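(* Let $\mathbf{C}$ be a possibly non-unital $C^{*}$-category and let $\mathbf{M}\mathbf{C}$ be its multiplier category as defined in the context. Then: (1) $\mathbf{M}\mathbf{C}$, with the norm $\|(L,R)\|:=\max\{\|L\|,\|R\|\}$, is a unital $C^{*}$-category (and in fact $\|L\|=\|R\|$); (2) the functor $\mathbf{C}\to\mathbf{M}\mathbf{C}$, identity on objects and $f\mapsto (f\circ -,\,-\circ f)$ on morphisms, is the inclusion of an ideal; (3) for every unital $C^{*}$-category $\mathbf{D}$ and every ideal inclusion $\mathbf{C}\to\mathbf{D}$ there exists a unique unital $*$-functor $\mathbf{D}\to\mathbf{M}\mathbf{C}$ whose composition with $\mathbf{C}\to\mathbf{D}$ is the functor $\mathbf{C}\to\mathbf{M}\mathbf{C}$.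
   Context: A possibly non-unital $C^*$-category is a $C^*$-category in which identity morphisms need not exist. For objects $C,D$ of $\mathbf{C}$, a multiplier morphism $C\to D$ is a pair $(L,R)$ where $L=(L_E)_{E}$ is a family of linear maps $L_E\colon \mathrm{Hom}(E,C)\to\mathrm{Hom}(E,D)$ with $L_F(hg)=L_E(h)g$ for all $h\colon E\to C$, $g\colon F\to E$ and $\|L\|:=\sup_E\|L_E\|<\infty$; $R=(R_E)_E$ is a family of linear maps $R_E\colon\mathrm{Hom}(D,E)\to\mathrm{Hom}(C,E)$ with $R_F(gh)=gR_E(h)$ for all $h\colon D\to E$, $g\colon E\to F$ and $\|R\|:=\sup_E\|R_E\|<\infty$; and $gL_F(f)=R_E(g)f$ for all $f\colon F\to C$, $g\colon D\to E$. The multiplier category $\mathbf{M}\mathbf{C}$ has the objects of $\mathbf{C}$, multiplier morphisms as morphisms, composition $(L',R')\circ(L,R):=(L'L,RR')$, and involution $(L,R)^*:=(R^*,L^* )$ with $L^*_E(f):=R_E(f^* )^*$ and $R^*_E(f):=L_E(f^* )^*$. A $*$-functor $i\colon\mathbf{C}\to\mathbf{D}$ between possibly non-unital $C^*$-categories is an ideal inclusion if it is bijective on objects, an isometric embedding with closed image on morphism spaces, and the composition of any morphism in the image of $i$ with any morphism of $\mathbf{D}$ lies in the image of $i$. *)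

theory Defs
  imports Complex_Main
begin

text \<open>A (possibly non-unital) C*-category, encoded with an object set and
  hom-indexed operations: every hom set Hom(C,D) carries its own zero, addition,
  scalar multiplication and norm. Composition c_comp C D E g f is g o f for
  f : C -> D, g : D -> E; involution c_star C D maps Hom(C,D) to Hom(D,C).\<close>

record ('o,'m) cstarcat =
  c_obj :: "'o set"
  c_hom :: "'o \<Rightarrow> 'o \<Rightarrow> 'm set"
  c_zero :: "'o \<Rightarrow> 'o \<Rightarrow> 'm"
  c_add :: "'o \<Rightarrow> 'o \<Rightarrow> 'm \<Rightarrow> 'm \<Rightarrow> 'm"
  c_scale :: "'o \<Rightarrow> 'o \<Rightarrow> complex \<Rightarrow> 'm \<Rightarrow> 'm"
  c_norm :: "'o \<Rightarrow> 'o \<Rightarrow> 'm \<Rightarrow> real"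
  c_comp :: "'o \<Rightarrow> 'o \<Rightarrow> 'o \<Rightarrow> 'm \<Rightarrow> 'm \<Rightarrow> 'm"
  c_star :: "'o \<Rightarrow> 'o \<Rightarrow> 'm \<Rightarrow> 'm"

definition banach_on ::
  "'m set \<Rightarrow> 'm \<Rightarrow> ('m \<Rightarrow> 'm \<Rightarrow> 'm) \<Rightarrow> (complex \<Rightarrow> 'm \<Rightarrow> 'm) \<Rightarrow> ('m \<Rightarrow> real) \<Rightarrow> bool" where
"banach_on V z ad sc nm \<longleftrightarrow>
  z \<in> V \<and> (\<forall>x\<in>V. \<forall>y\<in>V. ad x y \<in> V) \<and> (\<forall>a. \<forall>x\<in>V. sc a x \<in> V) \<and>
  (\<forall>x\<in>V. \<forall>y\<in>V. \<forall>w\<in>V. ad (ad x y) w = ad x (ad y w)) \<and>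
  (\<forall>x\<in>V. \<forall>y\<in>V. ad x y = ad y x) \<and>
  (\<forall>x\<in>V. ad z x = x) \<and>
  (\<forall>x\<in>V. \<exists>y\<in>V. ad x y = z) \<and>
  (\<forall>x\<in>V. sc 1 x = x) \<and>
  (\<forall>a b. \<forall>x\<in>V. sc a (sc b x) = sc (a * b) x) \<and>
  (\<forall>a b. \<forall>x\<in>V. sc (a + b) x = ad (sc a x) (sc b x)) \<and>
  (\<forall>a. \<forall>x\<in>V. \<forall>y\<in>V. sc a (ad x y) = ad (sc a x) (sc a y)) \<and>
  (\<forall>x\<in>V. nm x = 0 \<longleftrightarrow> x = z) \<and>
  (\<forall>x\<in>V. \<forall>y\<in>V. nm (ad x y) \<le> nm x + nm y) \<and>
  (\<forall>a. \<forall>x\<in>V. nm (sc a x) = cmod a * nm x) \<and>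
  (\<forall>X. (\<forall>n. X n \<in> V) \<and>
       (\<forall>e>0. \<exists>N. \<forall>m\<ge>N. \<forall>n\<ge>N. nm (ad (X m) (sc (-1) (X n))) < e) \<longrightarrow>
       (\<exists>x\<in>V. (\<lambda>n. nm (ad (X n) (sc (-1) x))) \<longlonglongrightarrow> 0))"

text \<open>Positivity of an element a of the (possibly non-unital) C*-algebra End(C):
  a is self-adjoint and its spectrum (computed in the unitization) lies in [0,oo).
  For lambda \<noteq> 0, lambda is not in the spectrum iff a - lambda 1 is invertible in the
  unitization, i.e. there is b with (a - lambda 1)(-1/lambda 1 + b) = 1 = (-1/lambda 1 + b)(a - lambda 1),
  i.e. a b - lambda b - a/lambda = 0 = b a - lambda b - a/lambda.\<close>
definition positive_el :: "('o,'m) cstarcat \<Rightarrow> 'o \<Rightarrow> 'm \<Rightarrow> bool" where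
"positive_el A C a \<longleftrightarrow>
  a \<in> c_hom A C C \<and> c_star A C C a = a \<and>
  (\<forall>l::complex. \<not> (l \<in> \<real> \<and> 0 \<le> Re l) \<longrightarrow>
     (\<exists>b\<in>c_hom A C C.
        c_add A C C (c_add A C C (c_comp A C C C a b) (c_scale A C C (- l) b))
                    (c_scale A C C (- (1 / l)) a) = c_zero A C C \<and>
        c_add A C C (c_add A C C (c_comp A C C C b a) (c_scale A C C (- l) b))
                    (c_scale A C C (- (1 / l)) a) = c_zero A C C))"

definition cstar_cat :: "('o,'m) cstarcat \<Rightarrow> bool" where
"cstar_cat A \<longleftrightarrow>
  (\<forall>C\<in>c_obj A. \<forall>D\<in>c_obj A.
     banach_on (c_hom A C D) (c_zero A C D) (c_add A C D) (c_scale A C D) (c_norm A C D)) \<and>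
  (\<forall>C\<in>c_obj A. \<forall>D\<in>c_obj A. \<forall>E\<in>c_obj A. \<forall>f\<in>c_hom A C D. \<forall>g\<in>c_hom A D E.
     c_comp A C D E g f \<in> c_hom A C E) \<and>
  (\<forall>C\<in>c_obj A. \<forall>D\<in>c_obj A. \<forall>E\<in>c_obj A. \<forall>F\<in>c_obj A.
     \<forall>f\<in>c_hom A C D. \<forall>g\<in>c_hom A D E. \<forall>h\<in>c_hom A E F.
     c_comp A C E F h (c_comp A C D E g f) = c_comp A C D F (c_comp A D E F h g) f) \<and>
  (\<forall>C\<in>c_obj A. \<forall>D\<in>c_obj A. \<forall>E\<in>c_obj A. \<forall>f\<in>c_hom A C D. \<forall>f'\<in>c_hom A C D. \<forall>g\<in>c_hom A D E.
     c_comp A C D E g (c_add A C D f f') = c_add A C E (c_comp A C D E g f) (c_comp A C D E g f')) \<and>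
  (\<forall>C\<in>c_obj A. \<forall>D\<in>c_obj A. \<forall>E\<in>c_obj A. \<forall>f\<in>c_hom A C D. \<forall>g\<in>c_hom A D E. \<forall>g'\<in>c_hom A D E.
     c_comp A C D E (c_add A D E g g') f = c_add A C E (c_comp A C D E g f) (c_comp A C D E g' f)) \<and>
  (\<forall>C\<in>c_obj A. \<forall>D\<in>c_obj A. \<forall>E\<in>c_obj A. \<forall>f\<in>c_hom A C D. \<forall>g\<in>c_hom A D E. \<forall>a.
     c_comp A C D E g (c_scale A C D a f) = c_scale A C E a (c_comp A C D E g f) \<and>
     c_comp A C D E (c_scale A D E a g) f = c_scale A C E a (c_comp A C D E g f)) \<and>
  (\<forall>C\<in>c_obj A. \<forall>D\<in>c_obj A. \<forall>E\<in>c_obj A. \<forall>f\<in>c_hom A C D. \<forall>g\<in>c_hom A D E.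
     c_norm A C E (c_comp A C D E g f) \<le> c_norm A D E g * c_norm A C D f) \<and>
  (\<forall>C\<in>c_obj A. \<forall>D\<in>c_obj A. \<forall>f\<in>c_hom A C D. c_star A C D f \<in> c_hom A D C) \<and>
  (\<forall>C\<in>c_obj A. \<forall>D\<in>c_obj A. \<forall>f\<in>c_hom A C D. \<forall>g\<in>c_hom A C D.
     c_star A C D (c_add A C D f g) = c_add A D C (c_star A C D f) (c_star A C D g)) \<and>
  (\<forall>C\<in>c_obj A. \<forall>D\<in>c_obj A. \<forall>f\<in>c_hom A C D. \<forall>a.
     c_star A C D (c_scale A C D a f) = c_scale A D C (cnj a) (c_star A C D f)) \<and>
  (\<forall>C\<in>c_obj A. \<forall>D\<in>c_obj A. \<forall>f\<in>c_hom A C D. c_star A D C (c_star A C D f) = f) \<and>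
  (\<forall>C\<in>c_obj A. \<forall>D\<in>c_obj A. \<forall>E\<in>c_obj A. \<forall>f\<in>c_hom A C D. \<forall>g\<in>c_hom A D E.
     c_star A C E (c_comp A C D E g f) = c_comp A E D C (c_star A C D f) (c_star A D E g)) \<and>
  (\<forall>C\<in>c_obj A. \<forall>D\<in>c_obj A. \<forall>f\<in>c_hom A C D.
     c_norm A C C (c_comp A C D C (c_star A C D f) f) = (c_norm A C D f)\<^sup>2) \<and>
  (\<forall>C\<in>c_obj A. \<forall>D\<in>c_obj A. \<forall>f\<in>c_hom A C D.
     positive_el A C (c_comp A C D C (c_star A C D f) f))"

definition is_unit :: "('o,'m) cstarcat \<Rightarrow> 'o \<Rightarrow> 'm \<Rightarrow> bool" where
"is_unit A C u \<longleftrightarrow> u \<in> c_hom A C C \<and>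
   (\<forall>D\<in>c_obj A. \<forall>f\<in>c_hom A C D. c_comp A C C D f u = f) \<and>
   (\<forall>D\<in>c_obj A. \<forall>g\<in>c_hom A D C. c_comp A D C C u g = g)"

definition unital :: "('o,'m) cstarcat \<Rightarrow> bool" where
"unital A \<longleftrightarrow> (\<forall>C\<in>c_obj A. \<exists>u. is_unit A C u)"

type_synonym ('o1,'m1,'o2,'m2) cfun = "('o1 \<Rightarrow> 'o2) \<times> ('o1 \<Rightarrow> 'o1 \<Rightarrow> 'm1 \<Rightarrow> 'm2)"

definition star_functor :: "('o1,'m1) cstarcat \<Rightarrow> ('o2,'m2) cstarcat \<Rightarrow> ('o1,'m1,'o2,'m2) cfun \<Rightarrow> bool" where
"star_functor A B F \<longleftrightarrow>
  (\<forall>C\<in>c_obj A. fst F C \<in> c_obj B) \<and>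
  (\<forall>C\<in>c_obj A. \<forall>D\<in>c_obj A. \<forall>f\<in>c_hom A C D. snd F C D f \<in> c_hom B (fst F C) (fst F D)) \<and>
  (\<forall>C\<in>c_obj A. \<forall>D\<in>c_obj A. \<forall>f\<in>c_hom A C D. \<forall>g\<in>c_hom A C D.
     snd F C D (c_add A C D f g) = c_add B (fst F C) (fst F D) (snd F C D f) (snd F C D g)) \<and>
  (\<forall>C\<in>c_obj A. \<forall>D\<in>c_obj A. \<forall>f\<in>c_hom A C D. \<forall>a.
     snd F C D (c_scale A C D a f) = c_scale B (fst F C) (fst F D) a (snd F C D f)) \<and>
  (\<forall>C\<in>c_obj A. \<forall>D\<in>c_obj A. \<forall>E\<in>c_obj A. \<forall>f\<in>c_hom A C D. \<forall>g\<in>c_hom A D E.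
     snd F C E (c_comp A C D E g f) = c_comp B (fst F C) (fst F D) (fst F E) (snd F D E g) (snd F C D f)) \<and>
  (\<forall>C\<in>c_obj A. \<forall>D\<in>c_obj A. \<forall>f\<in>c_hom A C D.
     snd F D C (c_star A C D f) = c_star B (fst F C) (fst F D) (snd F C D f))"

definition unital_functor :: "('o1,'m1) cstarcat \<Rightarrow> ('o2,'m2) cstarcat \<Rightarrow> ('o1,'m1,'o2,'m2) cfun \<Rightarrow> bool" where
"unital_functor A B F \<longleftrightarrow>
  (\<forall>C\<in>c_obj A. \<forall>u. is_unit A C u \<longrightarrow> is_unit B (fst F C) (snd F C C u))"

definition ideal_inclusion :: "('o1,'m1) cstarcat \<Rightarrow> ('o2,'m2) cstarcat \<Rightarrow> ('o1,'m1,'o2,'m2) cfun \<Rightarrow> bool" where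
"ideal_inclusion A B F \<longleftrightarrow>
  star_functor A B F \<and>
  bij_betw (fst F) (c_obj A) (c_obj B) \<and>
  (\<forall>C\<in>c_obj A. \<forall>D\<in>c_obj A. inj_on (snd F C D) (c_hom A C D)) \<and>
  (\<forall>C\<in>c_obj A. \<forall>D\<in>c_obj A. \<forall>f\<in>c_hom A C D.
     c_norm B (fst F C) (fst F D) (snd F C D f) = c_norm A C D f) \<and>
  (\<forall>C\<in>c_obj A. \<forall>D\<in>c_obj A. \<forall>X g.
     (\<forall>n. X n \<in> snd F C D ` c_hom A C D) \<and> g \<in> c_hom B (fst F C) (fst F D) \<and>
     (\<lambda>n. c_norm B (fst F C) (fst F D)
            (c_add B (fst F C) (fst F D) (X n) (c_scale B (fst F C) (fst F D) (-1) g))) \<longlonglongrightarrow> 0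
     \<longrightarrow> g \<in> snd F C D ` c_hom A C D) \<and>
  (\<forall>C\<in>c_obj A. \<forall>D\<in>c_obj A. \<forall>E\<in>c_obj A. \<forall>f\<in>c_hom A C D. \<forall>g\<in>c_hom B (fst F D) (fst F E).
     c_comp B (fst F C) (fst F D) (fst F E) g (snd F C D f) \<in> snd F C E ` c_hom A C E) \<and>
  (\<forall>C\<in>c_obj A. \<forall>D\<in>c_obj A. \<forall>E\<in>c_obj A. \<forall>f\<in>c_hom A C D. \<forall>g\<in>c_hom B (fst F E) (fst F C).
     c_comp B (fst F E) (fst F C) (fst F D) (snd F C D f) g \<in> snd F E D ` c_hom A E D)"

definition functor_comp :: "('o1,'m1,'o2,'m2) cfun \<Rightarrow> ('o2,'m2,'o3,'m3) cfun \<Rightarrow> ('o1,'m1,'o3,'m3) cfun" where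
"functor_comp F G = (\<lambda>C. fst G (fst F C), \<lambda>C D f. snd G (fst F C) (fst F D) (snd F C D f))"

definition functor_eq_on :: "('o1,'m1) cstarcat \<Rightarrow> ('o1,'m1,'o2,'m2) cfun \<Rightarrow> ('o1,'m1,'o2,'m2) cfun \<Rightarrow> bool" where
"functor_eq_on A F G \<longleftrightarrow>
  (\<forall>C\<in>c_obj A. fst F C = fst G C) \<and>
  (\<forall>C\<in>c_obj A. \<forall>D\<in>c_obj A. \<forall>f\<in>c_hom A C D. snd F C D f = snd G C D f)"

type_synonym ('o,'m) mult = "('o \<Rightarrow> 'm \<Rightarrow> 'm) \<times> ('o \<Rightarrow> 'm \<Rightarrow> 'm)"

text \<open>Multiplier morphisms C -> D: L E : Hom(E,C) -> Hom(E,D), R E : Hom(D,E) -> Hom(C,E);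
  families are made extensional (undefined outside their domains) so that equality of
  multiplier morphisms is equality of the families on their domains.\<close>
definition mult_hom :: "('o,'m) cstarcat \<Rightarrow> 'o \<Rightarrow> 'o \<Rightarrow> ('o,'m) mult set" where
"mult_hom A C D = {(L, R). C \<in> c_obj A \<and> D \<in> c_obj A \<and>
  (\<forall>E\<in>c_obj A. \<forall>h\<in>c_hom A E C. L E h \<in> c_hom A E D) \<and>
  (\<forall>E h. (E \<notin> c_obj A \<or> h \<notin> c_hom A E C) \<longrightarrow> L E h = undefined) \<and>
  (\<forall>E\<in>c_obj A. \<forall>h\<in>c_hom A E C. \<forall>h'\<in>c_hom A E C.
     L E (c_add A E C h h') = c_add A E D (L E h) (L E h')) \<and>
  (\<forall>E\<in>c_obj A. \<forall>h\<in>c_hom A E C. \<forall>a. L E (c_scale A E C a h) = c_scale A E D a (L E h)) \<and>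
  (\<forall>E\<in>c_obj A. \<forall>F\<in>c_obj A. \<forall>h\<in>c_hom A E C. \<forall>g\<in>c_hom A F E.
     L F (c_comp A F E C h g) = c_comp A F E D (L E h) g) \<and>
  (\<exists>K. \<forall>E\<in>c_obj A. \<forall>h\<in>c_hom A E C. c_norm A E D (L E h) \<le> K * c_norm A E C h) \<and>
  (\<forall>E\<in>c_obj A. \<forall>h\<in>c_hom A D E. R E h \<in> c_hom A C E) \<and>
  (\<forall>E h. (E \<notin> c_obj A \<or> h \<notin> c_hom A D E) \<longrightarrow> R E h = undefined) \<and>
  (\<forall>E\<in>c_obj A. \<forall>h\<in>c_hom A D E. \<forall>h'\<in>c_hom A D E.
     R E (c_add A D E h h') = c_add A C E (R E h) (R E h')) \<and>
  (\<forall>E\<in>c_obj A. \<forall>h\<in>c_hom A D E. \<forall>a. R E (c_scale A D E a h) = c_scale A C E a (R E h)) \<and>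
  (\<forall>E\<in>c_obj A. \<forall>F\<in>c_obj A. \<forall>h\<in>c_hom A D E. \<forall>g\<in>c_hom A E F.
     R F (c_comp A D E F g h) = c_comp A C E F g (R E h)) \<and>
  (\<exists>K. \<forall>E\<in>c_obj A. \<forall>h\<in>c_hom A D E. c_norm A C E (R E h) \<le> K * c_norm A D E h) \<and>
  (\<forall>E\<in>c_obj A. \<forall>F\<in>c_obj A. \<forall>f\<in>c_hom A F C. \<forall>g\<in>c_hom A D E.
     c_comp A F D E g (L F f) = c_comp A F C E (R E g) f)}"

text \<open>||L|| = sup_E ||L_E|| (operator norms); 0 is inserted to cover the empty case.\<close>
definition mult_normL :: "('o,'m) cstarcat \<Rightarrow> 'o \<Rightarrow> 'o \<Rightarrow> ('o \<Rightarrow> 'm \<Rightarrow> 'm) \<Rightarrow> real" where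
"mult_normL A C D L = Sup (insert 0 {c_norm A E D (L E h) | E h.
    E \<in> c_obj A \<and> h \<in> c_hom A E C \<and> c_norm A E C h \<le> 1})"

definition mult_normR :: "('o,'m) cstarcat \<Rightarrow> 'o \<Rightarrow> 'o \<Rightarrow> ('o \<Rightarrow> 'm \<Rightarrow> 'm) \<Rightarrow> real" where
"mult_normR A C D R = Sup (insert 0 {c_norm A C E (R E h) | E h.
    E \<in> c_obj A \<and> h \<in> c_hom A D E \<and> c_norm A D E h \<le> 1})"

definition mult_cat :: "('o,'m) cstarcat \<Rightarrow> ('o, ('o,'m) mult) cstarcat" where
"mult_cat A = \<lparr>
  c_obj = c_obj A,
  c_hom = mult_hom A,
  c_zero = (\<lambda>C D.
     (\<lambda>E h. if E \<in> c_obj A \<and> h \<in> c_hom A E C then c_zero A E D else undefined,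
      \<lambda>E h. if E \<in> c_obj A \<and> h \<in> c_hom A D E then c_zero A C E else undefined)),
  c_add = (\<lambda>C D LR LR'.
     (\<lambda>E h. if E \<in> c_obj A \<and> h \<in> c_hom A E C
             then c_add A E D (fst LR E h) (fst LR' E h) else undefined,
      \<lambda>E h. if E \<in> c_obj A \<and> h \<in> c_hom A D E
             then c_add A C E (snd LR E h) (snd LR' E h) else undefined)),
  c_scale = (\<lambda>C D a LR.
     (\<lambda>E h. if E \<in> c_obj A \<and> h \<in> c_hom A E C
             then c_scale A E D a (fst LR E h) else undefined,
      \<lambda>E h. if E \<in> c_obj A \<and> h \<in> c_hom A D E
             then c_scale A C E a (snd LR E h) else undefined)),
  c_norm = (\<lambda>C D LR. max (mult_normL A C D (fst LR)) (mult_normR A C D (snd LR))),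
  c_comp = (\<lambda>C D E LR' LR.
     (\<lambda>F h. if F \<in> c_obj A \<and> h \<in> c_hom A F C then fst LR' F (fst LR F h) else undefined,
      \<lambda>F h. if F \<in> c_obj A \<and> h \<in> c_hom A E F then snd LR F (snd LR' F h) else undefined)),
  c_star = (\<lambda>C D LR.
     (\<lambda>E f. if E \<in> c_obj A \<and> f \<in> c_hom A E D
             then c_star A C E (snd LR E (c_star A E D f)) else undefined,
      \<lambda>E f. if E \<in> c_obj A \<and> f \<in> c_hom A C E
             then c_star A E D (fst LR E (c_star A C E f)) else undefined))
  \<rparr>"

definition mult_embed :: "('o,'m) cstarcat \<Rightarrow> ('o,'m,'o,('o,'m) mult) cfun" where
"mult_embed A = (\<lambda>C. C, \<lambda>C D f.
   (\<lambda>E h. if E \<in> c_obj A \<and> h \<in> c_hom A E C then c_comp A E C D f h else undefined,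
    \<lambda>E h. if E \<in> c_obj A \<and> h \<in> c_hom A D E then c_comp A C D E h f else undefined))"

end

theory Submission
  imports Defs
begin

text \<open>A multiplier is determined by the compatibility \<open>g L(f) = R(g) f\<close>: composition in a
  C*-category separates morphisms, so linearity, the module property and the equality of the two
  norms all follow from it, and the C*-identity is inherited from
  \<open>(T f)\<^sup>* (T f) = f\<^sup>* (T\<^sup>* T) f\<close>.

  The serious point is that \<open>T\<^sup>* T\<close> has spectrum in \<open>[0,\<infinity>)\<close>. For \<open>s > 0\<close> the positive
  elements \<open>p = (T f)\<^sup>* (T f)\<close> and \<open>q = s f\<^sup>* f\<close> satisfy \<open>\<parallel>q\<parallel> \<le> \<parallel>p + q\<parallel>\<close>, so \<open>T\<^sup>* T + s\<close> is bounded
  below by \<open>s\<close>; for nonreal \<open>l\<close> the self-adjoint element \<open>T\<^sup>* T - l\<close> is bounded below by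
  \<open>\<bar>Im l\<bar>\<close>. Invertibility then propagates, by steps of fixed size, from large \<open>l\<close> to every
  \<open>l\<close> outside \<open>[0,\<infinity>)\<close>. The norm estimate for \<open>p\<close> and \<open>q\<close> rests on the spectral radius formula
  for self-adjoint elements, proved by averaging resolvents over roots of unity of order \<open>2\<^sup>n\<close>.

  A morphism \<open>b\<close> of a unital category containing the given one as an ideal acts on the ideal by
  composition; this multiplier is the only possible value at \<open>b\<close> of an extension.\<close>

section \<open>Spectra in seminormed C*-algebras\<close>

text \<open>Positivity resists a pointwise proof because it asks for inverses in the unitization: an
  inverse of \<open>T\<^sup>* T - l\<close> is not given by inverses of elements of the original
  category. Norm estimates, however, can be tested pointwise, and an element joined to an invertible
  one by a segment with a common lower bound is invertible. This is why lower bounds carry the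
  argument.

  There is no circle in comparing positive elements of a category without units inside its
  multiplier category: all axioms but positivity are established there first, units are present
  there, and the comparison rests on these facts alone.

  The function \<open>N\<close> is only a seminorm, and inverses are taken up to elements of
  seminorm zero, because the arithmetic takes place in one ring that is a product of many
  endomorphism algebras, while the norm of a single factor is considered at a time. Scalars enter as
  central ring elements \<open>k a\<close>, so that ring normalisation covers them.\<close>

locale seminormed_cstar_algebra =
  fixes k :: "complex \<Rightarrow> 'a::{ring,monoid_mult}"
    and star :: "'a \<Rightarrow> 'a"
    and N :: "'a \<Rightarrow> real"
  assumes k_add: "k (a + b) = k a + k b"
    and k_mult: "k (a * b) = k a * k b"
    and k_one: "k 1 = 1"
    and k_central: "x * k a = k a * x"
    and star_diff: "star (x - y) = star x - star y"
    and star_mult: "star (x * y) = star y * star x"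
    and star_star: "star (star x) = x"
    and star_k: "star (k a) = k (cnj a)"
    and N_triangle: "N (x + y) \<le> N x + N y"
    and N_mult: "N (x * y) \<le> N x * N y"
    and N_k: "N (k a * x) = cmod a * N x"
    and N_cstar: "N (star x * x) = (N x)\<^sup>2"
    and N_complete: "(\<And>e. e > 0 \<Longrightarrow> \<exists>M. \<forall>m\<ge>M. \<forall>n\<ge>M. N (X m - X n) < e) \<Longrightarrow>
      \<exists>x. (\<lambda>n. N (X n - x)) \<longlonglongrightarrow> 0"
begin

section \<open>Arithmetic of the scalars and the seminorm\<close>

lemma k_zero: "k 0 = 0"
  using k_add[of 0 0] by simp

lemma k_minus: "k (- a) = - k a"
  using k_add[of a "- a"] by (simp add: k_zero eq_neg_iff_add_eq_0 add.commute)

lemma k_diff: "k (a - b) = k a - k b"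
  using k_add[of a "- b"] by (simp add: k_minus)

lemma k_left_commute: "x * (k a * y) = k a * (x * y)"
  by (metis k_central mult.assoc)

lemma k_fold: "k a * (k b * x) = k (a * b) * x"
  by (simp add: k_mult mult.assoc)

lemma N_zero: "N 0 = 0"
  using N_k[of 0 0] by (simp add: k_zero)

lemma N_minus: "N (- x) = N x"
  using N_k[of "-1" x] by (simp add: k_minus k_one)

lemma N_nonneg: "0 \<le> N x"
  using N_triangle[of x "- x"] by (simp add: N_minus N_zero)

lemma N_triangle_diff: "N (x - y) \<le> N x + N y"
  using N_triangle[of x "- y"] by (simp add: N_minus)

lemma N_diff_ge: "N x - N y \<le> N (x - y)"
  using N_triangle[of "x - y" y] by simp

lemma star_zero: "star 0 = 0"
  using star_diff[of 0 0] by simp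

lemma star_add: "star (x + y) = star x + star y"
  using star_diff[of x "0 - y"] star_diff[of 0 y] by (simp add: star_zero)

lemma star_one: "star 1 = 1"
  using star_k[of 1] by (simp add: k_one)

text \<open>By the C*-identity \<open>N 1\<close> equals its own square, so it is 0 or 1. The value
  0 means that \<open>N\<close> vanishes identically, as it does at an object whose only
  endomorphism is zero; hence an inequality.\<close>

lemma N_one_le: "N 1 \<le> 1"
proof -
  have "N 1 = N 1 * N 1"
    using N_cstar[of 1] by (simp add: star_one power2_eq_square)
  then show ?thesis by (cases "N 1 = 0") auto
qed

lemma N_star: "N (star x) = N x"
proof -
  have le: "N y \<le> N (star y)" for y
  proof (cases "N y = 0")
    case True then show ?thesis using N_nonneg[of "star y"] by simp
  next
    case False
    have "N y * N y \<le> N (star y) * N y"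
      using N_mult[of "star y" y] by (simp add: N_cstar power2_eq_square)
    then show ?thesis
      using False N_nonneg[of y] by (simp add: mult_le_cancel_right)
  qed
  show ?thesis using le[of x] le[of "star x"] by (simp add: star_star)
qed

lemma null_add: "N x = 0 \<Longrightarrow> N y = 0 \<Longrightarrow> N (x + y) = 0"
  using N_triangle[of x y] N_nonneg[of "x + y"] by simp

lemma null_diff: "N x = 0 \<Longrightarrow> N y = 0 \<Longrightarrow> N (x - y) = 0"
  using null_add[of x "- y"] by (simp add: N_minus)

lemma null_mult_left: "N x = 0 \<Longrightarrow> N (x * y) = 0"
  using N_mult[of x y] N_nonneg[of "x * y"] by simp

lemma null_mult_right: "N x = 0 \<Longrightarrow> N (y * x) = 0"
  using N_mult[of y x] N_nonneg[of "y * x"] by simp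

lemma N_cong: "N (x - y) = 0 \<Longrightarrow> N x = N y"
  using N_diff_ge[of x y] N_diff_ge[of y x] N_minus[of "x - y"] by simp

lemma N_power: "N (x ^ n) \<le> N x ^ n"
proof (induction n)
  case 0 then show ?case using N_one_le by simp
next
  case (Suc n)
  have "N (x ^ Suc n) \<le> N x * N (x ^ n)" using N_mult[of x "x ^ n"] by simp
  also have "\<dots> \<le> N x * N x ^ n" using Suc N_nonneg[of x] by (simp add: mult_left_mono)
  finally show ?case by simp
qed

lemma N_sum: "finite I \<Longrightarrow> N (sum f I) \<le> (\<Sum>i\<in>I. N (f i))"
proof (induction I rule: finite_induct)
  case empty then show ?case by (simp add: N_zero)
next
  case (insert a I)
  then show ?case using N_triangle[of "f a" "sum f I"] by simp
qed

section \<open>Inverses modulo null elements\<close>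

definition is_inv :: "'a \<Rightarrow> 'a \<Rightarrow> bool" where
  "is_inv x y \<longleftrightarrow> N (x * y - 1) = 0 \<and> N (y * x - 1) = 0"

definition invertible :: "'a \<Rightarrow> bool" where
  "invertible x \<longleftrightarrow> (\<exists>y. is_inv x y)"

text \<open>Such a bound can be established without knowing that an inverse exists, and it controls
  the norm of an inverse as soon as there is one.\<close>

definition lower_bound :: "'a \<Rightarrow> real \<Rightarrow> bool" where
  "lower_bound x c \<longleftrightarrow> (\<forall>m. c * N m \<le> N (x * m))"

lemma lower_bound_mono:
  assumes "lower_bound x c" "b \<le> c"
  shows "lower_bound x b"
  using assms mult_right_mono[OF assms(2) N_nonneg] unfolding lower_bound_def by (meson order_trans)

text \<open>Neumann series. The partial sums are compared with a real geometric series; completeness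
  supplies a limit that is unique only up to null elements, and so the conclusion is again modulo
  null elements.\<close>

lemma invertible_geometric:
  assumes "N d < 1"
  shows "invertible (1 - d)"
proof -
  let ?t = "N d"
  let ?X = "\<lambda>n. \<Sum>i<n. d ^ i"
  let ?s = "\<lambda>n. \<Sum>i<n. ?t ^ i"
  have t: "0 \<le> ?t" by (rule N_nonneg)
  have half: "N (?X m - ?X n) \<le> \<bar>?s m - ?s n\<bar>" if "n \<le> m" for m n
  proof -
    have "?X m = ?X n + (\<Sum>i\<in>{n..<m}. d ^ i)"
      using that by (metis lessThan_atLeast0 sum.atLeastLessThan_concat zero_le)
    then have "N (?X m - ?X n) = N (\<Sum>i\<in>{n..<m}. d ^ i)" by simp
    also have "\<dots> \<le> (\<Sum>i\<in>{n..<m}. N (d ^ i))" by (rule N_sum) simp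
    also have "\<dots> \<le> (\<Sum>i\<in>{n..<m}. ?t ^ i)" by (rule sum_mono) (rule N_power)
    also have "\<dots> = ?s m - ?s n"
      using that by (metis add_diff_cancel_left' lessThan_atLeast0 sum.atLeastLessThan_concat zero_le)
    finally show ?thesis by simp
  qed
  have diff: "N (?X m - ?X n) \<le> \<bar>?s m - ?s n\<bar>" for m n
  proof (cases "n \<le> m")
    case True then show ?thesis by (rule half)
  next
    case False
    then have "N (?X n - ?X m) \<le> \<bar>?s n - ?s m\<bar>" by (intro half) simp
    then show ?thesis using N_minus[of "?X n - ?X m"] by (simp add: abs_minus_commute)
  qed
  have "summable (\<lambda>i. ?t ^ i)" using assms t by (simp add: summable_geometric)
  then have "Cauchy ?s" by (simp add: summable_iff_convergent convergent_Cauchy)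
  then have "\<exists>M. \<forall>m\<ge>M. \<forall>n\<ge>M. N (?X m - ?X n) < e" if "e > 0" for e
    using that diff unfolding Cauchy_def dist_real_def by (meson le_less_trans)
  then obtain z where z: "(\<lambda>n. N (?X n - z)) \<longlonglongrightarrow> 0"
    using N_complete[of ?X] by blast
  have right: "(1 - d) * ?X n = 1 - d ^ n" for n
    by (induction n) (simp_all add: distrib_left, simp add: left_diff_distrib)
  have left: "?X n * (1 - d) = 1 - d ^ n" for n
    by (induction n) (simp_all add: distrib_right, simp add: right_diff_distrib power_commutes)
  have lim: "(\<lambda>n. N (1 - d) * N (?X n - z) + ?t ^ n) \<longlonglongrightarrow> 0"
    using tendsto_add[OF tendsto_mult_right[OF z, of "N (1 - d)"] LIMSEQ_realpow_zero[OF t assms]]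
    by (simp add: mult.commute)
  have small: "N (w - 1) \<le> 0"
    if "\<And>n. N (w - 1) \<le> N (1 - d) * N (?X n - z) + ?t ^ n" for w
    using LIMSEQ_le_const[OF lim] that by blast
  have "N ((1 - d) * z - 1) \<le> N (1 - d) * N (?X n - z) + ?t ^ n" for n
  proof -
    have "(1 - d) * z - 1 = - ((1 - d) * (?X n - z) + d ^ n)"
      using right[of n] by (simp add: algebra_simps)
    then have "N ((1 - d) * z - 1) \<le> N ((1 - d) * (?X n - z)) + N (d ^ n)"
      using N_triangle N_minus by metis
    then show ?thesis using N_mult[of "1 - d" "?X n - z"] N_power[of d n] by simp
  qed
  moreover have "N (z * (1 - d) - 1) \<le> N (1 - d) * N (?X n - z) + ?t ^ n" for n
  proof -
    have "z * (1 - d) - 1 = - ((?X n - z) * (1 - d) + d ^ n)"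
      using left[of n] by (simp add: algebra_simps)
    then have "N (z * (1 - d) - 1) \<le> N ((?X n - z) * (1 - d)) + N (d ^ n)"
      using N_triangle N_minus by metis
    then show ?thesis using N_mult[of "?X n - z" "1 - d"] N_power[of d n] by (simp add: mult.commute)
  qed
  ultimately have "is_inv (1 - d) z"
    unfolding is_inv_def using small N_nonneg by (metis order_antisym)
  then show ?thesis unfolding invertible_def by blast
qed

text \<open>Up to null elements \<open>x + d\<close> is \<open>x * (1 + y * d)\<close>. The second
  factor is inverted by a Neumann series, and \<open>w * y\<close> is the resulting inverse.\<close>

lemma invertible_perturb:
  assumes "is_inv x y" "N d * N y < 1"
  shows "invertible (x + d)"
proof -
  have "N (- (y * d)) < 1" using N_mult[of y d] assms(2) by (simp add: N_minus mult.commute)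
  from invertible_geometric[OF this] obtain w where w: "is_inv (1 + y * d) w"
    unfolding invertible_def by auto
  have xy: "N (x * y - 1) = 0" "N (y * x - 1) = 0" using assms(1) by (auto simp: is_inv_def)
  have yw: "N ((1 + y * d) * w - 1) = 0" "N (w * (1 + y * d) - 1) = 0"
    using w by (auto simp: is_inv_def)
  \<comment> \<open>Each defect is written as an exact combination of products that contain a null
    factor, so the null lemmas dispose of it term by term.\<close>
  have "(x + d) * (w * y) - 1 = x * (((1 + y * d) * w - 1) * y) + (x * y - 1) - (x * y - 1) * (d * w * y)"
    by (simp add: algebra_simps)
  moreover have "(w * y) * (x + d) - 1 = (w * (1 + y * d) - 1) + w * (y * x - 1)"
    by (simp add: algebra_simps)
  ultimately have "is_inv (x + d) (w * y)"
    unfolding is_inv_def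
    by (simp only:) (intro conjI null_add null_diff xy yw null_mult_right[OF null_mult_left[OF yw(1)]]
        null_mult_left[OF xy(1)] null_mult_right[OF xy(2)])
  then show ?thesis unfolding invertible_def by blast
qed

text \<open>Since \<open>m\<close> is \<open>y * (x * m)\<close> up to a null element,
  \<open>N m\<close> is at most \<open>N y * N (x * m)\<close>. The added 1 keeps the denominator
  positive, also when \<open>N y = 0\<close>.\<close>

lemma is_inv_lower_bound:
  assumes "is_inv x y"
  shows "lower_bound x (1 / (N y + 1))"
  unfolding lower_bound_def
proof
  fix m
  have "N (y * (x * m) - m) = 0"
    using null_mult_left[of "y * x - 1" m] assms by (simp add: is_inv_def algebra_simps)
  then have "N m = N (y * (x * m))" by (simp add: N_cong)
  also have "\<dots> \<le> N y * N (x * m)" by (rule N_mult)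
  also have "\<dots> \<le> (N y + 1) * N (x * m)" using N_nonneg[of "x * m"] by (simp add: distrib_right)
  finally show "1 / (N y + 1) * N m \<le> N (x * m)"
    using N_nonneg[of y] by (simp add: divide_le_eq mult.commute)
qed

lemma is_inv_N_le:
  assumes "is_inv x y" "lower_bound x c" "c > 0"
  shows "N y \<le> 1 / c"
proof -
  have "c * N y \<le> N (x * y)" using assms(2) by (simp add: lower_bound_def)
  also have "\<dots> = N 1" using assms(1) by (simp add: is_inv_def N_cong)
  also have "\<dots> \<le> 1" by (rule N_one_le)
  finally show ?thesis using assms(3) by (simp add: le_divide_eq mult.commute)
qed

text \<open>The admissible size of \<open>d\<close> depends on the lower bound alone and not on the
  inverse at hand. This uniformity permits finitely many equal steps along a segment.\<close>

lemma invertible_perturb_lower_bound: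
  assumes "invertible x" "lower_bound x c" "N d < c"
  shows "invertible (x + d)"
proof -
  obtain y where y: "is_inv x y" using assms(1) by (auto simp: invertible_def)
  have c: "c > 0" using assms(3) N_nonneg[of d] by simp
  have "N d * N y \<le> N d * (1 / c)"
    using is_inv_N_le[OF y assms(2) c] N_nonneg by (rule mult_left_mono)
  also have "\<dots> < 1" using c assms(3) by simp
  finally show ?thesis by (rule invertible_perturb[OF y])
qed

lemma invertible_k_mult:
  assumes "invertible x" "c \<noteq> 0"
  shows "invertible (k c * x)"
proof -
  obtain y where y: "is_inv x y" using assms(1) by (auto simp: invertible_def)
  have "(k c * x) * (k (1 / c) * y) = x * y" "(k (1 / c) * y) * (k c * x) = y * x"
    using assms(2) by (simp_all add: mult.assoc k_left_commute[of x] k_left_commute[of y] k_fold k_one)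
  then have "is_inv (k c * x) (k (1 / c) * y)" using y by (simp add: is_inv_def)
  then show ?thesis by (auto simp: invertible_def)
qed

lemma invertible_minus: "invertible x \<Longrightarrow> invertible (- x)"
  using invertible_k_mult[of x "-1"] by (simp add: k_minus k_one)

lemma invertible_minus_k:
  assumes "N a < cmod l"
  shows "invertible (a - k l)"
proof -
  have l: "l \<noteq> 0" using assms N_nonneg[of a] by auto
  have "N (k (1 / l) * a) < 1" using assms l by (simp add: N_k norm_divide)
  then have "invertible (k (- l) * (1 - k (1 / l) * a))"
    using l by (intro invertible_k_mult invertible_geometric) auto
  moreover have "k (- l) * (1 - k (1 / l) * a) = a - k l"
    using l by (simp add: right_diff_distrib k_fold k_minus k_one)
  ultimately show ?thesis by simp
qed

section \<open>Resolvents of self-adjoint elements\<close>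

lemma invertible_along_segment:
  assumes inv: "invertible (a - k l)"
    and lb: "\<And>t. 0 \<le> t \<Longrightarrow> t \<le> 1 \<Longrightarrow> lower_bound (a - k (l + of_real t * v)) c"
    and c: "c > 0"
  shows "invertible (a - k (l + v))"
proof -
  \<comment> \<open>With more than \<open>cmod v / c\<close> steps each one is shorter than the
    perturbation radius \<open>c\<close>, which is common to the whole segment.\<close>
  obtain M :: nat where M: "cmod v / c < real M" using reals_Archimedean2 by blast
  then have M0: "M > 0" using c by (metis divide_nonneg_pos gr0I norm_ge_zero not_le of_nat_0)
  have "invertible (a - k (l + of_real (real n / real M) * v))" if "n \<le> M" for n
    using that
  proof (induction n)
    case 0 then show ?case using inv by simp
  next
    case (Suc n)
    let ?l = "l + of_real (real n / real M) * v"
    have "invertible (a - k ?l + k (- (v / of_nat M)))"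
    proof (rule invertible_perturb_lower_bound)
      show "invertible (a - k ?l)" using Suc by simp
      show "lower_bound (a - k ?l) c" using Suc.prems M0 by (intro lb) auto
      have "N (k (- (v / of_nat M))) \<le> cmod v / real M"
        using N_k[of "- (v / of_nat M)" 1] mult_left_mono[OF N_one_le, of "cmod v / real M"]
        by (simp add: norm_divide)
      also have "\<dots> < c" using M M0 c by (simp add: divide_less_eq mult.commute)
      finally show "N (k (- (v / of_nat M))) < c" .
    qed
    moreover have "a - k ?l + k (- (v / of_nat M)) = a - k (?l + v / of_nat M)"
      by (simp add: k_add k_minus algebra_simps)
    moreover have "?l + v / of_nat M = l + of_real (real (Suc n) / real M) * v"
      using M0 by (simp add: field_simps)
    ultimately show ?case by metis
  qed
  from this[of M] show ?thesis using M0 by simp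
qed

text \<open>For \<open>w = m\<^sup>* (a - l) m\<close> the contribution of \<open>a\<close> cancels
  in \<open>w\<^sup>* - w\<close>, leaving \<open>(l - cnj l) m\<^sup>* m\<close>. The C*-identity
  evaluates its norm as \<open>2 \<bar>Im l\<bar> (N m)\<^sup>2\<close>, and the triangle inequality
  bounds it by \<open>2 N w\<close>.\<close>

lemma self_adjoint_lower_bound:
  assumes "star a = a"
  shows "lower_bound (a - k l) \<bar>Im l\<bar>"
  unfolding lower_bound_def
proof
  fix m
  let ?w = "star m * ((a - k l) * m)"
  have "star ?w - ?w = k (l - cnj l) * (star m * m)"
    by (simp add: star_mult star_star star_diff star_k assms k_diff left_diff_distrib right_diff_distrib
        mult.assoc k_left_commute k_central)
  also have "l - cnj l = of_real (2 * Im l) * \<i>" by (simp add: complex_diff_cnj)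
  finally have "2 * \<bar>Im l\<bar> * (N m)\<^sup>2 = N (star ?w - ?w)"
    by (simp add: N_k N_cstar norm_mult)
  also have "\<dots> \<le> 2 * N ?w" using N_triangle_diff[of "star ?w" ?w] by (simp add: N_star)
  also have "N ?w \<le> N m * N ((a - k l) * m)" using N_mult[of "star m" "(a - k l) * m"] by (simp add: N_star)
  finally have "N m * (\<bar>Im l\<bar> * N m) \<le> N m * N ((a - k l) * m)"
    by (simp add: power2_eq_square algebra_simps)
  then show "\<bar>Im l\<bar> * N m \<le> N ((a - k l) * m)"
    using N_nonneg[of m] N_nonneg[of "(a - k l) * m"] by (cases "N m = 0") auto
qed

lemma self_adjoint_nonreal_resolvent:
  assumes "star a = a" "Im l \<noteq> 0"
  shows "invertible (a - k l)"
proof -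
  \<comment> \<open>The segment starts at \<open>l - ?v\<close>, which lies \<open>N a + 1\<close>
    farther from the real axis on the same side as \<open>l\<close>, hence outside the disc of
    radius \<open>N a\<close>. On the way to \<open>l\<close> the imaginary part never falls below
    \<open>\<bar>Im l\<bar>\<close> in absolute value.\<close>
  let ?v = "- (of_real (sgn (Im l) * (N a + 1)) * \<i>)"
  have im: "\<bar>Im l\<bar> \<le> \<bar>Im (l - ?v + of_real t * ?v)\<bar>" if "t \<le> 1" for t
  proof -
    have "Im (l - ?v + of_real t * ?v) = sgn (Im l) * (\<bar>Im l\<bar> + (1 - t) * (N a + 1))"
      by (simp add: algebra_simps sgn_if abs_if)
    then show ?thesis using that assms(2) N_nonneg[of a] by (simp add: abs_mult)
  qed
  have "invertible (a - k (l - ?v + ?v))"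
  proof (rule invertible_along_segment)
    have "Im (l - ?v) = sgn (Im l) * (\<bar>Im l\<bar> + (N a + 1))" by (simp add: algebra_simps sgn_if abs_if)
    then have "\<bar>Im (l - ?v)\<bar> = \<bar>Im l\<bar> + (N a + 1)" using assms(2) N_nonneg[of a] by (simp add: abs_mult)
    then have "N a < cmod (l - ?v)" using abs_Im_le_cmod[of "l - ?v"] by linarith
    then show "invertible (a - k (l - ?v))" by (rule invertible_minus_k)
    fix t :: real assume "0 \<le> t" "t \<le> 1"
    then show "lower_bound (a - k (l - ?v + of_real t * ?v)) \<bar>Im l\<bar>"
      using self_adjoint_lower_bound[OF assms(1)] im lower_bound_mono by blast
  qed (use assms(2) in simp)
  then show ?thesis by simp
qed

lemma resolvent_off_half_line:
  assumes "star a = a"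
    and lb: "\<And>s. s > 0 \<Longrightarrow> lower_bound (a + k (of_real s)) s"
    and l: "\<not> (l \<in> \<real> \<and> 0 \<le> Re l)"
  shows "invertible (a - k l)"
proof (cases "Im l = 0")
  case False
  then show ?thesis using self_adjoint_nonreal_resolvent assms(1) by blast
next
  case True
  define r where "r = - Re l"
  have l_r: "l = of_real (- r)" using True by (simp add: r_def complex_eq_iff)
  have r: "r > 0" using l True by (auto simp: r_def complex_is_Real_iff)
  \<comment> \<open>For negative \<open>l\<close> the approach is along the real axis from the left;
    the lower bounds \<open>s\<close> met on the way are all at least \<open>r\<close>.\<close>
  let ?v = "of_real (N a + 1) :: complex"
  have "invertible (a - k (l - ?v + ?v))"
  proof (rule invertible_along_segment)
    have "l - ?v = of_real (- (r + N a + 1))" by (simp add: l_r)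
    then have "cmod (l - ?v) = r + N a + 1" using r N_nonneg[of a] by (simp only: norm_of_real)
    then show "invertible (a - k (l - ?v))" using r by (intro invertible_minus_k) simp
    fix t :: real assume t: "0 \<le> t" "t \<le> 1"
    define s where "s = r + (1 - t) * (N a + 1)"
    have s: "s \<ge> r" using t N_nonneg[of a] by (simp add: s_def)
    have "l - ?v + of_real t * ?v = - of_real s" by (simp add: s_def l_r algebra_simps)
    then have eq: "a - k (l - ?v + of_real t * ?v) = a + k (of_real s)"
      by (simp only: k_minus diff_minus_eq_add)
    show "lower_bound (a - k (l - ?v + of_real t * ?v)) r"
      unfolding eq using s r by (intro lower_bound_mono[OF lb]) auto
  qed (use r in simp)
  then show ?thesis by simp
qed

section \<open>The spectral radius of self-adjoint elements\<close>

text \<open>Partial fractions: \<open>1/(1 - y\<^sup>2)\<close> is half the sum of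
  \<open>1/(1 - y)\<close> and \<open>1/(1 + y)\<close>. The unit is written as
  \<open>k (1/2) + k (1/2)\<close> so that both defects are given by plain ring identities.\<close>

lemma is_inv_one_minus_square:
  assumes "is_inv (1 - y) u" "is_inv (1 + y) v"
  shows "is_inv (1 - y * y) (k (1/2) * (u + v))"
proof -
  have half: "k (1/2) + k (1/2) = 1" using k_add[of "1/2" "1/2"] by (simp add: k_one)
  have "(1 - y * y) * (k (1/2) * (u + v)) - (k (1/2) + k (1/2))
      = k (1/2) * ((1 + y) * ((1 - y) * u - 1) + (1 - y) * ((1 + y) * v - 1))"
    by (simp add: algebra_simps k_left_commute)
  moreover have "k (1/2) * (u + v) * (1 - y * y) - (k (1/2) + k (1/2))
      = k (1/2) * ((u * (1 - y) - 1) * (1 + y) + (v * (1 + y) - 1) * (1 - y))"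
    by (simp add: algebra_simps)
  ultimately show ?thesis
    using assms unfolding is_inv_def half
    by (simp only:) (intro conjI null_mult_right[of _ "k (1/2)"] null_add; auto intro: null_mult_left null_mult_right)
qed

text \<open>\<open>close_inverses\<close> survives squaring because the inverse of \<open>1 - (z y)\<^sup>2\<close> is the mean of
  the inverses of \<open>1 - z y\<close> and \<open>1 + z y\<close>. This replaces the Cauchy integral in the spectral
  radius formula.\<close>

definition close_inverses :: "'a \<Rightarrow> real \<Rightarrow> real \<Rightarrow> bool" where
  "close_inverses y r R \<longleftrightarrow> (\<forall>z. cmod z = 1 \<longrightarrow> (\<exists>u v.
     is_inv (1 - k (of_real r * z) * y) u \<and> is_inv (1 - k (of_real R * z) * y) v \<and> N (u - v) \<le> 1/4))"

text \<open>Both square roots of \<open>z\<close> lie on the unit circle, and the mean of two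
  differences of size at most 1/4 is at most 1/4. The tolerance survives while the radii are
  squared, and iteration drives them to 0 and to infinity when
  \<open>0 \<le> r < 1 < R\<close>.\<close>

lemma close_inverses_square:
  assumes "close_inverses y r R"
  shows "close_inverses (y * y) (r * r) (R * R)"
  unfolding close_inverses_def
proof (intro allI impI)
  fix z :: complex assume z: "cmod z = 1"
  define w where "w = csqrt z"
  have ww: "w * w = z" unfolding w_def by (metis power2_csqrt power2_eq_square)
  then have "cmod w * cmod w = 1" using z by (metis norm_mult)
  then have w: "cmod w = 1" by (metis abs_norm_cancel abs_square_eq_1 power2_eq_square)
  obtain u v where uv: "is_inv (1 - k (of_real r * w) * y) u" "is_inv (1 - k (of_real R * w) * y) v"
      "N (u - v) \<le> 1/4"
    using assms w by (auto simp: close_inverses_def)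
  have "cmod (- w) = 1" using w by simp
  then obtain u' v' where uv': "is_inv (1 - k (of_real r * - w) * y) u'"
      "is_inv (1 - k (of_real R * - w) * y) v'" "N (u' - v') \<le> 1/4"
    using assms unfolding close_inverses_def by metis
  have sq: "(k (of_real \<rho> * w) * y) * (k (of_real \<rho> * w) * y) = k (of_real (\<rho> * \<rho>) * z) * (y * y)" for \<rho>
    by (simp only: mult.assoc k_left_commute[of y] k_fold ww[symmetric]) (simp add: ac_simps)
  have "is_inv (1 - k (of_real (r * r) * z) * (y * y)) (k (1/2) * (u + u'))"
    using is_inv_one_minus_square[of "k (of_real r * w) * y" u u'] uv(1) uv'(1)
    unfolding sq by (simp add: k_minus)
  moreover have "is_inv (1 - k (of_real (R * R) * z) * (y * y)) (k (1/2) * (v + v'))"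
    using is_inv_one_minus_square[of "k (of_real R * w) * y" v v'] uv(2) uv'(2)
    unfolding sq by (simp add: k_minus)
  moreover have "N (k (1/2) * (u + u') - k (1/2) * (v + v')) \<le> 1/4"
  proof -
    have "k (1/2) * (u + u') - k (1/2) * (v + v') = k (1/2) * ((u - v) + (u' - v'))"
      by (simp add: algebra_simps)
    then have "N (k (1/2) * (u + u') - k (1/2) * (v + v')) = 1/2 * N ((u - v) + (u' - v'))"
      by (simp add: N_k)
    then show ?thesis using N_triangle[of "u - v" "u' - v'"] uv(3) uv'(3) by simp
  qed
  ultimately show "\<exists>u v. is_inv (1 - k (of_real (r * r) * z) * (y * y)) u \<and>
      is_inv (1 - k (of_real (R * R) * z) * (y * y)) v \<and> N (u - v) \<le> 1/4"
    by blast
qed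

lemma close_inverses_power:
  assumes "close_inverses y r R"
  shows "close_inverses (y ^ 2 ^ n) (r ^ 2 ^ n) (R ^ 2 ^ n)"
proof (induction n)
  case 0 then show ?case using assms by simp
next
  case (Suc n)
  then show ?case using close_inverses_square[OF Suc] by (simp add: mult_2 power_add)
qed

lemma star_power: "star x = x \<Longrightarrow> star (x ^ n) = x ^ n"
  by (induction n) (simp_all add: star_one star_mult power_commutes)

text \<open>For self-adjoint elements the C*-identity squares the norm exactly; this equality, and
  not submultiplicativity, is what links the norm to the spectrum.\<close>

lemma N_self_adjoint_power:
  assumes "star x = x"
  shows "N (x ^ 2 ^ n) = N x ^ 2 ^ n"
proof (induction n)
  case 0 then show ?case by simp
next
  case (Suc n)
  then show ?case
    using N_cstar[of "x ^ 2 ^ n"] star_power[OF assms, of "2 ^ n"]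
    by (simp add: power2_eq_square mult_2 power_add)
qed

text \<open>At a tiny radius the inverse is close to 1, and \<open>close_inverses\<close> carries
  this over to the outer radius. But an inverse of \<open>1 - e\<close> within 1/2 of 1 forces
  \<open>N e \<le> 1\<close>, whereas \<open>N e = R ^ M > 1\<close> because \<open>x ^ M\<close>
  still has norm 1.\<close>

lemma not_close_inverses:
  assumes x: "star x = x" "N x = 1" and r: "0 \<le> r" "r < 1" and R: "1 < R"
  shows "\<not> close_inverses x r R"
proof
  assume close: "close_inverses x r R"
  \<comment> \<open>An inner term of size \<open>t < 1\<close> gives
    \<open>N (u - 1) \<le> t / (1 - t)\<close>, which is 1/4 for \<open>t = 1/5\<close>; adding the
    tolerance 1/4 leaves 1/2 for \<open>v\<close>.\<close>
  obtain n where n: "r ^ n < 1/5" using real_arch_pow_inv[of "1/5" r] r by auto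
  define M :: nat where "M = 2 ^ n"
  have "n \<le> M" by (simp add: M_def less_imp_le)
  then have rM: "r ^ M \<le> 1/5" using n r power_decreasing[of n M r] by simp
  define y where "y = x ^ M"
  have y: "N y = 1" using N_self_adjoint_power[OF x(1), of n] x(2) by (simp add: y_def M_def)
  have "close_inverses y (r ^ M) (R ^ M)"
    using close_inverses_power[OF close, of n] by (simp add: y_def M_def)
  then obtain u v where u: "is_inv (1 - k (of_real (r ^ M) * 1) * y) u"
    and v: "is_inv (1 - k (of_real (R ^ M) * 1) * y) v" and uv: "N (u - v) \<le> 1/4"
    unfolding close_inverses_def by (metis norm_one)
  define d where "d = k (of_real (r ^ M)) * y"
  define e where "e = k (of_real (R ^ M)) * y"
  have d: "N d \<le> 1/5" using rM r y by (simp add: d_def N_k norm_power)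
  have e: "N e = R ^ M" using R y by (simp add: e_def N_k norm_power)
  have "N (u - 1) \<le> 1/4"
  proof -
    have "N ((u - 1) - d * u) = 0" using u by (simp add: is_inv_def d_def algebra_simps)
    then have "N (u - 1) = N (d * u)" by (rule N_cong)
    also have "\<dots> \<le> N d * N u" by (rule N_mult)
    also have "\<dots> \<le> 1/5 * N u" using d N_nonneg by (rule mult_right_mono)
    finally show ?thesis using N_triangle[of "u - 1" 1] N_one_le by simp
  qed
  then have v1: "N (v - 1) \<le> 1/2"
    using N_triangle_diff[of "u - 1" "u - v"] uv by (simp add: algebra_simps)
  \<comment> \<open>Modulo null elements, \<open>(1 - e) * v = 1\<close> reads
    \<open>e = (1 - e) * (v - 1)\<close>.\<close>
  have "N (((v - 1) - e * (v - 1)) - e) = 0" using v by (simp add: is_inv_def e_def algebra_simps)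
  then have "N e = N ((v - 1) - e * (v - 1))" by (simp add: N_cong)
  also have "\<dots> \<le> N (v - 1) + N e * N (v - 1)"
    using N_triangle_diff[of "v - 1" "e * (v - 1)"] N_mult[of e "v - 1"] by simp
  also have "\<dots> \<le> 1/2 + N e * (1/2)"
    using v1 N_nonneg[of e] by (intro add_mono mult_left_mono) auto
  finally have "R ^ M \<le> 1" by (simp add: e)
  moreover have "1 < R ^ M" using R by (intro one_less_power) (auto simp: M_def)
  ultimately show False by simp
qed

text \<open>Near 1 and -1 the hypotheses are perturbed at the cost of half of \<open>c\<close>.
  Elsewhere \<open>1 - z x\<close> is \<open>-z (x - cnj z)\<close> with \<open>cnj z\<close>
  nonreal, so self-adjointness bounds it below by \<open>\<bar>Im z\<bar>\<close>.\<close>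

lemma lower_bound_on_circle:
  assumes x: "star x = x" "N x = 1"
    and lb: "lower_bound (1 - x) c" "lower_bound (1 + x) c" and c: "c > 0"
    and z: "cmod z = 1"
  shows "lower_bound (1 - k z * x) (min (c / 2) (c\<^sup>2 / 8))"
proof -
  have near: "lower_bound (1 - k z * x) (c / 2)"
    if "cmod (z - w) \<le> c / 2" "lower_bound (1 - k w * x) c" for w
    unfolding lower_bound_def
  proof
    fix m
    have "(1 - k z * x) * m = (1 - k w * x) * m - k (z - w) * (x * m)"
      by (simp add: algebra_simps k_diff)
    then have "N ((1 - k w * x) * m) - cmod (z - w) * N (x * m) \<le> N ((1 - k z * x) * m)"
      using N_diff_ge[of "(1 - k w * x) * m" "k (z - w) * (x * m)"] by (simp add: N_k)
    moreover have "c * N m \<le> N ((1 - k w * x) * m)" using that(2) by (simp add: lower_bound_def)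
    moreover have "cmod (z - w) * N (x * m) \<le> c / 2 * N m"
      using that(1) N_mult[of x m] x(2) N_nonneg c by (intro mult_mono) auto
    ultimately show "c / 2 * N m \<le> N ((1 - k z * x) * m)" by simp
  qed
  consider "cmod (z - 1) \<le> c / 2" | "cmod (z - (- 1)) \<le> c / 2"
    | "c / 2 < cmod (z - 1)" "c / 2 < cmod (z + 1)" by fastforce
  then show ?thesis
  proof cases
    case 1
    then have "lower_bound (1 - k z * x) (c / 2)" using near[of 1] lb(1) by (simp add: k_one)
    then show ?thesis by (rule lower_bound_mono) simp
  next
    case 2
    then have "lower_bound (1 - k z * x) (c / 2)" using near[of "- 1"] lb(2) by (simp add: k_minus k_one)
    then show ?thesis by (rule lower_bound_mono) simp
  next
    case 3
    \<comment> \<open>On the unit circle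
      \<open>cmod (z - 1) * cmod (z + 1) = 2 * \<bar>Im z\<bar>\<close>. With both factors above
      \<open>c / 2\<close> this gives the bound \<open>c\<^sup>2 / 8\<close>.\<close>
    have sq: "(Re z)\<^sup>2 + (Im z)\<^sup>2 = 1" using z by (metis cmod_power2 one_power2)
    have "(cmod (z - 1))\<^sup>2 = 2 - 2 * Re z" "(cmod (z + 1))\<^sup>2 = 2 + 2 * Re z"
      using sq by (simp_all only: cmod_power2) (simp_all add: power2_eq_square algebra_simps)
    then have "(cmod (z - 1) * cmod (z + 1))\<^sup>2 = (2 - 2 * Re z) * (2 + 2 * Re z)"
      by (simp add: power_mult_distrib)
    also have "\<dots> = (2 * \<bar>Im z\<bar>)\<^sup>2" using sq by (simp add: power2_eq_square algebra_simps)
    finally have "cmod (z - 1) * cmod (z + 1) = 2 * \<bar>Im z\<bar>"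
      by (rule power2_eq_imp_eq) auto
    moreover have "c / 2 * (c / 2) \<le> cmod (z - 1) * cmod (z + 1)"
      using 3 c by (intro mult_mono) auto
    ultimately have im: "c\<^sup>2 / 8 \<le> \<bar>Im z\<bar>" by (simp add: power2_eq_square)
    have "z * cnj z = 1" using z by (metis complex_norm_square of_real_1 one_power2)
    then have eq: "1 - k z * x = k (- z) * (x - k (cnj z))"
      by (simp add: algebra_simps k_minus flip: k_mult) (simp add: k_one)
    show ?thesis unfolding lower_bound_def
    proof
      fix m
      have "min (c / 2) (c\<^sup>2 / 8) * N m \<le> \<bar>Im (cnj z)\<bar> * N m"
        using im N_nonneg by (intro mult_right_mono) auto
      also have "\<dots> \<le> N ((x - k (cnj z)) * m)"
        using self_adjoint_lower_bound[OF x(1)] by (simp only: lower_bound_def)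
      also have "\<dots> = N ((1 - k z * x) * m)" using z by (simp add: eq mult.assoc N_k)
      finally show "min (c / 2) (c\<^sup>2 / 8) * N m \<le> N ((1 - k z * x) * m)" .
    qed
  qed
qed

text \<open>The circle is thickened to an annulus: as \<open>N x = 1\<close>, changing the radius by
  at most \<open>\<kappa> / 2\<close> costs at most half of the bound.\<close>

lemma lower_bound_near_circle:
  assumes x: "N x = 1" and circle: "\<And>z. cmod z = 1 \<Longrightarrow> lower_bound (1 - k z * x) \<kappa>"
    and z: "cmod z = 1" and \<rho>: "\<bar>\<rho> - 1\<bar> \<le> \<kappa> / 2"
  shows "lower_bound (1 - k (of_real \<rho> * z) * x) (\<kappa> / 2)"
  unfolding lower_bound_def
proof
  fix m
  have "(1 - k (of_real \<rho> * z) * x) * m = (1 - k z * x) * m - k (of_real (\<rho> - 1) * z) * (x * m)"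
    by (simp add: algebra_simps k_diff)
  then have "N ((1 - k z * x) * m) - \<bar>\<rho> - 1\<bar> * N (x * m) \<le> N ((1 - k (of_real \<rho> * z) * x) * m)"
    using N_diff_ge[of "(1 - k z * x) * m" "k (of_real (\<rho> - 1) * z) * (x * m)"] z
    by (simp only: N_k norm_mult norm_of_real mult_1_right)
  moreover have "\<kappa> * N m \<le> N ((1 - k z * x) * m)" using circle[OF z] by (simp add: lower_bound_def)
  moreover have "\<bar>\<rho> - 1\<bar> * N (x * m) \<le> \<kappa> / 2 * N m"
    using \<rho> N_mult[of x m] x N_nonneg abs_ge_zero[of "\<rho> - 1"] by (intro mult_mono) (auto simp del: abs_ge_zero)
  ultimately show "\<kappa> / 2 * N m \<le> N ((1 - k (of_real \<rho> * z) * x) * m)" by simp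
qed

text \<open>If 1 and -1 were both outside the spectrum, the inverses of \<open>1 - z x\<close> would
  be uniformly bounded around the unit circle, and hence close to each other at two radii on either
  side of it, contrary to \<open>not_close_inverses\<close>.\<close>

lemma norm_one_in_spectrum:
  assumes x: "star x = x" "N x = 1"
  shows "\<not> (invertible (1 - x) \<and> invertible (1 + x))"
proof
  assume "invertible (1 - x) \<and> invertible (1 + x)"
  then obtain u v where uv: "is_inv (1 - x) u" "is_inv (1 + x) v" by (auto simp: invertible_def)
  define c where "c = min (1 / (N u + 1)) (1 / (N v + 1))"
  have c: "0 < c" "c \<le> 1"
    using N_nonneg[of u] N_nonneg[of v] by (auto simp: c_def min_def)
  have lb: "lower_bound (1 - x) c" "lower_bound (1 + x) c"
    using is_inv_lower_bound[OF uv(1)] is_inv_lower_bound[OF uv(2)]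
    by (auto simp: c_def intro: lower_bound_mono)
  define \<kappa> where "\<kappa> = min (c / 2) (c\<^sup>2 / 8)"
  have \<kappa>: "0 < \<kappa>" "\<kappa> \<le> 1/2" using c by (auto simp: \<kappa>_def min_le_iff_disj)
  have circle: "lower_bound (1 - k z * x) \<kappa>" if "cmod z = 1" for z
    unfolding \<kappa>_def using lower_bound_on_circle[OF x lb c(1) that] .
  \<comment> \<open>At the radii \<open>1 - \<delta>\<close> and \<open>1 + \<delta>\<close> the
    inverses have norm at most \<open>2 / \<kappa>\<close>, so they differ by at most
    \<open>2 \<delta> (2 / \<kappa>)\<^sup>2\<close>; this choice makes that 1/4.\<close>
  define \<delta> where "\<delta> = \<kappa>\<^sup>2 / 32"
  have \<delta>: "0 < \<delta>" "\<delta> \<le> \<kappa> / 64" "\<delta> < 1"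
  proof -
    have "\<kappa> * \<kappa> \<le> \<kappa> * (1/2)" using \<kappa> by (intro mult_left_mono) auto
    then have "\<kappa>\<^sup>2 \<le> \<kappa> / 2" by (simp add: power2_eq_square)
    then show "0 < \<delta>" "\<delta> \<le> \<kappa> / 64" "\<delta> < 1"
      using \<kappa> unfolding \<delta>_def by (simp_all, linarith?)
  qed
  have "close_inverses x (1 - \<delta>) (1 + \<delta>)"
    unfolding close_inverses_def
  proof (intro allI impI)
    fix z :: complex assume z: "cmod z = 1"
    let ?a = "1 - k (of_real (1 - \<delta>) * z) * x" and ?b = "1 - k (of_real (1 + \<delta>) * z) * x"
    let ?d = "k (of_real (- (2 * \<delta>)) * z) * x"
    have "of_real (- (2 * \<delta>)) * z = of_real (1 - \<delta>) * z - of_real (1 + \<delta>) * z"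
      by (simp add: algebra_simps)
    then have "?d = k (of_real (1 - \<delta>) * z) * x - k (of_real (1 + \<delta>) * z) * x"
      by (simp only: k_diff left_diff_distrib)
    then have b: "?b = ?a + ?d" by simp
    have d: "N ?d = 2 * \<delta>" using z x \<delta> by (simp add: N_k norm_mult)
    have lb_a: "lower_bound ?a (\<kappa> / 2)"
      by (rule lower_bound_near_circle[OF x(2) circle z]) (use \<delta> \<kappa> in auto)
    have lb_b: "lower_bound ?b (\<kappa> / 2)"
      by (rule lower_bound_near_circle[OF x(2) circle z]) (use \<delta> \<kappa> in auto)
    \<comment> \<open>Inside the circle the Neumann series provides the inverse; the outer one is
      reached from it by a single perturbation across the circle.\<close>
    have "N (k (of_real (1 - \<delta>) * z) * x) < 1"
      using z x \<delta> by (simp only: N_k norm_mult norm_of_real) simp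
    then have inv_a: "invertible ?a" by (rule invertible_geometric)
    have "invertible ?b"
      unfolding b using inv_a lb_a by (rule invertible_perturb_lower_bound) (use d \<delta> \<kappa> in simp)
    with inv_a obtain u v where u: "is_inv ?a u" and v: "is_inv ?b v" by (auto simp: invertible_def)
    have "N u \<le> 1 / (\<kappa> / 2)" "N v \<le> 1 / (\<kappa> / 2)"
      using is_inv_N_le[OF u lb_a] is_inv_N_le[OF v lb_b] \<kappa> by simp_all
    then have N_uv: "N u * N v \<le> (2 / \<kappa>) * (2 / \<kappa>)"
      using N_nonneg \<kappa> by (intro mult_mono) auto
    \<comment> \<open>Resolvent identity \<open>u - v = u (?b - ?a) v\<close>, up to null
      elements.\<close>
    have "(u - v) - u * (?d * v) = (u * ?a - 1) * v - u * (?b * v - 1)"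
      unfolding b by (simp add: algebra_simps)
    also have "N \<dots> = 0" using u v unfolding is_inv_def
      by (intro null_diff) (auto intro: null_mult_left null_mult_right)
    finally have "N (u - v) = N (u * (?d * v))" by (rule N_cong)
    also have "\<dots> \<le> N u * (N ?d * N v)"
      using N_mult[of u "?d * v"] mult_left_mono[OF N_mult[of ?d v] N_nonneg[of u]] by linarith
    also have "\<dots> = 2 * \<delta> * (N u * N v)" by (simp only: d mult.left_commute)
    also have "\<dots> \<le> 2 * \<delta> * ((2 / \<kappa>) * (2 / \<kappa>))" using N_uv \<delta> by (intro mult_left_mono) auto
    also have "\<dots> = 1/4" using \<kappa> by (simp add: \<delta>_def power2_eq_square)
    finally show "\<exists>u v. is_inv ?a u \<and> is_inv ?b v \<and> N (u - v) \<le> 1/4" using u v by blast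
  qed
  moreover have "\<not> close_inverses x (1 - \<delta>) (1 + \<delta>)"
    using \<delta> by (intro not_close_inverses x) auto
  ultimately show False by simp
qed

text \<open>If the norm exceeded \<open>t\<close>, the element scaled to norm 1 would have neither 1
  nor -1 in its spectrum.\<close>

lemma N_le_spectral_radius:
  assumes "star x = x" "0 \<le> t"
    and res: "\<And>s. t < \<bar>s\<bar> \<Longrightarrow> invertible (x - k (of_real s))"
  shows "N x \<le> t"
proof (rule ccontr)
  assume "\<not> N x \<le> t"
  then have n: "N x > t" "N x > 0" using assms(2) by auto
  define c :: complex where "c = of_real (1 / N x)"
  have c: "c \<noteq> 0" "c * of_real (N x) = 1" using n by (simp_all add: c_def)
  let ?y = "k c * x"
  have "star ?y = ?y" by (simp add: star_mult star_k assms(1) k_central c_def)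
  moreover have "N ?y = 1" using n by (simp add: c_def N_k norm_divide)
  moreover have "invertible (- (k c * (x - k (of_real (N x)))))"
    using n c by (intro invertible_minus invertible_k_mult res) auto
  then have "invertible (1 - ?y)"
    using c by (simp add: algebra_simps k_one flip: k_mult)
  moreover have "invertible (k c * (x - k (of_real (- N x))))"
    using n c by (intro invertible_k_mult res) auto
  then have "invertible (1 + ?y)"
    using c by (simp add: algebra_simps k_one k_minus flip: k_mult)
  ultimately show False using norm_one_in_spectrum by blast
qed

section \<open>Positive elements and monotonicity of the norm\<close>

text \<open>Writing a candidate inverse as \<open>b - k (1 / l)\<close> turns the two inverse
  equations into the unit-free ones of \<open>positive_el\<close>.\<close>

lemma invertible_iff_quasi_inverse:
  assumes "l \<noteq> 0"
  shows "invertible (a - k l) \<longleftrightarrow> (\<exists>b. N (a * b + k (- l) * b + k (- (1 / l)) * a) = 0 \<and>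
    N (b * a + k (- l) * b + k (- (1 / l)) * a) = 0)"
proof -
  have l: "k l * k (1 / l) = 1" "k (1 / l) * k l = 1" using assms by (simp_all add: k_one flip: k_mult)
  have "is_inv (a - k l) (b - k (1 / l)) \<longleftrightarrow> N (a * b + k (- l) * b + k (- (1 / l)) * a) = 0 \<and>
      N (b * a + k (- l) * b + k (- (1 / l)) * a) = 0" for b
    unfolding is_inv_def by (simp add: left_diff_distrib right_diff_distrib k_minus k_central[of a] k_central[of b] l
        diff_right_commute[of "b * a"])
  then show ?thesis
    unfolding invertible_def by (metis add_diff_cancel_right')
qed

text \<open>Nonreal points are covered by \<open>self_adjoint_nonreal_resolvent\<close>, so only
  negative reals have to be tested.\<close>

definition psd :: "'a \<Rightarrow> bool" where
  "psd p \<longleftrightarrow> star p = p \<and> (\<forall>s>0. invertible (p + k (of_real s)))"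

text \<open>The spectrum of \<open>p\<close> lies in \<open>[0, N p]\<close>, and reflection at the
  midpoint preserves this interval. Together with \<open>psdI\<close> this expresses positivity by a
  norm inequality.\<close>

lemma psd_N_diff_le:
  assumes "psd p"
  shows "N (k (of_real (N p)) - p) \<le> N p"
proof (rule N_le_spectral_radius)
  show "star (k (of_real (N p)) - p) = k (of_real (N p)) - p"
    using assms by (simp add: psd_def star_diff star_k)
  fix s assume s: "N p < \<bar>s\<bar>"
  have "invertible (p + k (of_real (s - N p)))"
  proof (cases "s > 0")
    case True
    then show ?thesis using assms s unfolding psd_def by (metis abs_of_pos diff_gt_0_iff_gt)
  next
    case False
    then have "N p < cmod (of_real (N p - s))" using s N_nonneg[of p] by (simp only: norm_of_real)
    then have "invertible (p - k (of_real (N p - s)))" by (rule invertible_minus_k)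
    then show ?thesis by (simp add: k_diff algebra_simps)
  qed
  then have "invertible (- (p + k (of_real (s - N p))))" by (rule invertible_minus)
  then show "invertible (k (of_real (N p)) - p - k (of_real s))" by (simp add: k_diff algebra_simps)
qed (rule N_nonneg)

text \<open>The hypothesis confines the spectrum to the disc of radius \<open>t\<close> around
  \<open>t\<close>, which contains no negative real.\<close>

lemma psdI:
  assumes "star p = p" "N (k (of_real t) - p) \<le> t"
  shows "psd p"
  unfolding psd_def
proof (intro conjI allI impI assms(1))
  fix s :: real assume "s > 0"
  then have "N (k (of_real t) - p) < cmod (of_real (t + s))"
    using assms(2) N_nonneg[of "k (of_real t) - p"] by (simp only: norm_of_real)
  then have "invertible (- (k (of_real t) - p - k (of_real (t + s))))"
    by (intro invertible_minus invertible_minus_k)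
  then show "invertible (p + k (of_real s))" by (simp add: k_add algebra_simps)
qed

text \<open>Resolvents of a sum are out of reach, but the norm inequality that characterises
  positivity adds up by the triangle inequality.\<close>

lemma psd_add:
  assumes "psd p" "psd q"
  shows "psd (p + q)"
proof (rule psdI)
  show "star (p + q) = p + q" using assms by (simp add: psd_def star_add)
  have "k (of_real (N p + N q)) - (p + q) = (k (of_real (N p)) - p) + (k (of_real (N q)) - q)"
    by (simp add: k_add)
  then show "N (k (of_real (N p + N q)) - (p + q)) \<le> N p + N q"
    using N_triangle psd_N_diff_le[OF assms(1)] psd_N_diff_le[OF assms(2)] by (metis add_mono order_trans)
qed

text \<open>With \<open>t = N (p + q)\<close> the elements \<open>t - (p + q)\<close> and
  \<open>p\<close> are positive, hence so is their sum \<open>t - q\<close>. The spectrum of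
  \<open>q\<close> then lies in \<open>[0, t]\<close>.\<close>

lemma psd_norm_mono:
  assumes "psd p" "psd q"
  shows "N q \<le> N (p + q)"
proof (rule N_le_spectral_radius)
  let ?t = "N (p + q)"
  show "star q = q" using assms(2) by (simp add: psd_def)
  have "psd (k (of_real ?t) - (p + q))"
    by (rule psdI[where t = ?t]) (use assms in \<open>auto simp: psd_def star_diff star_add star_k add.commute\<close>)
  then have "psd ((k (of_real ?t) - (p + q)) + p)" using assms(1) by (rule psd_add)
  then have u: "psd (k (of_real ?t) - q)" by simp
  fix s assume s: "?t < \<bar>s\<bar>"
  show "invertible (q - k (of_real s))"
  proof (cases "s > 0")
    case True
    then have "invertible (- (k (of_real ?t) - q + k (of_real (s - ?t))))"
      using u s unfolding psd_def by (intro invertible_minus) (metis abs_of_pos diff_gt_0_iff_gt)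
    then show ?thesis by (simp add: k_diff algebra_simps)
  next
    case False
    then have "invertible (q + k (of_real (- s)))" using assms(2) s N_nonneg[of "p + q"]
      by (auto simp: psd_def simp del: of_real_minus)
    then show ?thesis by (simp add: k_minus)
  qed
qed (rule N_nonneg)

end

section \<open>C*-categories\<close>

locale banach_carrier =
  fixes V :: "'m set" and z ad sc nm
  assumes banach: "banach_on V z ad sc nm"
begin

lemma zero_in: "z \<in> V"
  and add_in: "x \<in> V \<Longrightarrow> y \<in> V \<Longrightarrow> ad x y \<in> V"
  and scale_in: "x \<in> V \<Longrightarrow> sc a x \<in> V"
  and add_assoc: "x \<in> V \<Longrightarrow> y \<in> V \<Longrightarrow> w \<in> V \<Longrightarrow> ad (ad x y) w = ad x (ad y w)"
  and add_commute: "x \<in> V \<Longrightarrow> y \<in> V \<Longrightarrow> ad x y = ad y x"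
  and add_zero_left: "x \<in> V \<Longrightarrow> ad z x = x"
  and scale_one: "x \<in> V \<Longrightarrow> sc 1 x = x"
  and scale_scale: "x \<in> V \<Longrightarrow> sc a (sc b x) = sc (a * b) x"
  and scale_add_left: "x \<in> V \<Longrightarrow> sc (a + b) x = ad (sc a x) (sc b x)"
  and scale_add_right: "x \<in> V \<Longrightarrow> y \<in> V \<Longrightarrow> sc a (ad x y) = ad (sc a x) (sc a y)"
  and norm_eq_0: "x \<in> V \<Longrightarrow> nm x = 0 \<longleftrightarrow> x = z"
  and norm_triangle: "x \<in> V \<Longrightarrow> y \<in> V \<Longrightarrow> nm (ad x y) \<le> nm x + nm y"
  and norm_scale: "x \<in> V \<Longrightarrow> nm (sc a x) = cmod a * nm x"
  by (insert banach[unfolded banach_on_def]; elim conjE; simp)+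

lemma complete:
  assumes "\<And>n. X n \<in> V"
    and "\<And>e. e > 0 \<Longrightarrow> \<exists>N. \<forall>m\<ge>N. \<forall>n\<ge>N. nm (ad (X m) (sc (-1) (X n))) < e"
  shows "\<exists>x\<in>V. (\<lambda>n. nm (ad (X n) (sc (-1) x))) \<longlonglongrightarrow> 0"
  using banach assms unfolding banach_on_def by blast

lemma add_zero_right: "x \<in> V \<Longrightarrow> ad x z = x"
  by (metis add_commute add_zero_left zero_in)

lemma add_left_commute:
  "x \<in> V \<Longrightarrow> y \<in> V \<Longrightarrow> w \<in> V \<Longrightarrow> ad x (ad y w) = ad y (ad x w)"
  by (metis add_assoc add_commute)

lemma norm_zero: "nm z = 0"
  using norm_eq_0 zero_in by blast

lemma scale_zero_left: "x \<in> V \<Longrightarrow> sc 0 x = z"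
  using norm_scale[of x 0] norm_eq_0[of "sc 0 x"] by (simp add: scale_in)

lemma scale_zero_right: "sc a z = z"
  using norm_scale[of z a] norm_eq_0[of "sc a z"] by (simp add: scale_in zero_in norm_zero)

lemma add_neg: "x \<in> V \<Longrightarrow> ad x (sc (-1) x) = z"
  using scale_add_left[of x 1 "-1"] by (simp add: scale_zero_left scale_one)

lemma norm_nonneg: "x \<in> V \<Longrightarrow> 0 \<le> nm x"
  using norm_triangle[of x "sc (-1) x"] by (simp add: add_neg norm_zero scale_in norm_scale)

lemma diff_in: "x \<in> V \<Longrightarrow> y \<in> V \<Longrightarrow> ad x (sc (-1) y) \<in> V"
  by (simp add: add_in scale_in)

lemma diff_eq_zero: 
  assumes "x \<in> V" "y \<in> V" "ad x (sc (-1) y) = z"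
  shows "x = y"
proof -
  have "x = ad x (ad (sc (-1) y) y)"
    using assms by (metis add_commute add_neg add_zero_right scale_in)
  also have "\<dots> = ad (ad x (sc (-1) y)) y" using assms(1,2) by (simp add: add_assoc scale_in)
  also have "\<dots> = y" using assms by (simp add: add_zero_left)
  finally show ?thesis .
qed

lemma diff_triangle:
  assumes "x \<in> V" "y \<in> V" "w \<in> V"
  shows "nm (ad x (sc (-1) w)) \<le> nm (ad x (sc (-1) y)) + nm (ad y (sc (-1) w))"
proof -
  have "ad (ad x (sc (-1) y)) (ad y (sc (-1) w)) = ad x (ad (ad y (sc (-1) y)) (sc (-1) w))"
    using assms by (simp add: add_assoc scale_in diff_in add_left_commute add_in)
  also have "\<dots> = ad x (sc (-1) w)" using assms by (simp add: add_neg add_zero_left scale_in)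
  finally show ?thesis using norm_triangle assms diff_in by metis
qed

lemma diff_commute:
  assumes "x \<in> V" "y \<in> V"
  shows "nm (ad x (sc (-1) y)) = nm (ad y (sc (-1) x))"
proof -
  have "sc (-1) (ad x (sc (-1) y)) = ad y (sc (-1) x)"
    using assms by (simp add: scale_add_right scale_in scale_scale scale_one add_commute)
  then show ?thesis using norm_scale[of "ad x (sc (-1) y)" "-1"] assms by (simp add: diff_in)
qed

lemma norm_le_diff:
  assumes "x \<in> V" "y \<in> V"
  shows "nm x \<le> nm (ad x (sc (-1) y)) + nm y"
  using diff_triangle[of x y z] assms by (simp add: zero_in scale_zero_right add_zero_right)

lemma limit_unique:
  assumes V: "\<And>n. X n \<in> V" "x \<in> V" "y \<in> V"
    and lim: "(\<lambda>n. nm (ad (X n) (sc (-1) x))) \<longlonglongrightarrow> 0" "(\<lambda>n. nm (ad (X n) (sc (-1) y))) \<longlonglongrightarrow> 0"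
  shows "x = y"
proof -
  have "nm (ad x (sc (-1) y)) \<le> nm (ad (X n) (sc (-1) x)) + nm (ad (X n) (sc (-1) y))" for n
    using diff_triangle[of x "X n" y] V diff_commute by auto
  then have "nm (ad x (sc (-1) y)) \<le> 0"
    using tendsto_add[OF lim] LIMSEQ_le_const by fastforce
  then have "nm (ad x (sc (-1) y)) = 0" using V norm_nonneg diff_in by (metis order_antisym)
  then show ?thesis using V diff_eq_zero norm_eq_0 diff_in by blast
qed

text \<open>Closed balls are closed. The bound is asked for only eventually because it will come
  from a Cauchy estimate.\<close>

lemma limit_norm_diff_le:
  assumes V: "\<And>n. X n \<in> V" "x \<in> V" "y \<in> V"
    and lim: "(\<lambda>n. nm (ad (X n) (sc (-1) x))) \<longlonglongrightarrow> 0"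
    and bound: "\<And>n. n \<ge> N \<Longrightarrow> nm (ad y (sc (-1) (X n))) \<le> b"
  shows "nm (ad y (sc (-1) x)) \<le> b"
proof -
  have "nm (ad y (sc (-1) x)) \<le> b + nm (ad (X n) (sc (-1) x))" if "n \<ge> N" for n
    using diff_triangle[of y "X n" x] bound[OF that] V by force
  then show ?thesis
    using LIMSEQ_le_const[OF tendsto_add[OF tendsto_const lim, of b]] by auto
qed

lemma convergent_imp_Cauchy:
  assumes V: "\<And>n. X n \<in> V" "x \<in> V"
    and lim: "(\<lambda>n. nm (ad (X n) (sc (-1) x))) \<longlonglongrightarrow> 0" and "e > 0"
  shows "\<exists>N. \<forall>m\<ge>N. \<forall>n\<ge>N. nm (ad (X m) (sc (-1) (X n))) < e"
proof -
  obtain N where N: "\<And>n. n \<ge> N \<Longrightarrow> nm (ad (X n) (sc (-1) x)) < e / 2"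
    using LIMSEQ_D[OF lim, of "e / 2"] \<open>e > 0\<close> by force
  have "nm (ad (X m) (sc (-1) (X n))) < e" if "m \<ge> N" "n \<ge> N" for m n
    using diff_triangle[of "X m" x "X n"] N[OF that(1)] N[OF that(2)] V diff_commute[of "X n" x] by auto
  then show ?thesis by blast
qed

end

text \<open>All axioms of \<^const>\<open>cstar_cat\<close> except positivity of \<open>f\<^sup>* f\<close>.\<close>

locale pre_cstar_category =
  fixes A :: "('o,'m) cstarcat"
  assumes hom_banach: "C \<in> c_obj A \<Longrightarrow> D \<in> c_obj A \<Longrightarrow>
      banach_carrier (c_hom A C D) (c_zero A C D) (c_add A C D) (c_scale A C D) (c_norm A C D)"
    and comp_in: "C \<in> c_obj A \<Longrightarrow> D \<in> c_obj A \<Longrightarrow> E \<in> c_obj A \<Longrightarrow> f \<in> c_hom A C D \<Longrightarrow> g \<in> c_hom A D E \<Longrightarrow>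
      c_comp A C D E g f \<in> c_hom A C E"
    and comp_assoc: "C \<in> c_obj A \<Longrightarrow> D \<in> c_obj A \<Longrightarrow> E \<in> c_obj A \<Longrightarrow> F \<in> c_obj A \<Longrightarrow>
      f \<in> c_hom A C D \<Longrightarrow> g \<in> c_hom A D E \<Longrightarrow> h \<in> c_hom A E F \<Longrightarrow>
      c_comp A C E F h (c_comp A C D E g f) = c_comp A C D F (c_comp A D E F h g) f"
    and comp_add_right: "C \<in> c_obj A \<Longrightarrow> D \<in> c_obj A \<Longrightarrow> E \<in> c_obj A \<Longrightarrow>
      f \<in> c_hom A C D \<Longrightarrow> f' \<in> c_hom A C D \<Longrightarrow> g \<in> c_hom A D E \<Longrightarrow>
      c_comp A C D E g (c_add A C D f f') = c_add A C E (c_comp A C D E g f) (c_comp A C D E g f')"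
    and comp_add_left: "C \<in> c_obj A \<Longrightarrow> D \<in> c_obj A \<Longrightarrow> E \<in> c_obj A \<Longrightarrow>
      f \<in> c_hom A C D \<Longrightarrow> g \<in> c_hom A D E \<Longrightarrow> g' \<in> c_hom A D E \<Longrightarrow>
      c_comp A C D E (c_add A D E g g') f = c_add A C E (c_comp A C D E g f) (c_comp A C D E g' f)"
    and comp_scale_right: "C \<in> c_obj A \<Longrightarrow> D \<in> c_obj A \<Longrightarrow> E \<in> c_obj A \<Longrightarrow>
      f \<in> c_hom A C D \<Longrightarrow> g \<in> c_hom A D E \<Longrightarrow>
      c_comp A C D E g (c_scale A C D a f) = c_scale A C E a (c_comp A C D E g f)"
    and comp_scale_left: "C \<in> c_obj A \<Longrightarrow> D \<in> c_obj A \<Longrightarrow> E \<in> c_obj A \<Longrightarrow>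
      f \<in> c_hom A C D \<Longrightarrow> g \<in> c_hom A D E \<Longrightarrow>
      c_comp A C D E (c_scale A D E a g) f = c_scale A C E a (c_comp A C D E g f)"
    and norm_comp: "C \<in> c_obj A \<Longrightarrow> D \<in> c_obj A \<Longrightarrow> E \<in> c_obj A \<Longrightarrow>
      f \<in> c_hom A C D \<Longrightarrow> g \<in> c_hom A D E \<Longrightarrow>
      c_norm A C E (c_comp A C D E g f) \<le> c_norm A D E g * c_norm A C D f"
    and star_in: "C \<in> c_obj A \<Longrightarrow> D \<in> c_obj A \<Longrightarrow> f \<in> c_hom A C D \<Longrightarrow> c_star A C D f \<in> c_hom A D C"
    and star_add: "C \<in> c_obj A \<Longrightarrow> D \<in> c_obj A \<Longrightarrow> f \<in> c_hom A C D \<Longrightarrow> g \<in> c_hom A C D \<Longrightarrow>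
      c_star A C D (c_add A C D f g) = c_add A D C (c_star A C D f) (c_star A C D g)"
    and star_scale: "C \<in> c_obj A \<Longrightarrow> D \<in> c_obj A \<Longrightarrow> f \<in> c_hom A C D \<Longrightarrow>
      c_star A C D (c_scale A C D a f) = c_scale A D C (cnj a) (c_star A C D f)"
    and star_star: "C \<in> c_obj A \<Longrightarrow> D \<in> c_obj A \<Longrightarrow> f \<in> c_hom A C D \<Longrightarrow>
      c_star A D C (c_star A C D f) = f"
    and star_comp: "C \<in> c_obj A \<Longrightarrow> D \<in> c_obj A \<Longrightarrow> E \<in> c_obj A \<Longrightarrow>
      f \<in> c_hom A C D \<Longrightarrow> g \<in> c_hom A D E \<Longrightarrow>
      c_star A C E (c_comp A C D E g f) = c_comp A E D C (c_star A C D f) (c_star A D E g)"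
    and norm_star_comp: "C \<in> c_obj A \<Longrightarrow> D \<in> c_obj A \<Longrightarrow> f \<in> c_hom A C D \<Longrightarrow>
      c_norm A C C (c_comp A C D C (c_star A C D f) f) = (c_norm A C D f)\<^sup>2"

lemma cstar_cat_iff:
  "cstar_cat A \<longleftrightarrow> pre_cstar_category A \<and> (\<forall>C\<in>c_obj A. \<forall>D\<in>c_obj A. \<forall>f\<in>c_hom A C D.
     positive_el A C (c_comp A C D C (c_star A C D f) f))"
  unfolding cstar_cat_def pre_cstar_category_def banach_carrier_def
  by (intro iffI; elim conjE; intro conjI allI impI ballI; simp)

context pre_cstar_category
begin

lemmas hom_simps [simp] =
  banach_carrier.zero_in[OF hom_banach] banach_carrier.add_in[OF hom_banach]
  banach_carrier.scale_in[OF hom_banach] comp_in star_in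
  banach_carrier.norm_zero[OF hom_banach] banach_carrier.scale_zero_right[OF hom_banach]
  banach_carrier.norm_nonneg[OF hom_banach]

lemmas hom_add_assoc = banach_carrier.add_assoc[OF hom_banach]
lemmas hom_add_commute = banach_carrier.add_commute[OF hom_banach]
lemmas hom_add_zero_left = banach_carrier.add_zero_left[OF hom_banach]
lemmas hom_add_neg = banach_carrier.add_neg[OF hom_banach]
lemmas hom_scale_one = banach_carrier.scale_one[OF hom_banach]
lemmas hom_scale_scale = banach_carrier.scale_scale[OF hom_banach]
lemmas hom_scale_add_left = banach_carrier.scale_add_left[OF hom_banach]
lemmas hom_scale_add_right = banach_carrier.scale_add_right[OF hom_banach]
lemmas hom_scale_zero_left = banach_carrier.scale_zero_left[OF hom_banach]
lemmas hom_norm_eq_0 = banach_carrier.norm_eq_0[OF hom_banach]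
lemmas hom_norm_triangle = banach_carrier.norm_triangle[OF hom_banach]
lemmas hom_norm_scale = banach_carrier.norm_scale[OF hom_banach]
lemmas hom_norm_nonneg = banach_carrier.norm_nonneg[OF hom_banach]
lemmas hom_diff_eq_zero = banach_carrier.diff_eq_zero[OF hom_banach]
lemmas hom_diff_commute = banach_carrier.diff_commute[OF hom_banach]
lemmas hom_complete = banach_carrier.complete[OF hom_banach]
lemmas hom_limit_unique = banach_carrier.limit_unique[OF hom_banach]
lemmas hom_limit_norm_diff_le = banach_carrier.limit_norm_diff_le[OF hom_banach]
lemmas hom_norm_le_diff = banach_carrier.norm_le_diff[OF hom_banach]
lemmas hom_convergent_imp_Cauchy = banach_carrier.convergent_imp_Cauchy[OF hom_banach]

section \<open>The adjoint and separation of morphisms\<close>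

lemma norm_star:
  assumes [simp]: "C \<in> c_obj A" "D \<in> c_obj A" "f \<in> c_hom A C D"
  shows "c_norm A D C (c_star A C D f) = c_norm A C D f"
proof -
  have le: "c_norm A C D f \<le> c_norm A D C (c_star A C D f)"
    if [simp]: "C \<in> c_obj A" "D \<in> c_obj A" "f \<in> c_hom A C D" for C D f
  proof (cases "c_norm A C D f = 0")
    case True
    then show ?thesis by simp
  next
    case False
    have "c_norm A C D f * c_norm A C D f \<le> c_norm A D C (c_star A C D f) * c_norm A C D f"
      using norm_comp[of C D C f "c_star A C D f"] norm_star_comp[of C D f] by (simp add: power2_eq_square)
    moreover have "0 < c_norm A C D f" using False hom_norm_nonneg[of C D f] by (simp add: less_le)
    ultimately show ?thesis by (rule mult_right_le_imp_le)
  qed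
  show ?thesis using le[of C D f] le[of D C "c_star A C D f"] by (simp add: star_star)
qed

lemma norm_comp_star:
  assumes [simp]: "C \<in> c_obj A" "D \<in> c_obj A" "f \<in> c_hom A C D"
  shows "c_norm A D D (c_comp A D C D f (c_star A C D f)) = (c_norm A C D f)\<^sup>2"
  using norm_star_comp[of D C "c_star A C D f"] by (simp add: star_star norm_star)

text \<open>The adjoint of the difference of \<open>x\<close> and \<open>y\<close> is itself a test
  morphism, and the C*-identity makes the difference vanish. This stands in for units, which may be
  missing.\<close>

lemma comp_faithful_left:
  assumes [simp]: "C \<in> c_obj A" "D \<in> c_obj A" "x \<in> c_hom A C D" "y \<in> c_hom A C D"
    and eq: "\<And>E g. E \<in> c_obj A \<Longrightarrow> g \<in> c_hom A D E \<Longrightarrow> c_comp A C D E g x = c_comp A C D E g y"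
  shows "x = y"
proof -
  let ?d = "c_add A C D x (c_scale A C D (-1) y)"
  have "c_comp A C D C (c_star A C D ?d) ?d = c_zero A C C"
    using eq[of C "c_star A C D ?d"] by (simp add: comp_add_right comp_scale_right hom_add_neg)
  then have "(c_norm A C D ?d)\<^sup>2 = 0" using norm_star_comp[of C D ?d] by simp
  then show ?thesis using hom_diff_eq_zero[of C D x y] hom_norm_eq_0[of C D ?d] by simp
qed

lemma comp_faithful_right:
  assumes [simp]: "C \<in> c_obj A" "D \<in> c_obj A" "x \<in> c_hom A C D" "y \<in> c_hom A C D"
    and eq: "\<And>E f. E \<in> c_obj A \<Longrightarrow> f \<in> c_hom A E C \<Longrightarrow> c_comp A E C D x f = c_comp A E C D y f"
  shows "x = y"
proof -
  let ?d = "c_add A C D x (c_scale A C D (-1) y)"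
  have "c_comp A D C D ?d (c_star A C D ?d) = c_zero A D D"
    using eq[of D "c_star A C D ?d"] by (simp add: comp_add_left comp_scale_left hom_add_neg)
  then have "(c_norm A C D ?d)\<^sup>2 = 0" using norm_comp_star[of C D ?d] by simp
  then show ?thesis using hom_diff_eq_zero[of C D x y] hom_norm_eq_0[of C D ?d] by simp
qed

end

section \<open>The multiplier category\<close>

lemma mult_cat_sel [simp]:
  "c_obj (mult_cat A) = c_obj A"
  "c_hom (mult_cat A) = mult_hom A"
  by (simp_all add: mult_cat_def)

lemma mult_cat_eval [simp]:
  "E \<in> c_obj A \<Longrightarrow> h \<in> c_hom A E C \<Longrightarrow> fst (c_zero (mult_cat A) C D) E h = c_zero A E D"
  "E \<in> c_obj A \<Longrightarrow> g \<in> c_hom A D E \<Longrightarrow> snd (c_zero (mult_cat A) C D) E g = c_zero A C E"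
  "E \<in> c_obj A \<Longrightarrow> h \<in> c_hom A E C \<Longrightarrow>
    fst (c_add (mult_cat A) C D S T) E h = c_add A E D (fst S E h) (fst T E h)"
  "E \<in> c_obj A \<Longrightarrow> g \<in> c_hom A D E \<Longrightarrow>
    snd (c_add (mult_cat A) C D S T) E g = c_add A C E (snd S E g) (snd T E g)"
  "E \<in> c_obj A \<Longrightarrow> h \<in> c_hom A E C \<Longrightarrow>
    fst (c_scale (mult_cat A) C D a T) E h = c_scale A E D a (fst T E h)"
  "E \<in> c_obj A \<Longrightarrow> g \<in> c_hom A D E \<Longrightarrow>
    snd (c_scale (mult_cat A) C D a T) E g = c_scale A C E a (snd T E g)"
  "E \<in> c_obj A \<Longrightarrow> h \<in> c_hom A E C \<Longrightarrow>
    fst (c_comp (mult_cat A) C D B S T) E h = fst S E (fst T E h)"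
  "E \<in> c_obj A \<Longrightarrow> g \<in> c_hom A B E \<Longrightarrow>
    snd (c_comp (mult_cat A) C D B S T) E g = snd T E (snd S E g)"
  "E \<in> c_obj A \<Longrightarrow> h \<in> c_hom A E D \<Longrightarrow>
    fst (c_star (mult_cat A) C D T) E h = c_star A C E (snd T E (c_star A E D h))"
  "E \<in> c_obj A \<Longrightarrow> g \<in> c_hom A C E \<Longrightarrow>
    snd (c_star (mult_cat A) C D T) E g = c_star A E D (fst T E (c_star A C E g))"
  by (simp_all add: mult_cat_def)

lemma mult_embed_eval [simp]:
  "fst (mult_embed A) C = C"
  "E \<in> c_obj A \<Longrightarrow> h \<in> c_hom A E C \<Longrightarrow> fst (snd (mult_embed A) C D f) E h = c_comp A E C D f h"
  "E \<in> c_obj A \<Longrightarrow> g \<in> c_hom A D E \<Longrightarrow> snd (snd (mult_embed A) C D f) E g = c_comp A C D E g f"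
  by (simp_all add: mult_embed_def)

lemma mult_homD:
  assumes "T \<in> mult_hom A C D"
  shows "C \<in> c_obj A" "D \<in> c_obj A"
    and "E \<in> c_obj A \<Longrightarrow> h \<in> c_hom A E C \<Longrightarrow> fst T E h \<in> c_hom A E D"
    and "E \<in> c_obj A \<Longrightarrow> g \<in> c_hom A D E \<Longrightarrow> snd T E g \<in> c_hom A C E"
    and "E \<notin> c_obj A \<or> h \<notin> c_hom A E C \<Longrightarrow> fst T E h = undefined"
    and "E \<notin> c_obj A \<or> g \<notin> c_hom A D E \<Longrightarrow> snd T E g = undefined"
    and "E \<in> c_obj A \<Longrightarrow> h \<in> c_hom A E C \<Longrightarrow> h' \<in> c_hom A E C \<Longrightarrow>
      fst T E (c_add A E C h h') = c_add A E D (fst T E h) (fst T E h')"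
    and "E \<in> c_obj A \<Longrightarrow> h \<in> c_hom A E C \<Longrightarrow>
      fst T E (c_scale A E C a h) = c_scale A E D a (fst T E h)"
    and "E \<in> c_obj A \<Longrightarrow> F \<in> c_obj A \<Longrightarrow> h \<in> c_hom A E C \<Longrightarrow> f \<in> c_hom A F E \<Longrightarrow>
      fst T F (c_comp A F E C h f) = c_comp A F E D (fst T E h) f"
    and "\<exists>K. \<forall>E\<in>c_obj A. \<forall>h\<in>c_hom A E C. c_norm A E D (fst T E h) \<le> K * c_norm A E C h"
    and "E \<in> c_obj A \<Longrightarrow> g \<in> c_hom A D E \<Longrightarrow> g' \<in> c_hom A D E \<Longrightarrow>
      snd T E (c_add A D E g g') = c_add A C E (snd T E g) (snd T E g')"
    and "E \<in> c_obj A \<Longrightarrow> g \<in> c_hom A D E \<Longrightarrow>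
      snd T E (c_scale A D E a g) = c_scale A C E a (snd T E g)"
    and "E \<in> c_obj A \<Longrightarrow> F \<in> c_obj A \<Longrightarrow> g \<in> c_hom A D E \<Longrightarrow> f \<in> c_hom A E F \<Longrightarrow>
      snd T F (c_comp A D E F f g) = c_comp A C E F f (snd T E g)"
    and "\<exists>K. \<forall>E\<in>c_obj A. \<forall>g\<in>c_hom A D E. c_norm A C E (snd T E g) \<le> K * c_norm A D E g"
    and "E \<in> c_obj A \<Longrightarrow> F \<in> c_obj A \<Longrightarrow> f \<in> c_hom A F C \<Longrightarrow> g \<in> c_hom A D E \<Longrightarrow>
      c_comp A F D E g (fst T F f) = c_comp A F C E (snd T E g) f"
  using assms by (cases T, simp add: mult_hom_def; elim conjE; simp)+

lemmas multL_in = mult_homD(3)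
lemmas multR_in = mult_homD(4)
lemmas multL_ext = mult_homD(5)
lemmas multR_ext = mult_homD(6)
lemmas multL_add = mult_homD(7)
lemmas multL_scale = mult_homD(8)
lemmas multL_comp = mult_homD(9)
lemmas multL_bounded = mult_homD(10)
lemmas multR_scale = mult_homD(12)
lemmas multR_bounded = mult_homD(14)
lemmas mult_compat = mult_homD(15)

lemma tendsto_zero_dominated:
  fixes u v :: "nat \<Rightarrow> real"
  assumes "v \<longlonglongrightarrow> 0" "\<And>n. 0 \<le> u n" "\<And>n. u n \<le> c * v n"
  shows "u \<longlonglongrightarrow> 0"
proof (rule tendsto_sandwich[of "\<lambda>_. 0" u _ "\<lambda>n. c * v n"])
  show "(\<lambda>n. c * v n) \<longlonglongrightarrow> 0" using tendsto_mult_right_zero[OF assms(1)] by simp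
qed (use assms in auto)

context pre_cstar_category
begin

section \<open>Building and comparing multipliers\<close>

lemma comp_zero_right:
  assumes [simp]: "C \<in> c_obj A" "D \<in> c_obj A" "E \<in> c_obj A" "g \<in> c_hom A D E"
  shows "c_comp A C D E g (c_zero A C D) = c_zero A C E"
  using comp_scale_right[of C D E "c_zero A C D" g 0] by (simp add: hom_scale_zero_left)

lemma comp_zero_left:
  assumes [simp]: "C \<in> c_obj A" "D \<in> c_obj A" "E \<in> c_obj A" "f \<in> c_hom A C D"
  shows "c_comp A C D E (c_zero A D E) f = c_zero A C E"
  using comp_scale_left[of C D E f "c_zero A D E" 0] by (simp add: hom_scale_zero_left)

text \<open>Transfers a bound from the left component to the right one: by compatibility
  \<open>x x\<^sup>*\<close> is \<open>g\<close> composed with the value of \<open>L\<close> at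
  \<open>x\<^sup>*\<close>, and its norm is the square of the norm of \<open>x\<close>.\<close>

lemma compat_norm_bound:
  assumes [simp]: "C \<in> c_obj A" "D \<in> c_obj A" "E \<in> c_obj A" "g \<in> c_hom A D E" "x \<in> c_hom A C E"
    and [simp]: "\<And>h. h \<in> c_hom A E C \<Longrightarrow> L h \<in> c_hom A E D"
    and compat: "\<And>f. f \<in> c_hom A E C \<Longrightarrow> c_comp A E D E g (L f) = c_comp A E C E x f"
    and K: "0 \<le> K"
    and bound: "\<And>h. h \<in> c_hom A E C \<Longrightarrow> c_norm A E D (L h) \<le> K * c_norm A E C h"
  shows "c_norm A C E x \<le> K * c_norm A D E g"
proof (cases "c_norm A C E x = 0")
  case True
  then show ?thesis using K by simp
next
  case False
  have "c_norm A C E x * c_norm A C E x = c_norm A E E (c_comp A E D E g (L (c_star A C E x)))"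
    using norm_comp_star[of C E x] by (simp add: compat power2_eq_square)
  also have "\<dots> \<le> c_norm A D E g * c_norm A E D (L (c_star A C E x))"
    by (rule norm_comp) simp_all
  also have "\<dots> \<le> c_norm A D E g * (K * c_norm A C E x)"
    using bound[of "c_star A C E x"] by (intro mult_left_mono) (simp_all add: norm_star)
  finally have "c_norm A C E x * c_norm A C E x \<le> (K * c_norm A D E g) * c_norm A C E x"
    by (simp add: ac_simps)
  moreover have "0 < c_norm A C E x" using False hom_norm_nonneg[of C E x] by (simp add: less_le)
  ultimately show ?thesis by (rule mult_right_le_imp_le)
qed

text \<open>Compatibility alone forces linearity and the module property, because composition separates
  morphisms.\<close>

lemma mult_homI:
  assumes obj [simp]: "C \<in> c_obj A" "D \<in> c_obj A"
    and L [simp]: "\<And>E h. E \<in> c_obj A \<Longrightarrow> h \<in> c_hom A E C \<Longrightarrow> fst T E h \<in> c_hom A E D"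
    and R [simp]: "\<And>E g. E \<in> c_obj A \<Longrightarrow> g \<in> c_hom A D E \<Longrightarrow> snd T E g \<in> c_hom A C E"
    and ext: "\<And>E h. E \<notin> c_obj A \<or> h \<notin> c_hom A E C \<Longrightarrow> fst T E h = undefined"
      "\<And>E g. E \<notin> c_obj A \<or> g \<notin> c_hom A D E \<Longrightarrow> snd T E g = undefined"
    and compat: "\<And>E F f g. E \<in> c_obj A \<Longrightarrow> F \<in> c_obj A \<Longrightarrow> f \<in> c_hom A F C \<Longrightarrow> g \<in> c_hom A D E \<Longrightarrow>
      c_comp A F D E g (fst T F f) = c_comp A F C E (snd T E g) f"
    and K: "0 \<le> K"
    and bound: "\<And>E h. E \<in> c_obj A \<Longrightarrow> h \<in> c_hom A E C \<Longrightarrow> c_norm A E D (fst T E h) \<le> K * c_norm A E C h"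
  shows "T \<in> mult_hom A C D"
proof -
  have L_add: "fst T E (c_add A E C h h') = c_add A E D (fst T E h) (fst T E h')"
    if [simp]: "E \<in> c_obj A" "h \<in> c_hom A E C" "h' \<in> c_hom A E C" for E h h'
    by (rule comp_faithful_left[of E D]) (simp_all add: compat comp_add_right)
  have L_scale: "fst T E (c_scale A E C a h) = c_scale A E D a (fst T E h)"
    if [simp]: "E \<in> c_obj A" "h \<in> c_hom A E C" for E h a
    by (rule comp_faithful_left[of E D]) (simp_all add: compat comp_scale_right)
  have L_comp: "fst T F (c_comp A F E C h f) = c_comp A F E D (fst T E h) f"
    if [simp]: "E \<in> c_obj A" "F \<in> c_obj A" "h \<in> c_hom A E C" "f \<in> c_hom A F E" for E F h f
    by (rule comp_faithful_left[of F D]) (simp_all add: compat comp_assoc)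
  have R_add: "snd T E (c_add A D E g g') = c_add A C E (snd T E g) (snd T E g')"
    if [simp]: "E \<in> c_obj A" "g \<in> c_hom A D E" "g' \<in> c_hom A D E" for E g g'
    by (rule comp_faithful_right[of C E]) (simp_all add: compat[symmetric] comp_add_left)
  have R_scale: "snd T E (c_scale A D E a g) = c_scale A C E a (snd T E g)"
    if [simp]: "E \<in> c_obj A" "g \<in> c_hom A D E" for E g a
    by (rule comp_faithful_right[of C E]) (simp_all add: compat[symmetric] comp_scale_left)
  have R_comp: "snd T F (c_comp A D E F f g) = c_comp A C E F f (snd T E g)"
    if [simp]: "E \<in> c_obj A" "F \<in> c_obj A" "g \<in> c_hom A D E" "f \<in> c_hom A E F" for E F g f
    by (rule comp_faithful_right[of C F]) (simp_all add: compat[symmetric] comp_assoc[symmetric])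
  have R_bound: "c_norm A C E (snd T E g) \<le> K * c_norm A D E g"
    if [simp]: "E \<in> c_obj A" "g \<in> c_hom A D E" for E g
    by (rule compat_norm_bound[of C D E g _ "fst T E"]) (simp_all add: compat K bound)
  show ?thesis
    unfolding mult_hom_def case_prod_beta
    by (intro CollectI conjI ballI allI impI exI[of _ K])
      (simp_all add: L_add L_scale L_comp R_add R_scale R_comp R_bound compat bound ext)
qed

text \<open>The left component determines the right one, because \<open>R(g) f = g L(f)\<close> for
  all \<open>f\<close> and composition separates morphisms. Identities between multipliers are
  therefore checked on left components only.\<close>

lemma mult_eqI:
  assumes S: "S \<in> mult_hom A C D" and T: "T \<in> mult_hom A C D"
    and eq: "\<And>E h. E \<in> c_obj A \<Longrightarrow> h \<in> c_hom A E C \<Longrightarrow> fst S E h = fst T E h"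
  shows "S = T"
proof (rule prod_eqI; rule ext; rule ext)
  have [simp]: "C \<in> c_obj A" "D \<in> c_obj A" using S by (simp_all add: mult_homD)
  fix E x
  show "fst S E x = fst T E x"
    using eq multL_ext[OF S] multL_ext[OF T] by (cases "E \<in> c_obj A \<and> x \<in> c_hom A E C") auto
  show "snd S E x = snd T E x"
  proof (cases "E \<in> c_obj A \<and> x \<in> c_hom A D E")
    case True
    then have [simp]: "E \<in> c_obj A" "x \<in> c_hom A D E" by auto
    show ?thesis
      by (rule comp_faithful_right[of C E])
        (simp_all add: multR_in[OF S] multR_in[OF T] mult_compat[OF S, symmetric] mult_compat[OF T, symmetric] eq)
  next
    case False
    then show ?thesis using multR_ext[OF S] multR_ext[OF T] by auto
  qed
qed

section \<open>Operator norms of the two components\<close>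

lemma multL_norms_bdd:
  assumes T: "T \<in> mult_hom A C D"
  shows "bdd_above (insert 0 {c_norm A E D (fst T E h) |E h. E \<in> c_obj A \<and> h \<in> c_hom A E C \<and> c_norm A E C h \<le> 1})"
proof -
  have [simp]: "C \<in> c_obj A" "D \<in> c_obj A" using T by (simp_all add: mult_homD)
  obtain K where K: "\<And>E h. E \<in> c_obj A \<Longrightarrow> h \<in> c_hom A E C \<Longrightarrow> c_norm A E D (fst T E h) \<le> K * c_norm A E C h"
    using multL_bounded[OF T] by blast
  \<comment> \<open>The constant \<open>K\<close> in \<open>mult_hom\<close> carries no sign; where
    there are no nonzero morphisms it may be negative.\<close>
  have "c_norm A E D (fst T E h) \<le> \<bar>K\<bar>"
    if [simp]: "E \<in> c_obj A" "h \<in> c_hom A E C" and "c_norm A E C h \<le> 1" for E h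
  proof -
    have "c_norm A E D (fst T E h) \<le> K * c_norm A E C h" by (simp add: K)
    also have "\<dots> \<le> \<bar>K\<bar> * 1" using that by (intro mult_mono) auto
    finally show ?thesis by simp
  qed
  then show ?thesis by (intro bdd_aboveI[of _ "\<bar>K\<bar>"]) auto
qed

lemma multL_norm_nonneg: "T \<in> mult_hom A C D \<Longrightarrow> 0 \<le> mult_normL A C D (fst T)"
  unfolding mult_normL_def by (rule cSup_upper[OF _ multL_norms_bdd]) auto

lemma multL_norm_bound:
  assumes T: "T \<in> mult_hom A C D" and [simp]: "E \<in> c_obj A" "h \<in> c_hom A E C"
  shows "c_norm A E D (fst T E h) \<le> mult_normL A C D (fst T) * c_norm A E C h"
proof -
  have [simp]: "C \<in> c_obj A" "D \<in> c_obj A" using T by (simp_all add: mult_homD)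
  note [simp] = multL_in[OF T]
  obtain K where K: "\<And>E h. E \<in> c_obj A \<Longrightarrow> h \<in> c_hom A E C \<Longrightarrow> c_norm A E D (fst T E h) \<le> K * c_norm A E C h"
    using multL_bounded[OF T] by blast
  show ?thesis
  proof (cases "c_norm A E C h = 0")
    \<comment> \<open>A morphism of norm zero cannot be rescaled to norm 1; the constant
      \<open>K\<close> forces its image to have norm zero.\<close>
    case True
    then show ?thesis using K[of E h] by simp
  next
    case False
    define n where "n = c_norm A E C h"
    have n: "n > 0" using False hom_norm_nonneg[of E C h] by (simp add: n_def less_le)
    let ?h = "c_scale A E C (of_real (1 / n)) h"
    have "c_norm A E C ?h = 1" using n by (simp add: hom_norm_scale norm_divide n_def[symmetric])
    then have "c_norm A E D (fst T E ?h) \<le> mult_normL A C D (fst T)"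
      unfolding mult_normL_def by (intro cSup_upper[OF _ multL_norms_bdd[OF T]]) force
    then show ?thesis using n
      by (simp add: multL_scale[OF T] hom_norm_scale norm_divide n_def[symmetric] divide_le_eq)
  qed
qed

lemma multL_norm_least:
  assumes "0 \<le> K"
    and "\<And>E h. E \<in> c_obj A \<Longrightarrow> h \<in> c_hom A E C \<Longrightarrow> c_norm A E D (L E h) \<le> K * c_norm A E C h"
  shows "mult_normL A C D L \<le> K"
  unfolding mult_normL_def
  by (rule cSup_least) (use assms mult_left_le[of _ K] in \<open>fastforce intro: order_trans\<close>)+

lemma multR_norms_bdd:
  assumes T: "T \<in> mult_hom A C D"
  shows "bdd_above (insert 0 {c_norm A C E (snd T E h) |E h. E \<in> c_obj A \<and> h \<in> c_hom A D E \<and> c_norm A D E h \<le> 1})"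
proof -
  have [simp]: "C \<in> c_obj A" "D \<in> c_obj A" using T by (simp_all add: mult_homD)
  obtain K where K: "\<And>E h. E \<in> c_obj A \<Longrightarrow> h \<in> c_hom A D E \<Longrightarrow> c_norm A C E (snd T E h) \<le> K * c_norm A D E h"
    using multR_bounded[OF T] by blast
  have "c_norm A C E (snd T E h) \<le> \<bar>K\<bar>"
    if [simp]: "E \<in> c_obj A" "h \<in> c_hom A D E" and "c_norm A D E h \<le> 1" for E h
  proof -
    have "c_norm A C E (snd T E h) \<le> K * c_norm A D E h" by (simp add: K)
    also have "\<dots> \<le> \<bar>K\<bar> * 1" using that by (intro mult_mono) auto
    finally show ?thesis by simp
  qed
  then show ?thesis by (intro bdd_aboveI[of _ "\<bar>K\<bar>"]) auto
qed

lemma multR_norm_nonneg: "T \<in> mult_hom A C D \<Longrightarrow> 0 \<le> mult_normR A C D (snd T)"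
  unfolding mult_normR_def by (rule cSup_upper[OF _ multR_norms_bdd]) auto

lemma multR_norm_bound:
  assumes T: "T \<in> mult_hom A C D" and [simp]: "E \<in> c_obj A" "g \<in> c_hom A D E"
  shows "c_norm A C E (snd T E g) \<le> mult_normR A C D (snd T) * c_norm A D E g"
proof -
  have [simp]: "C \<in> c_obj A" "D \<in> c_obj A" using T by (simp_all add: mult_homD)
  note [simp] = multR_in[OF T]
  obtain K where K: "\<And>E h. E \<in> c_obj A \<Longrightarrow> h \<in> c_hom A D E \<Longrightarrow> c_norm A C E (snd T E h) \<le> K * c_norm A D E h"
    using multR_bounded[OF T] by blast
  show ?thesis
  proof (cases "c_norm A D E g = 0")
    case True
    then show ?thesis using K[of E g] by simp
  next
    case False
    define n where "n = c_norm A D E g"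
    have n: "n > 0" using False hom_norm_nonneg[of D E g] by (simp add: n_def less_le)
    let ?g = "c_scale A D E (of_real (1 / n)) g"
    have "c_norm A D E ?g = 1" using n by (simp add: hom_norm_scale norm_divide n_def[symmetric])
    then have "c_norm A C E (snd T E ?g) \<le> mult_normR A C D (snd T)"
      unfolding mult_normR_def by (intro cSup_upper[OF _ multR_norms_bdd[OF T]]) force
    then show ?thesis using n
      by (simp add: multR_scale[OF T] hom_norm_scale norm_divide n_def[symmetric] divide_le_eq)
  qed
qed

lemma multR_norm_least:
  assumes "0 \<le> K"
    and "\<And>E g. E \<in> c_obj A \<Longrightarrow> g \<in> c_hom A D E \<Longrightarrow> c_norm A C E (R E g) \<le> K * c_norm A D E g"
  shows "mult_normR A C D R \<le> K"
  unfolding mult_normR_def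
  by (rule cSup_least) (use assms mult_left_le[of _ K] in \<open>fastforce intro: order_trans\<close>)+

text \<open>For \<open>x = L(h)\<close>, compatibility writes \<open>x\<^sup>* x\<close> as the
  value of \<open>R\<close> at \<open>x\<^sup>*\<close> composed with \<open>h\<close>; cancelling
  one factor \<open>\<parallel>x\<parallel>\<close> bounds \<open>L\<close> by \<open>R\<close>. The
  reverse estimate is \<open>compat_norm_bound\<close>.\<close>

lemma mult_normL_eq_mult_normR:
  assumes T: "T \<in> mult_hom A C D"
  shows "mult_normL A C D (fst T) = mult_normR A C D (snd T)"
proof (rule antisym)
  have [simp]: "C \<in> c_obj A" "D \<in> c_obj A" using T by (simp_all add: mult_homD)
  note [simp] = multL_in[OF T] multR_in[OF T]
  show "mult_normL A C D (fst T) \<le> mult_normR A C D (snd T)"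
  proof (rule multL_norm_least[OF multR_norm_nonneg[OF T]])
    fix E h assume [simp]: "E \<in> c_obj A" "h \<in> c_hom A E C"
    let ?x = "fst T E h"
    have "(c_norm A E D ?x)\<^sup>2 = c_norm A E E (c_comp A E C E (snd T E (c_star A E D ?x)) h)"
      using norm_star_comp[of E D ?x] by (simp add: mult_compat[OF T])
    also have "\<dots> \<le> c_norm A C E (snd T E (c_star A E D ?x)) * c_norm A E C h"
      by (rule norm_comp) simp_all
    also have "\<dots> \<le> (mult_normR A C D (snd T) * c_norm A E D ?x) * c_norm A E C h"
      using multR_norm_bound[OF T, of E "c_star A E D ?x"] by (intro mult_right_mono) (simp_all add: norm_star)
    finally have le: "c_norm A E D ?x * c_norm A E D ?x
        \<le> (mult_normR A C D (snd T) * c_norm A E C h) * c_norm A E D ?x"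
      by (simp add: power2_eq_square ac_simps)
    show "c_norm A E D ?x \<le> mult_normR A C D (snd T) * c_norm A E C h"
    proof (cases "c_norm A E D ?x = 0")
      case True
      then show ?thesis by (simp add: multR_norm_nonneg[OF T])
    next
      case False
      then have "0 < c_norm A E D ?x" using hom_norm_nonneg[of E D ?x] by (simp add: less_le)
      with le show ?thesis by (rule mult_right_le_imp_le)
    qed
  qed
  show "mult_normR A C D (snd T) \<le> mult_normL A C D (fst T)"
  proof (rule multR_norm_least[OF multL_norm_nonneg[OF T]])
    fix E g assume [simp]: "E \<in> c_obj A" "g \<in> c_hom A D E"
    show "c_norm A C E (snd T E g) \<le> mult_normL A C D (fst T) * c_norm A D E g"
      by (rule compat_norm_bound[of C D E g _ "fst T E"])
        (simp_all add: mult_compat[OF T] multL_norm_bound[OF T] multL_norm_nonneg[OF T])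
  qed
qed

lemma mult_norm_eq: "T \<in> mult_hom A C D \<Longrightarrow> c_norm (mult_cat A) C D T = mult_normL A C D (fst T)"
  by (simp add: mult_cat_def mult_normL_eq_mult_normR)

lemma mult_norm_bound:
  assumes "T \<in> mult_hom A C D" "E \<in> c_obj A" "h \<in> c_hom A E C"
  shows "c_norm A E D (fst T E h) \<le> c_norm (mult_cat A) C D T * c_norm A E C h"
  using assms by (simp add: mult_norm_eq multL_norm_bound)

lemma mult_norm_boundR:
  assumes "T \<in> mult_hom A C D" "E \<in> c_obj A" "g \<in> c_hom A D E"
  shows "c_norm A C E (snd T E g) \<le> c_norm (mult_cat A) C D T * c_norm A D E g"
  using assms by (simp add: mult_norm_eq mult_normL_eq_mult_normR multR_norm_bound)

lemma mult_norm_least: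
  assumes "T \<in> mult_hom A C D" "0 \<le> K"
    and "\<And>E h. E \<in> c_obj A \<Longrightarrow> h \<in> c_hom A E C \<Longrightarrow> c_norm A E D (fst T E h) \<le> K * c_norm A E C h"
  shows "c_norm (mult_cat A) C D T \<le> K"
  using assms by (simp add: mult_norm_eq multL_norm_least)

lemma mult_norm_nonneg: "T \<in> mult_hom A C D \<Longrightarrow> 0 \<le> c_norm (mult_cat A) C D T"
  by (simp add: mult_norm_eq multL_norm_nonneg)

section \<open>Operations on multipliers\<close>

lemma mult_zero_in:
  assumes [simp]: "C \<in> c_obj A" "D \<in> c_obj A"
  shows "c_zero (mult_cat A) C D \<in> mult_hom A C D"
  by (rule mult_homI[where K = 0]) (auto simp: comp_zero_left comp_zero_right, auto simp: mult_cat_def)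

lemma mult_add_in:
  assumes S: "S \<in> mult_hom A C D" and T: "T \<in> mult_hom A C D"
  shows "c_add (mult_cat A) C D S T \<in> mult_hom A C D"
proof -
  have [simp]: "C \<in> c_obj A" "D \<in> c_obj A" using T by (simp_all add: mult_homD)
  note [simp] = multL_in[OF S] multR_in[OF S] multL_in[OF T] multR_in[OF T]
  show ?thesis
  proof (rule mult_homI[where K = "c_norm (mult_cat A) C D S + c_norm (mult_cat A) C D T"])
    fix E h assume [simp]: "E \<in> c_obj A" "h \<in> c_hom A E C"
    have "c_norm A E D (fst (c_add (mult_cat A) C D S T) E h)
        \<le> c_norm A E D (fst S E h) + c_norm A E D (fst T E h)"
      by (simp add: hom_norm_triangle)
    also have "\<dots> \<le> (c_norm (mult_cat A) C D S + c_norm (mult_cat A) C D T) * c_norm A E C h"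
      using mult_norm_bound[OF S] mult_norm_bound[OF T] by (simp add: distrib_right add_mono)
    finally show "c_norm A E D (fst (c_add (mult_cat A) C D S T) E h)
        \<le> (c_norm (mult_cat A) C D S + c_norm (mult_cat A) C D T) * c_norm A E C h" .
  next
    fix E F f g
    assume [simp]: "E \<in> c_obj A" "F \<in> c_obj A" "f \<in> c_hom A F C" "g \<in> c_hom A D E"
    show "c_comp A F D E g (fst (c_add (mult_cat A) C D S T) F f)
        = c_comp A F C E (snd (c_add (mult_cat A) C D S T) E g) f"
      by (simp add: comp_add_left comp_add_right mult_compat[OF S] mult_compat[OF T])
  qed (simp_all add: mult_norm_nonneg[OF S] mult_norm_nonneg[OF T], auto simp: mult_cat_def)
qed

lemma mult_scale_in:
  assumes T: "T \<in> mult_hom A C D"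
  shows "c_scale (mult_cat A) C D a T \<in> mult_hom A C D"
proof -
  have [simp]: "C \<in> c_obj A" "D \<in> c_obj A" using T by (simp_all add: mult_homD)
  note [simp] = multL_in[OF T] multR_in[OF T]
  show ?thesis
  proof (rule mult_homI[where K = "cmod a * c_norm (mult_cat A) C D T"])
    fix E h assume [simp]: "E \<in> c_obj A" "h \<in> c_hom A E C"
    show "c_norm A E D (fst (c_scale (mult_cat A) C D a T) E h)
        \<le> cmod a * c_norm (mult_cat A) C D T * c_norm A E C h"
      using mult_norm_bound[OF T] by (simp add: hom_norm_scale mult.assoc mult_left_mono)
  next
    fix E F f g
    assume [simp]: "E \<in> c_obj A" "F \<in> c_obj A" "f \<in> c_hom A F C" "g \<in> c_hom A D E"
    show "c_comp A F D E g (fst (c_scale (mult_cat A) C D a T) F f)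
        = c_comp A F C E (snd (c_scale (mult_cat A) C D a T) E g) f"
      by (simp add: comp_scale_left comp_scale_right mult_compat[OF T])
  qed (simp_all add: mult_norm_nonneg[OF T], auto simp: mult_cat_def)
qed

lemma mult_comp_in:
  assumes T: "T \<in> mult_hom A C D" and S: "S \<in> mult_hom A D B"
  shows "c_comp (mult_cat A) C D B S T \<in> mult_hom A C B"
    and "c_norm (mult_cat A) C B (c_comp (mult_cat A) C D B S T)
      \<le> c_norm (mult_cat A) D B S * c_norm (mult_cat A) C D T"
proof -
  have [simp]: "C \<in> c_obj A" "D \<in> c_obj A" "B \<in> c_obj A" using S T by (simp_all add: mult_homD)
  note [simp] = multL_in[OF T] multR_in[OF T] multL_in[OF S] multR_in[OF S]
  have K: "0 \<le> c_norm (mult_cat A) D B S * c_norm (mult_cat A) C D T"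
    by (simp add: mult_norm_nonneg[OF S] mult_norm_nonneg[OF T])
  have bound: "c_norm A E B (fst (c_comp (mult_cat A) C D B S T) E h)
      \<le> c_norm (mult_cat A) D B S * c_norm (mult_cat A) C D T * c_norm A E C h"
    if [simp]: "E \<in> c_obj A" "h \<in> c_hom A E C" for E h
  proof -
    have "c_norm A E B (fst S E (fst T E h)) \<le> c_norm (mult_cat A) D B S * c_norm A E D (fst T E h)"
      by (simp add: mult_norm_bound[OF S])
    also have "\<dots> \<le> c_norm (mult_cat A) D B S * (c_norm (mult_cat A) C D T * c_norm A E C h)"
      by (simp add: mult_norm_bound[OF T] mult_norm_nonneg[OF S] mult_left_mono)
    finally show ?thesis by (simp add: mult.assoc)
  qed
  show in_hom: "c_comp (mult_cat A) C D B S T \<in> mult_hom A C B"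
    by (rule mult_homI[OF _ _ _ _ _ _ _ K bound])
      (simp_all add: mult_compat[OF S] mult_compat[OF T], auto simp: mult_cat_def)
  show "c_norm (mult_cat A) C B (c_comp (mult_cat A) C D B S T)
      \<le> c_norm (mult_cat A) D B S * c_norm (mult_cat A) C D T"
    using in_hom K bound by (rule mult_norm_least)
qed

lemma mult_star_in:
  assumes T: "T \<in> mult_hom A C D"
  shows "c_star (mult_cat A) C D T \<in> mult_hom A D C"
    and "c_norm (mult_cat A) D C (c_star (mult_cat A) C D T) \<le> c_norm (mult_cat A) C D T"
proof -
  have [simp]: "C \<in> c_obj A" "D \<in> c_obj A" using T by (simp_all add: mult_homD)
  note [simp] = multL_in[OF T] multR_in[OF T]
  have bound: "c_norm A E C (fst (c_star (mult_cat A) C D T) E h) \<le> c_norm (mult_cat A) C D T * c_norm A E D h"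
    if [simp]: "E \<in> c_obj A" "h \<in> c_hom A E D" for E h
    using mult_norm_boundR[OF T, of E "c_star A E D h"] by (simp add: norm_star)
  \<comment> \<open>Taking adjoints turns this into the compatibility of \<open>T\<close> at the
    pair \<open>g\<^sup>*\<close>, \<open>f\<^sup>*\<close>.\<close>
  have compat: "c_comp A F C E g (c_star A C F (snd T F (c_star A F D f)))
      = c_comp A F D E (c_star A E D (fst T E (c_star A C E g))) f"
    if [simp]: "E \<in> c_obj A" "F \<in> c_obj A" "f \<in> c_hom A F D" "g \<in> c_hom A C E" for E F f g
  proof -
    have "c_comp A F C E g (c_star A C F (snd T F (c_star A F D f)))
        = c_star A E F (c_comp A E C F (snd T F (c_star A F D f)) (c_star A C E g))"
      by (simp add: star_comp star_star)
    also have "\<dots> = c_star A E F (c_comp A E D F (c_star A F D f) (fst T E (c_star A C E g)))"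
      by (simp add: mult_compat[OF T])
    also have "\<dots> = c_comp A F D E (c_star A E D (fst T E (c_star A C E g))) f"
      by (simp add: star_comp star_star)
    finally show ?thesis .
  qed
  show in_hom: "c_star (mult_cat A) C D T \<in> mult_hom A D C"
    by (rule mult_homI[OF _ _ _ _ _ _ _ mult_norm_nonneg[OF T] bound])
      (simp_all add: compat, auto simp: mult_cat_def)
  show "c_norm (mult_cat A) D C (c_star (mult_cat A) C D T) \<le> c_norm (mult_cat A) C D T"
    using in_hom mult_norm_nonneg[OF T] bound by (rule mult_norm_least)
qed

definition mult_unit :: "'o \<Rightarrow> ('o,'m) mult" where
  "mult_unit C = (\<lambda>E h. if E \<in> c_obj A \<and> h \<in> c_hom A E C then h else undefined,
     \<lambda>E h. if E \<in> c_obj A \<and> h \<in> c_hom A C E then h else undefined)"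

lemma mult_unit_eval [simp]:
  "E \<in> c_obj A \<Longrightarrow> h \<in> c_hom A E C \<Longrightarrow> fst (mult_unit C) E h = h"
  "E \<in> c_obj A \<Longrightarrow> g \<in> c_hom A C E \<Longrightarrow> snd (mult_unit C) E g = g"
  by (simp_all add: mult_unit_def)

lemma mult_unit_in: "C \<in> c_obj A \<Longrightarrow> mult_unit C \<in> mult_hom A C C"
  by (rule mult_homI[where K = 1]) (auto simp: mult_unit_def)

lemma is_unit_mult_unit:
  assumes [simp]: "C \<in> c_obj A"
  shows "is_unit (mult_cat A) C (mult_unit C)"
  unfolding is_unit_def
proof (intro conjI ballI)
  note [simp] = mult_unit_in mult_comp_in(1)
  show "mult_unit C \<in> c_hom (mult_cat A) C C" by simp
  fix D f assume "D \<in> c_obj (mult_cat A)"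
  then have [simp]: "D \<in> c_obj A" by simp
  show "c_comp (mult_cat A) C C D f (mult_unit C) = f" if "f \<in> c_hom (mult_cat A) C D"
    by (rule mult_eqI[of _ C D]) (use that in simp_all)
  show "c_comp (mult_cat A) D C C (mult_unit C) f = f" if "f \<in> c_hom (mult_cat A) D C"
    by (rule mult_eqI[of _ D C]) (use that in \<open>simp_all add: multL_in\<close>)
qed

lemma unital_mult_cat: "unital (mult_cat A)"
  unfolding unital_def using is_unit_mult_unit by (metis mult_cat_sel(1))

lemma star_comp_mult:
  assumes T: "T \<in> mult_hom A C D" and [simp]: "E \<in> c_obj A" "h \<in> c_hom A E C"
  shows "c_comp A E C E (c_star A E C h)
      (fst (c_comp (mult_cat A) C D C (c_star (mult_cat A) C D T) T) E h)
    = c_comp A E D E (c_star A E D (fst T E h)) (fst T E h)"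
proof -
  have [simp]: "C \<in> c_obj A" "D \<in> c_obj A" using T by (simp_all add: mult_homD)
  note [simp] = multL_in[OF T] multR_in[OF T]
  let ?x = "fst T E h"
  have "c_comp A E C E (c_star A E C h) (c_star A C E (snd T E (c_star A E D ?x)))
      = c_star A E E (c_comp A E C E (snd T E (c_star A E D ?x)) h)"
    by (simp add: star_comp)
  also have "\<dots> = c_star A E E (c_comp A E D E (c_star A E D ?x) ?x)"
    by (simp add: mult_compat[OF T])
  finally show ?thesis by (simp add: star_comp star_star)
qed

lemma mult_norm_star_comp:
  assumes T: "T \<in> mult_hom A C D"
  shows "c_norm (mult_cat A) C C (c_comp (mult_cat A) C D C (c_star (mult_cat A) C D T) T)
    = (c_norm (mult_cat A) C D T)\<^sup>2"
proof (rule antisym)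
  have [simp]: "C \<in> c_obj A" "D \<in> c_obj A" using T by (simp_all add: mult_homD)
  note [simp] = multL_in[OF T] multR_in[OF T]
  let ?a = "c_comp (mult_cat A) C D C (c_star (mult_cat A) C D T) T"
  have a: "?a \<in> mult_hom A C C" using mult_comp_in(1)[OF T mult_star_in(1)[OF T]] .
  have "c_norm (mult_cat A) C C ?a
      \<le> c_norm (mult_cat A) D C (c_star (mult_cat A) C D T) * c_norm (mult_cat A) C D T"
    using mult_comp_in(2)[OF T mult_star_in(1)[OF T]] .
  also have "\<dots> \<le> c_norm (mult_cat A) C D T * c_norm (mult_cat A) C D T"
    using mult_star_in(2)[OF T] mult_norm_nonneg[OF T] by (rule mult_right_mono)
  finally show "c_norm (mult_cat A) C C ?a \<le> (c_norm (mult_cat A) C D T)\<^sup>2"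
    by (simp add: power2_eq_square)
  have nn: "0 \<le> c_norm (mult_cat A) C C ?a" using a by (rule mult_norm_nonneg)
  have "c_norm (mult_cat A) C D T \<le> sqrt (c_norm (mult_cat A) C C ?a)"
  proof (rule mult_norm_least[OF T])
    fix E h assume [simp]: "E \<in> c_obj A" "h \<in> c_hom A E C"
    have "(c_norm A E D (fst T E h))\<^sup>2 = c_norm A E E (c_comp A E C E (c_star A E C h) (fst ?a E h))"
      by (simp add: star_comp_mult[OF T] norm_star_comp del: mult_cat_eval)
    also have "\<dots> \<le> c_norm A C E (c_star A E C h) * c_norm A E C (fst ?a E h)"
      using multL_in[OF a, of E h] by (intro norm_comp) simp_all
    also have "\<dots> \<le> c_norm A E C h * (c_norm (mult_cat A) C C ?a * c_norm A E C h)"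
      using mult_norm_bound[OF a, of E h] by (simp add: norm_star mult_left_mono del: mult_cat_eval)
    also have "\<dots> = (sqrt (c_norm (mult_cat A) C C ?a) * c_norm A E C h)\<^sup>2"
      using nn by (simp add: power_mult_distrib) (simp add: power2_eq_square)
    finally show "c_norm A E D (fst T E h) \<le> sqrt (c_norm (mult_cat A) C C ?a) * c_norm A E C h"
      by (rule power2_le_imp_le) (use nn in simp)
  qed (use nn in simp)
  then show "(c_norm (mult_cat A) C D T)\<^sup>2 \<le> c_norm (mult_cat A) C C ?a"
    using mult_norm_nonneg[OF T] nn by (metis power_mono real_sqrt_pow2)
qed

section \<open>Norm axioms and completeness\<close>

lemma mult_norm_eq_0:
  assumes T: "T \<in> mult_hom A C D"
  shows "c_norm (mult_cat A) C D T = 0 \<longleftrightarrow> T = c_zero (mult_cat A) C D"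
proof
  have [simp]: "C \<in> c_obj A" "D \<in> c_obj A" using T by (simp_all add: mult_homD)
  note [simp] = multL_in[OF T]
  assume 0: "c_norm (mult_cat A) C D T = 0"
  show "T = c_zero (mult_cat A) C D"
  proof (rule mult_eqI[OF T mult_zero_in])
    fix E h assume [simp]: "E \<in> c_obj A" "h \<in> c_hom A E C"
    have "c_norm A E D (fst T E h) = 0"
      using mult_norm_bound[OF T, of E h] by (intro antisym) (simp_all add: 0)
    then show "fst T E h = fst (c_zero (mult_cat A) C D) E h" by (simp add: hom_norm_eq_0)
  qed simp_all
next
  have [simp]: "C \<in> c_obj A" "D \<in> c_obj A" using T by (simp_all add: mult_homD)
  assume "T = c_zero (mult_cat A) C D"
  then show "c_norm (mult_cat A) C D T = 0"
    using mult_norm_least[OF T order_refl] mult_norm_nonneg[OF T] by simp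
qed

lemma mult_norm_add:
  assumes S: "S \<in> mult_hom A C D" and T: "T \<in> mult_hom A C D"
  shows "c_norm (mult_cat A) C D (c_add (mult_cat A) C D S T)
    \<le> c_norm (mult_cat A) C D S + c_norm (mult_cat A) C D T"
proof (rule mult_norm_least[OF mult_add_in[OF S T]])
  have [simp]: "C \<in> c_obj A" "D \<in> c_obj A" using T by (simp_all add: mult_homD)
  note [simp] = multL_in[OF S] multL_in[OF T]
  fix E h assume [simp]: "E \<in> c_obj A" "h \<in> c_hom A E C"
  have "c_norm A E D (fst (c_add (mult_cat A) C D S T) E h)
      \<le> c_norm A E D (fst S E h) + c_norm A E D (fst T E h)"
    by (simp add: hom_norm_triangle)
  also have "\<dots> \<le> (c_norm (mult_cat A) C D S + c_norm (mult_cat A) C D T) * c_norm A E C h"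
    using mult_norm_bound[OF S] mult_norm_bound[OF T] by (simp add: distrib_right add_mono)
  finally show "c_norm A E D (fst (c_add (mult_cat A) C D S T) E h)
      \<le> (c_norm (mult_cat A) C D S + c_norm (mult_cat A) C D T) * c_norm A E C h" .
qed (simp add: mult_norm_nonneg[OF S] mult_norm_nonneg[OF T])

lemma mult_norm_scale:
  assumes T: "T \<in> mult_hom A C D"
  shows "c_norm (mult_cat A) C D (c_scale (mult_cat A) C D a T) = cmod a * c_norm (mult_cat A) C D T"
proof -
  have [simp]: "C \<in> c_obj A" "D \<in> c_obj A" using T by (simp_all add: mult_homD)
  have le: "c_norm (mult_cat A) C D (c_scale (mult_cat A) C D b S) \<le> cmod b * c_norm (mult_cat A) C D S"
    if S: "S \<in> mult_hom A C D" for S b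
    by (rule mult_norm_least[OF mult_scale_in[OF S]])
      (use mult_norm_bound[OF S] in \<open>simp_all add: hom_norm_scale mult.assoc mult_left_mono
          mult_norm_nonneg[OF S] multL_in[OF S]\<close>)
  show ?thesis
  proof (cases "a = 0")
    case True
    then show ?thesis using le[OF T, of a] mult_norm_nonneg[OF mult_scale_in[OF T], of a] by simp
  next
    case False
    \<comment> \<open>The upper bound \<open>le\<close> for the scalar \<open>1 / a\<close> is the
      lower bound for \<open>a\<close>.\<close>
    have "c_scale (mult_cat A) C D (1 / a) (c_scale (mult_cat A) C D a T) = T"
      by (rule mult_eqI[OF mult_scale_in[OF mult_scale_in[OF T]] T])
        (use False in \<open>simp_all add: multL_in[OF T] hom_scale_scale hom_scale_one\<close>)
    then have "c_norm (mult_cat A) C D T \<le> cmod (1 / a) * c_norm (mult_cat A) C D (c_scale (mult_cat A) C D a T)"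
      using le[OF mult_scale_in[OF T, of a], of "1 / a"] by simp
    then have "cmod a * c_norm (mult_cat A) C D T \<le> c_norm (mult_cat A) C D (c_scale (mult_cat A) C D a T)"
      using False by (simp add: norm_divide field_simps)
    then show ?thesis using le[OF T, of a] by simp
  qed
qed

text \<open>Pointwise limits exist in the complete hom sets. Of the algebraic conditions only
  compatibility is passed to the limit, since \<open>mult_homI\<close> recovers linearity and the
  module property from it. An estimate uniform in the argument then upgrades pointwise convergence
  to convergence in norm.\<close>

lemma mult_complete:
  assumes [simp]: "C \<in> c_obj A" "D \<in> c_obj A"
    and X: "\<And>n. X n \<in> mult_hom A C D"
    and Cauchy: "\<And>e. e > 0 \<Longrightarrow> \<exists>N. \<forall>m\<ge>N. \<forall>n\<ge>N.
      c_norm (mult_cat A) C D (c_add (mult_cat A) C D (X m) (c_scale (mult_cat A) C D (-1) (X n))) < e"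
  shows "\<exists>T\<in>mult_hom A C D.
    (\<lambda>n. c_norm (mult_cat A) C D (c_add (mult_cat A) C D (X n) (c_scale (mult_cat A) C D (-1) T))) \<longlonglongrightarrow> 0"
proof -
  let ?d = "\<lambda>S T. c_add (mult_cat A) C D S (c_scale (mult_cat A) C D (-1) T)"
  note [simp] = multL_in[OF X] multR_in[OF X]
  have d_in: "?d S T \<in> mult_hom A C D" if "S \<in> mult_hom A C D" "T \<in> mult_hom A C D" for S T
    using that by (simp add: mult_add_in mult_scale_in)
  have Cauchy': "\<exists>N. \<forall>m\<ge>N. \<forall>n\<ge>N. c_norm (mult_cat A) C D (?d (X m) (X n)) * b < e" if eb: "e > 0" "b \<ge> 0" for e b
  proof -
    \<comment> \<open>Dividing by \<open>b + 1\<close> also covers \<open>b = 0\<close>.\<close>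
    obtain N where N: "\<forall>m\<ge>N. \<forall>n\<ge>N. c_norm (mult_cat A) C D (?d (X m) (X n)) < e / (b + 1)"
      using Cauchy[of "e / (b + 1)"] eb by auto
    have "c_norm (mult_cat A) C D (?d (X m) (X n)) * b < e" if "m \<ge> N" "n \<ge> N" for m n
    proof -
      have "c_norm (mult_cat A) C D (?d (X m) (X n)) * b \<le> c_norm (mult_cat A) C D (?d (X m) (X n)) * (b + 1)"
        by (intro mult_left_mono mult_norm_nonneg d_in X) simp
      also have "\<dots> < e" using N that \<open>b \<ge> 0\<close> by (simp add: less_divide_eq)
      finally show ?thesis .
    qed
    then show ?thesis by blast
  qed
  have "\<exists>x\<in>c_hom A E D. (\<lambda>n. c_norm A E D (c_add A E D (fst (X n) E h) (c_scale A E D (-1) x))) \<longlonglongrightarrow> 0"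
    if [simp]: "E \<in> c_obj A" "h \<in> c_hom A E C" for E h
  proof (rule hom_complete)
    fix e :: real assume "e > 0"
    then obtain N where N: "\<forall>m\<ge>N. \<forall>n\<ge>N. c_norm (mult_cat A) C D (?d (X m) (X n)) * c_norm A E C h < e"
      using Cauchy'[of e "c_norm A E C h"] by auto
    have "c_norm A E D (c_add A E D (fst (X m) E h) (c_scale A E D (-1) (fst (X n) E h)))
        \<le> c_norm (mult_cat A) C D (?d (X m) (X n)) * c_norm A E C h" for m n
      using mult_norm_bound[OF d_in[OF X X], of E h m n] by simp
    then show "\<exists>N. \<forall>m\<ge>N. \<forall>n\<ge>N.
        c_norm A E D (c_add A E D (fst (X m) E h) (c_scale A E D (-1) (fst (X n) E h))) < e"
      using N by (meson le_less_trans)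
  qed simp_all
  then obtain L where L [simp]: "\<And>E h. E \<in> c_obj A \<Longrightarrow> h \<in> c_hom A E C \<Longrightarrow> L E h \<in> c_hom A E D"
    and limL: "\<And>E h. E \<in> c_obj A \<Longrightarrow> h \<in> c_hom A E C \<Longrightarrow>
      (\<lambda>n. c_norm A E D (c_add A E D (fst (X n) E h) (c_scale A E D (-1) (L E h)))) \<longlonglongrightarrow> 0"
    by metis
  have "\<exists>x\<in>c_hom A C E. (\<lambda>n. c_norm A C E (c_add A C E (snd (X n) E g) (c_scale A C E (-1) x))) \<longlonglongrightarrow> 0"
    if [simp]: "E \<in> c_obj A" "g \<in> c_hom A D E" for E g
  proof (rule hom_complete)
    fix e :: real assume "e > 0"
    then obtain N where N: "\<forall>m\<ge>N. \<forall>n\<ge>N. c_norm (mult_cat A) C D (?d (X m) (X n)) * c_norm A D E g < e"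
      using Cauchy'[of e "c_norm A D E g"] by auto
    have "c_norm A C E (c_add A C E (snd (X m) E g) (c_scale A C E (-1) (snd (X n) E g)))
        \<le> c_norm (mult_cat A) C D (?d (X m) (X n)) * c_norm A D E g" for m n
      using mult_norm_boundR[OF d_in[OF X X], of E g m n] by simp
    then show "\<exists>N. \<forall>m\<ge>N. \<forall>n\<ge>N.
        c_norm A C E (c_add A C E (snd (X m) E g) (c_scale A C E (-1) (snd (X n) E g))) < e"
      using N by (meson le_less_trans)
  qed simp_all
  then obtain R where R [simp]: "\<And>E g. E \<in> c_obj A \<Longrightarrow> g \<in> c_hom A D E \<Longrightarrow> R E g \<in> c_hom A C E"
    and limR: "\<And>E g. E \<in> c_obj A \<Longrightarrow> g \<in> c_hom A D E \<Longrightarrow>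
      (\<lambda>n. c_norm A C E (c_add A C E (snd (X n) E g) (c_scale A C E (-1) (R E g)))) \<longlonglongrightarrow> 0"
    by metis
  define T :: "('o,'m) mult" where
    "T = (\<lambda>E h. if E \<in> c_obj A \<and> h \<in> c_hom A E C then L E h else undefined,
      \<lambda>E g. if E \<in> c_obj A \<and> g \<in> c_hom A D E then R E g else undefined)"
  have T_eval [simp]: "E \<in> c_obj A \<Longrightarrow> h \<in> c_hom A E C \<Longrightarrow> fst T E h = L E h"
    "E \<in> c_obj A \<Longrightarrow> g \<in> c_hom A D E \<Longrightarrow> snd T E g = R E g" for E h g
    by (simp_all add: T_def)
  \<comment> \<open>In the Cauchy estimate \<open>m\<close> tends to infinity while
    \<open>n\<close>, \<open>E\<close> and \<open>h\<close> are fixed; the resulting bound sees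
    \<open>h\<close> only through its norm.\<close>
  have unif: "c_norm A E D (c_add A E D (fst (X n) E h) (c_scale A E D (-1) (L E h))) \<le> e * c_norm A E C h"
    if N: "\<forall>m\<ge>N. \<forall>n\<ge>N. c_norm (mult_cat A) C D (?d (X m) (X n)) < e" and "n \<ge> N"
      and [simp]: "E \<in> c_obj A" "h \<in> c_hom A E C" for N e n E h
  proof (rule hom_limit_norm_diff_le[where X = "\<lambda>m. fst (X m) E h" and N = N])
    fix m assume "m \<ge> N"
    have "c_norm A E D (c_add A E D (fst (X n) E h) (c_scale A E D (-1) (fst (X m) E h)))
        \<le> c_norm (mult_cat A) C D (?d (X n) (X m)) * c_norm A E C h"
      using mult_norm_bound[OF d_in[OF X X], of E h n m] by simp
    also have "\<dots> \<le> e * c_norm A E C h"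
      using N \<open>m \<ge> N\<close> \<open>n \<ge> N\<close> by (intro mult_right_mono) (auto intro: less_imp_le)
    finally show "c_norm A E D (c_add A E D (fst (X n) E h) (c_scale A E D (-1) (fst (X m) E h)))
        \<le> e * c_norm A E C h" .
  qed (simp_all add: limL)
  \<comment> \<open>By the compatibility of each \<open>X n\<close> a single sequence converges to
    both sides.\<close>
  have compat: "c_comp A F D E g (L F f) = c_comp A F C E (R E g) f"
    if [simp]: "E \<in> c_obj A" "F \<in> c_obj A" "f \<in> c_hom A F C" "g \<in> c_hom A D E" for E F f g
  proof (rule hom_limit_unique[where X = "\<lambda>n. c_comp A F D E g (fst (X n) F f)"])
    show "(\<lambda>n. c_norm A F E (c_add A F E (c_comp A F D E g (fst (X n) F f))
        (c_scale A F E (-1) (c_comp A F D E g (L F f))))) \<longlonglongrightarrow> 0"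
    proof (rule tendsto_zero_dominated[OF limL[of F f]])
      fix n
      show "c_norm A F E (c_add A F E (c_comp A F D E g (fst (X n) F f))
          (c_scale A F E (-1) (c_comp A F D E g (L F f))))
        \<le> c_norm A D E g * c_norm A F D (c_add A F D (fst (X n) F f) (c_scale A F D (-1) (L F f)))"
        using norm_comp[of F D E "c_add A F D (fst (X n) F f) (c_scale A F D (-1) (L F f))" g]
        by (simp add: comp_add_right comp_scale_right)
    qed simp_all
    show "(\<lambda>n. c_norm A F E (c_add A F E (c_comp A F D E g (fst (X n) F f))
        (c_scale A F E (-1) (c_comp A F C E (R E g) f)))) \<longlonglongrightarrow> 0"
    proof (rule tendsto_zero_dominated[OF limR[of E g]])
      fix n
      show "c_norm A F E (c_add A F E (c_comp A F D E g (fst (X n) F f))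
          (c_scale A F E (-1) (c_comp A F C E (R E g) f)))
        \<le> c_norm A F C f * c_norm A C E (c_add A C E (snd (X n) E g) (c_scale A C E (-1) (R E g)))"
        using norm_comp[of F C E f "c_add A C E (snd (X n) E g) (c_scale A C E (-1) (R E g))"]
        by (simp add: comp_add_left comp_scale_left mult_compat[OF X] mult.commute)
    qed simp_all
  qed simp_all
  obtain N1 where N1: "\<forall>m\<ge>N1. \<forall>n\<ge>N1. c_norm (mult_cat A) C D (?d (X m) (X n)) < 1"
    using Cauchy[of 1] by auto
  have T: "T \<in> mult_hom A C D"
  proof (rule mult_homI[where K = "1 + c_norm (mult_cat A) C D (X N1)"])
    fix E h assume [simp]: "E \<in> c_obj A" "h \<in> c_hom A E C"
    have "c_norm A E D (L E h)
        \<le> c_norm A E D (c_add A E D (fst (X N1) E h) (c_scale A E D (-1) (L E h))) + c_norm A E D (fst (X N1) E h)"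
      using hom_norm_le_diff[of E D "L E h" "fst (X N1) E h"] hom_diff_commute[of E D "L E h" "fst (X N1) E h"]
      by simp
    also have "\<dots> \<le> 1 * c_norm A E C h + c_norm (mult_cat A) C D (X N1) * c_norm A E C h"
      by (intro add_mono unif[OF N1] mult_norm_bound[OF X]) simp_all
    finally show "c_norm A E D (fst T E h) \<le> (1 + c_norm (mult_cat A) C D (X N1)) * c_norm A E C h"
      by (simp add: distrib_right)
  qed (simp_all add: mult_norm_nonneg[OF X] compat, auto simp: T_def)
  have "(\<lambda>n. c_norm (mult_cat A) C D (?d (X n) T)) \<longlonglongrightarrow> 0"
  proof (rule LIMSEQ_I)
    fix r :: real assume r: "0 < r"
    then obtain N where N: "\<forall>m\<ge>N. \<forall>n\<ge>N. c_norm (mult_cat A) C D (?d (X m) (X n)) < r / 2"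
      using Cauchy[of "r / 2"] by auto
    have "c_norm (mult_cat A) C D (?d (X n) T) \<le> r / 2" if "n \<ge> N" for n
      by (rule mult_norm_least[OF d_in[OF X T]]) (use r unif[OF N that] in simp_all)
    then show "\<exists>no. \<forall>n\<ge>no. norm (c_norm (mult_cat A) C D (?d (X n) T) - 0) < r"
      using r mult_norm_nonneg[OF d_in[OF X T]] by (intro exI[of _ N]) force
  qed
  then show ?thesis using T by blast
qed

lemma mult_banach:
  assumes [simp]: "C \<in> c_obj A" "D \<in> c_obj A"
  shows "banach_on (mult_hom A C D) (c_zero (mult_cat A) C D) (c_add (mult_cat A) C D)
    (c_scale (mult_cat A) C D) (c_norm (mult_cat A) C D)"
  unfolding banach_on_def
proof (intro conjI ballI allI impI)
  note [simp] = mult_zero_in mult_add_in mult_scale_in multL_in[of _ A C D]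
  note ac = hom_add_assoc hom_scale_scale hom_scale_one hom_add_zero_left
    hom_scale_add_left hom_scale_add_right
  fix S T U :: "('o,'m) mult" and a b :: complex
  assume [simp]: "S \<in> mult_hom A C D"
  show "c_add (mult_cat A) C D (c_zero (mult_cat A) C D) S = S"
    "c_scale (mult_cat A) C D 1 S = S"
    "c_scale (mult_cat A) C D a (c_scale (mult_cat A) C D b S) = c_scale (mult_cat A) C D (a * b) S"
    "c_scale (mult_cat A) C D (a + b) S
      = c_add (mult_cat A) C D (c_scale (mult_cat A) C D a S) (c_scale (mult_cat A) C D b S)"
    by (rule mult_eqI[of _ C D]; simp add: ac)+
  show "\<exists>y\<in>mult_hom A C D. c_add (mult_cat A) C D S y = c_zero (mult_cat A) C D"
    by (rule bexI[of _ "c_scale (mult_cat A) C D (-1) S"]; (rule mult_eqI[of _ C D])?) (simp_all add: hom_add_neg)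
  show "(c_norm (mult_cat A) C D S = 0) = (S = c_zero (mult_cat A) C D)"
    "c_norm (mult_cat A) C D (c_scale (mult_cat A) C D a S) = cmod a * c_norm (mult_cat A) C D S"
    by (simp_all add: mult_norm_eq_0 mult_norm_scale)
  assume [simp]: "T \<in> mult_hom A C D"
  show "c_add (mult_cat A) C D S T = c_add (mult_cat A) C D T S"
    by (rule mult_eqI[of _ C D]) (simp_all add: hom_add_commute)
  show "c_scale (mult_cat A) C D a (c_add (mult_cat A) C D S T)
      = c_add (mult_cat A) C D (c_scale (mult_cat A) C D a S) (c_scale (mult_cat A) C D a T)"
    by (rule mult_eqI[of _ C D]) (simp_all add: ac)
  show "c_norm (mult_cat A) C D (c_add (mult_cat A) C D S T)
      \<le> c_norm (mult_cat A) C D S + c_norm (mult_cat A) C D T"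
    by (simp add: mult_norm_add)
  assume [simp]: "U \<in> mult_hom A C D"
  show "c_add (mult_cat A) C D (c_add (mult_cat A) C D S T) U
      = c_add (mult_cat A) C D S (c_add (mult_cat A) C D T U)"
    by (rule mult_eqI[of _ C D]) (simp_all add: ac)
next
  fix X :: "nat \<Rightarrow> ('o,'m) mult"
  assume "(\<forall>n. X n \<in> mult_hom A C D) \<and> (\<forall>e>0. \<exists>N. \<forall>m\<ge>N. \<forall>n\<ge>N.
    c_norm (mult_cat A) C D (c_add (mult_cat A) C D (X m) (c_scale (mult_cat A) C D (-1) (X n))) < e)"
  then show "\<exists>x\<in>mult_hom A C D.
      (\<lambda>n. c_norm (mult_cat A) C D (c_add (mult_cat A) C D (X n) (c_scale (mult_cat A) C D (-1) x))) \<longlonglongrightarrow> 0"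
    by (intro mult_complete) auto
qed (simp_all add: mult_zero_in mult_add_in mult_scale_in)

lemma pre_cstar_category_mult_cat: "pre_cstar_category (mult_cat A)"
proof (unfold_locales; (unfold mult_cat_sel)?)
  fix C D E F :: 'o and f f' g g' h :: "('o,'m) mult" and a :: complex
  note [simp] = mult_comp_in mult_star_in mult_add_in mult_scale_in
  assume [simp]: "C \<in> c_obj A" "D \<in> c_obj A"
  show "banach_on (mult_hom A C D) (c_zero (mult_cat A) C D) (c_add (mult_cat A) C D)
      (c_scale (mult_cat A) C D) (c_norm (mult_cat A) C D)"
    by (simp add: mult_banach)
  assume f [simp]: "f \<in> mult_hom A C D"
  note [simp] = multL_in[OF f] multR_in[OF f]
  show "c_star (mult_cat A) C D f \<in> mult_hom A D C"
    "c_norm (mult_cat A) C C (c_comp (mult_cat A) C D C (c_star (mult_cat A) C D f) f)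
      = (c_norm (mult_cat A) C D f)\<^sup>2"
    by (simp_all add: mult_norm_star_comp)
  show "c_star (mult_cat A) C D (c_scale (mult_cat A) C D a f)
      = c_scale (mult_cat A) D C (cnj a) (c_star (mult_cat A) C D f)"
    by (rule mult_eqI[of _ D C]) (simp_all add: star_scale)
  show "c_star (mult_cat A) D C (c_star (mult_cat A) C D f) = f"
    by (rule mult_eqI[of _ C D]) (simp_all add: star_star)
  {
    assume g [simp]: "g \<in> mult_hom A C D"
    note [simp] = multL_in[OF g] multR_in[OF g]
    show "c_star (mult_cat A) C D (c_add (mult_cat A) C D f g)
        = c_add (mult_cat A) D C (c_star (mult_cat A) C D f) (c_star (mult_cat A) C D g)"
      by (rule mult_eqI[of _ D C]) (simp_all add: star_add)
  }
  assume [simp]: "E \<in> c_obj A"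
  {
    assume f' [simp]: "f' \<in> mult_hom A C D" and g [simp]: "g \<in> mult_hom A D E"
    note [simp] = multL_in[OF g] multR_in[OF g] multL_in[OF f'] multR_in[OF f']
    show "c_comp (mult_cat A) C D E g (c_add (mult_cat A) C D f f')
        = c_add (mult_cat A) C E (c_comp (mult_cat A) C D E g f) (c_comp (mult_cat A) C D E g f')"
      by (rule mult_eqI[of _ C E]) (simp_all add: multL_add[OF g])
  }
  assume g [simp]: "g \<in> mult_hom A D E"
  note [simp] = multL_in[OF g] multR_in[OF g]
  show "c_comp (mult_cat A) C D E g f \<in> mult_hom A C E"
    "c_norm (mult_cat A) C E (c_comp (mult_cat A) C D E g f)
      \<le> c_norm (mult_cat A) D E g * c_norm (mult_cat A) C D f"
    by simp_all
  show "c_comp (mult_cat A) C D E g (c_scale (mult_cat A) C D a f)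
      = c_scale (mult_cat A) C E a (c_comp (mult_cat A) C D E g f)"
    by (rule mult_eqI[of _ C E]) (simp_all add: multL_scale[OF g])
  show "c_comp (mult_cat A) C D E (c_scale (mult_cat A) D E a g) f
      = c_scale (mult_cat A) C E a (c_comp (mult_cat A) C D E g f)"
    by (rule mult_eqI[of _ C E]) simp_all
  show "c_star (mult_cat A) C E (c_comp (mult_cat A) C D E g f)
      = c_comp (mult_cat A) E D C (c_star (mult_cat A) C D f) (c_star (mult_cat A) D E g)"
    by (rule mult_eqI[of _ E C]) (simp_all add: star_star)
  {
    assume g' [simp]: "g' \<in> mult_hom A D E"
    note [simp] = multL_in[OF g'] multR_in[OF g']
    show "c_comp (mult_cat A) C D E (c_add (mult_cat A) D E g g') f
        = c_add (mult_cat A) C E (c_comp (mult_cat A) C D E g f) (c_comp (mult_cat A) C D E g' f)"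
      by (rule mult_eqI[of _ C E]) simp_all
  }
  assume [simp]: "F \<in> c_obj A" and h [simp]: "h \<in> mult_hom A E F"
  note [simp] = multL_in[OF h] multR_in[OF h]
  show "c_comp (mult_cat A) C E F h (c_comp (mult_cat A) C D E g f)
      = c_comp (mult_cat A) C D F (c_comp (mult_cat A) D E F h g) f"
    by (rule mult_eqI[of _ C F]) simp_all
qed

end

section \<open>Positivity in endomorphism algebras\<close>

text \<open>The spectral arguments need ring arithmetic, but each algebra of endomorphisms lives on a
  carrier set. The product of all unital endomorphism algebras, over all categories with the given
  types of objects and morphisms, is a ring on a type; the norm of a single factor is a seminorm on it.\<close>

definition unital_at :: "('o,'m) cstarcat \<Rightarrow> 'o \<Rightarrow> bool" where
  "unital_at A C \<longleftrightarrow> pre_cstar_category A \<and> C \<in> c_obj A \<and> (\<exists>u. is_unit A C u)"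

definition unit_of :: "('o,'m) cstarcat \<Rightarrow> 'o \<Rightarrow> 'm" where
  "unit_of A C = (SOME u. is_unit A C u)"

lemma is_unit_unit_of: "unital_at A C \<Longrightarrow> is_unit A C (unit_of A C)"
  unfolding unital_at_def unit_of_def by (metis someI_ex)

text \<open>A type cannot depend on a category and an object, so one type serves them all. The value
  \<open>undefined\<close> off the index pairs makes equality of families equality in each
  factor.\<close>

typedef ('o,'m) endo_family =
  "{u :: ('o,'m) cstarcat \<Rightarrow> 'o \<Rightarrow> 'm. \<forall>A C. if unital_at A C then u A C \<in> c_hom A C C else u A C = undefined}"
  morphisms endo_at endo_family
proof
  show "(\<lambda>A C. if unital_at A C then unit_of A C else undefined) \<in>
      {u. \<forall>A C. if unital_at A C then u A C \<in> c_hom A C C else u A C = undefined}"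
    by (auto dest: is_unit_unit_of simp: is_unit_def)
qed

definition mk_endo :: "(('o,'m) cstarcat \<Rightarrow> 'o \<Rightarrow> 'm) \<Rightarrow> ('o,'m) endo_family" where
  "mk_endo f = endo_family (\<lambda>A C. if unital_at A C then f A C else undefined)"

lemma endo_at_mk_endo:
  assumes "\<And>A C. unital_at A C \<Longrightarrow> f A C \<in> c_hom A C C" "unital_at A C"
  shows "endo_at (mk_endo f) A C = f A C"
  unfolding mk_endo_def using assms by (subst endo_family_inverse) auto

lemma endo_at_in: "unital_at A C \<Longrightarrow> endo_at u A C \<in> c_hom A C C"
  using endo_at[of u] by (auto split: if_splits)

lemma endo_eqI:
  assumes "\<And>A C. unital_at A C \<Longrightarrow> endo_at u A C = endo_at v A C"
  shows "u = v"
proof -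
  have "endo_at u A C = endo_at v A C" for A C
    using assms[of A C] endo_at[of u] endo_at[of v] by (cases "unital_at A C") auto
  then show ?thesis by (metis endo_at_inject ext)
qed

lemma unital_atD:
  assumes "unital_at A C"
  shows "pre_cstar_category A" "C \<in> c_obj A" "unit_of A C \<in> c_hom A C C"
    and "D \<in> c_obj A \<Longrightarrow> f \<in> c_hom A C D \<Longrightarrow> c_comp A C C D f (unit_of A C) = f"
    and "D \<in> c_obj A \<Longrightarrow> g \<in> c_hom A D C \<Longrightarrow> c_comp A D C C (unit_of A C) g = g"
  using assms is_unit_unit_of[OF assms] by (auto simp: unital_at_def is_unit_def)

instantiation endo_family :: (type, type) "{ring, monoid_mult}"
begin

definition "0 = mk_endo (\<lambda>A C. c_zero A C C)"
definition "1 = mk_endo unit_of"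
definition "u + v = mk_endo (\<lambda>A C. c_add A C C (endo_at u A C) (endo_at v A C))"
definition "- u = mk_endo (\<lambda>A C. c_scale A C C (-1) (endo_at u A C))"
definition "u - v = mk_endo (\<lambda>A C. c_add A C C (endo_at u A C) (c_scale A C C (-1) (endo_at v A C)))"
definition "u * v = mk_endo (\<lambda>A C. c_comp A C C C (endo_at u A C) (endo_at v A C))"

lemma endo_at_simps:
  assumes "unital_at A C"
  shows "endo_at 0 A C = c_zero A C C"
    and "endo_at 1 A C = unit_of A C"
    and "endo_at (u + v) A C = c_add A C C (endo_at u A C) (endo_at v A C)"
    and "endo_at (- u) A C = c_scale A C C (-1) (endo_at u A C)"
    and "endo_at (u - v) A C = c_add A C C (endo_at u A C) (c_scale A C C (-1) (endo_at v A C))"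
    and "endo_at (u * v) A C = c_comp A C C C (endo_at u A C) (endo_at v A C)"
  unfolding zero_endo_family_def one_endo_family_def plus_endo_family_def uminus_endo_family_def
    minus_endo_family_def times_endo_family_def
  by (subst endo_at_mk_endo;
      simp add: assms unital_atD endo_at_in pre_cstar_category.hom_simps)+

instance
proof
  fix u v w :: "('a,'b) endo_family"
  note ev = endo_at_simps unital_atD endo_at_in pre_cstar_category.hom_simps
  show "u + v + w = u + (v + w)" "0 + u = u" "u - v = u + - v"
    "u * v * w = u * (v * w)" "(u + v) * w = u * w + v * w" "u * (v + w) = u * v + u * w"
    "1 * u = u" "u * 1 = u"
    by (rule endo_eqI, simp add: ev pre_cstar_category.hom_add_assoc pre_cstar_category.hom_add_zero_left
        pre_cstar_category.comp_assoc pre_cstar_category.comp_add_left pre_cstar_category.comp_add_right)+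
  show add_commute: "u + v = v + u" for u v :: "('a,'b) endo_family"
    by (rule endo_eqI) (simp add: ev, simp add: ev pre_cstar_category.hom_add_commute)
  have "u + - u = 0"
    by (rule endo_eqI) (simp add: ev pre_cstar_category.hom_add_neg)
  then show "- u + u = 0" by (simp add: add_commute)
qed

end

section \<open>Single factors of the product as seminormed C*-algebras\<close>

definition endo_scalar :: "complex \<Rightarrow> ('o,'m) endo_family" where
  "endo_scalar a = mk_endo (\<lambda>A C. c_scale A C C a (unit_of A C))"

definition endo_star :: "('o,'m) endo_family \<Rightarrow> ('o,'m) endo_family" where
  "endo_star u = mk_endo (\<lambda>A C. c_star A C C (endo_at u A C))"

text \<open>The seminorm at the chosen factor ignores all other coordinates, but self-adjointness is
  an equation in the whole product; zero coordinates satisfy it.\<close>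

definition endo_single :: "('o,'m) cstarcat \<Rightarrow> 'o \<Rightarrow> 'm \<Rightarrow> ('o,'m) endo_family" where
  "endo_single A C x = mk_endo (\<lambda>A' C'. if A' = A \<and> C' = C then x else c_zero A' C' C')"

lemma endo_at_scalar: "unital_at A C \<Longrightarrow> endo_at (endo_scalar a) A C = c_scale A C C a (unit_of A C)"
  unfolding endo_scalar_def
  by (rule endo_at_mk_endo) (simp_all add: unital_atD pre_cstar_category.hom_simps)

lemma endo_at_star: "unital_at A C \<Longrightarrow> endo_at (endo_star u) A C = c_star A C C (endo_at u A C)"
  unfolding endo_star_def
  by (rule endo_at_mk_endo) (simp_all add: unital_atD endo_at_in pre_cstar_category.hom_simps)

lemma endo_at_single:
  assumes "unital_at A C" "x \<in> c_hom A C C" "unital_at A' C'"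
  shows "endo_at (endo_single A C x) A' C' = (if A' = A \<and> C' = C then x else c_zero A' C' C')"
  unfolding endo_single_def
  by (rule endo_at_mk_endo) (use assms in \<open>auto simp: unital_atD pre_cstar_category.hom_simps\<close>)

text \<open>The unit property makes the adjoint of \<open>u\<close> equal to
  \<open>u\<^sup>* u\<close>, which is self-adjoint.\<close>

lemma star_unit_of:
  assumes A: "unital_at A C"
  shows "c_star A C C (unit_of A C) = unit_of A C"
proof -
  interpret pre_cstar_category A using A by (rule unital_atD)
  note [simp] = unital_atD[OF A]
  let ?u = "unit_of A C"
  have "?u = c_star A C C (c_star A C C ?u)" by (simp add: star_star)
  also have "\<dots> = c_star A C C (c_comp A C C C (c_star A C C ?u) ?u)" by simp
  also have "\<dots> = c_comp A C C C (c_star A C C ?u) ?u" by (subst star_comp) (simp_all add: star_star)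
  also have "\<dots> = c_star A C C ?u" by simp
  finally show ?thesis by simp
qed

lemma comp_scaled_unit:
  assumes A: "unital_at A C" and x: "x \<in> c_hom A C C"
  shows "c_comp A C C C (c_scale A C C a (unit_of A C)) x = c_scale A C C a x"
    and "c_comp A C C C x (c_scale A C C a (unit_of A C)) = c_scale A C C a x"
proof -
  interpret pre_cstar_category A using A by (rule unital_atD)
  show "c_comp A C C C (c_scale A C C a (unit_of A C)) x = c_scale A C C a x"
    "c_comp A C C C x (c_scale A C C a (unit_of A C)) = c_scale A C C a x"
    using x by (simp_all add: unital_atD[OF A] comp_scale_left comp_scale_right)
qed

lemma seminormed_cstar_algebra_endo:
  fixes A :: "('o,'m) cstarcat"
  assumes A: "unital_at A C"
  shows "seminormed_cstar_algebra endo_scalar endo_star (\<lambda>u. c_norm A C C (endo_at u A C))"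
proof
  fix a b :: complex and x y :: "('o,'m) endo_family"
  note ev = endo_at_simps endo_at_scalar endo_at_star endo_at_in unital_atD comp_scaled_unit
    pre_cstar_category.hom_simps
  show "endo_scalar (a + b) = (endo_scalar a + endo_scalar b :: ('o,'m) endo_family)"
    by (rule endo_eqI) (simp add: ev pre_cstar_category.hom_scale_add_left)
  show "endo_scalar (a * b) = (endo_scalar a * endo_scalar b :: ('o,'m) endo_family)"
    by (rule endo_eqI) (simp add: ev pre_cstar_category.hom_scale_scale mult.commute)
  show "endo_scalar 1 = (1 :: ('o,'m) endo_family)"
    by (rule endo_eqI) (simp add: ev pre_cstar_category.hom_scale_one)
  show "x * endo_scalar a = endo_scalar a * x"
    by (rule endo_eqI) (simp add: ev)
  show "endo_star (x - y) = endo_star x - endo_star y"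
    by (rule endo_eqI) (simp add: ev pre_cstar_category.star_add pre_cstar_category.star_scale)
  show "endo_star (x * y) = endo_star y * endo_star x"
    by (rule endo_eqI) (simp add: ev pre_cstar_category.star_comp)
  show "endo_star (endo_star x) = x"
    by (rule endo_eqI) (simp add: ev pre_cstar_category.star_star)
  show "endo_star (endo_scalar a) = (endo_scalar (cnj a) :: ('o,'m) endo_family)"
    by (rule endo_eqI) (simp add: ev pre_cstar_category.star_scale star_unit_of)
  \<comment> \<open>The laws above are equations in every factor; the norm laws below concern only
    the factor at \<open>A\<close> and \<open>C\<close>.\<close>
  interpret pre_cstar_category A using A by (rule unital_atD)
  note [simp] = endo_at_simps[OF A] endo_at_in[OF A] unital_atD(2)[OF A]
  show "c_norm A C C (endo_at (x + y) A C) \<le> c_norm A C C (endo_at x A C) + c_norm A C C (endo_at y A C)"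
    by (simp add: hom_norm_triangle)
  show "c_norm A C C (endo_at (x * y) A C) \<le> c_norm A C C (endo_at x A C) * c_norm A C C (endo_at y A C)"
    by (simp add: norm_comp)
  show "c_norm A C C (endo_at (endo_scalar a * x) A C) = cmod a * c_norm A C C (endo_at x A C)"
    by (simp add: endo_at_scalar[OF A] comp_scaled_unit[OF A] hom_norm_scale)
  show "c_norm A C C (endo_at (endo_star x * x) A C) = (c_norm A C C (endo_at x A C))\<^sup>2"
    by (simp add: endo_at_star[OF A] norm_star_comp)
  fix X :: "nat \<Rightarrow> ('o,'m) endo_family"
  assume "\<And>e. e > 0 \<Longrightarrow> \<exists>M. \<forall>m\<ge>M. \<forall>n\<ge>M. c_norm A C C (endo_at (X m - X n) A C) < e"
  then obtain x where "x \<in> c_hom A C C"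
      "(\<lambda>n. c_norm A C C (c_add A C C (endo_at (X n) A C) (c_scale A C C (-1) x))) \<longlonglongrightarrow> 0"
    using hom_complete[of C C "\<lambda>n. endo_at (X n) A C"] by auto
  \<comment> \<open>The limit found in \<open>c_hom A C C\<close> becomes a family through
    \<open>endo_single\<close>; its other coordinates do not affect this seminorm.\<close>
  then show "\<exists>x. (\<lambda>n. c_norm A C C (endo_at (X n - x) A C)) \<longlonglongrightarrow> 0"
    by (intro exI[of _ "endo_single A C x"]) (simp add: endo_at_single[OF A _ A])
qed

text \<open>Seminorm zero is equality in \<open>c_hom A C C\<close>. Keeping \<open>u\<close> and
  \<open>v\<close> apart from \<open>a\<close> and \<open>b\<close> lets one statement cover the
  products \<open>a b\<close> and \<open>b a\<close>.\<close>

lemma quasi_inverse_at: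
  assumes A: "unital_at A C"
  shows "c_norm A C C (endo_at (u * v + endo_scalar l * b + endo_scalar r * a) A C) = 0 \<longleftrightarrow>
    c_add A C C (c_add A C C (c_comp A C C C (endo_at u A C) (endo_at v A C))
      (c_scale A C C l (endo_at b A C))) (c_scale A C C r (endo_at a A C)) = c_zero A C C"
proof -
  interpret pre_cstar_category A using A by (rule unital_atD)
  show ?thesis
    by (simp add: endo_at_simps[OF A] endo_at_in[OF A] endo_at_scalar[OF A] unital_atD(2)[OF A]
        comp_scaled_unit[OF A] hom_norm_eq_0)
qed

lemma endo_star_single:
  fixes A :: "('o,'m) cstarcat"
  assumes A: "unital_at A C" and a: "a \<in> c_hom A C C" "c_star A C C a = a"
  shows "endo_star (endo_single A C a) = endo_single A C a"
proof (rule endo_eqI)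
  fix A' :: "('o,'m) cstarcat" and C'
  assume A': "unital_at A' C'"
  interpret pre_cstar_category A' using A' by (rule unital_atD)
  have "c_star A' C' C' (c_zero A' C' C') = c_zero A' C' C'"
    using star_scale[of C' C' "c_zero A' C' C'" 0] unital_atD(2)[OF A']
    by (simp add: hom_scale_zero_left)
  then show "endo_at (endo_star (endo_single A C a)) A' C' = endo_at (endo_single A C a) A' C'"
    using a by (simp add: endo_at_star[OF A'] endo_at_single[OF A a(1) A'])
qed

section \<open>Between \<open>positive_el\<close> and the spectral lemmas\<close>

lemma positive_el_norm_mono:
  assumes A: "unital_at A C" and p: "positive_el A C p" and q: "positive_el A C q"
  shows "c_norm A C C q \<le> c_norm A C C (c_add A C C p q)"
proof -
  interpret alg: seminormed_cstar_algebra endo_scalar endo_star "\<lambda>u. c_norm A C C (endo_at u A C)"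
    using A by (rule seminormed_cstar_algebra_endo)
  have psd: "alg.psd (endo_single A C a)" if a: "positive_el A C a" for a
    unfolding alg.psd_def
  proof (intro conjI allI impI)
    have a': "a \<in> c_hom A C C" "c_star A C C a = a" using a by (auto simp: positive_el_def)
    show "endo_star (endo_single A C a) = endo_single A C a" using A a' by (rule endo_star_single)
    fix s :: real assume s: "s > 0"
    let ?l = "- of_real s :: complex"
    obtain b where b: "b \<in> c_hom A C C"
      "c_add A C C (c_add A C C (c_comp A C C C a b) (c_scale A C C (- ?l) b))
        (c_scale A C C (- (1 / ?l)) a) = c_zero A C C"
      "c_add A C C (c_add A C C (c_comp A C C C b a) (c_scale A C C (- ?l) b))
        (c_scale A C C (- (1 / ?l)) a) = c_zero A C C"
      using a s unfolding positive_el_def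
      by (metis Re_complex_of_real neg_0_le_iff_le not_le of_real_minus)
    have "alg.invertible (endo_single A C a - endo_scalar ?l)"
      by (subst alg.invertible_iff_quasi_inverse)
        (use s b in \<open>auto simp: quasi_inverse_at[OF A] endo_at_single[OF A _ A] a' intro!: exI[of _ "endo_single A C b"]\<close>)
    then show "alg.invertible (endo_single A C a + endo_scalar (of_real s))" by (simp add: alg.k_minus)
  qed
  have "p \<in> c_hom A C C" "q \<in> c_hom A C C" using p q by (auto simp: positive_el_def)
  then show ?thesis
    using alg.psd_norm_mono[OF psd[OF p] psd[OF q]]
    by (simp add: endo_at_simps[OF A] endo_at_single[OF A _ A])
qed

text \<open>Together with self-adjointness the lower bounds at negative reals yield all resolvents
  off the half line. The inverse obtained is a family; its coordinate at \<open>A\<close> and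
  \<open>C\<close> gives the required element.\<close>

lemma positive_elI:
  assumes A: "unital_at A C" and a: "a \<in> c_hom A C C" "c_star A C C a = a"
    and lb: "\<And>s m. s > 0 \<Longrightarrow> m \<in> c_hom A C C \<Longrightarrow>
      s * c_norm A C C m \<le> c_norm A C C (c_add A C C (c_comp A C C C a m) (c_scale A C C (of_real s) m))"
  shows "positive_el A C a"
  unfolding positive_el_def
proof (intro conjI allI impI a)
  interpret alg: seminormed_cstar_algebra endo_scalar endo_star "\<lambda>u. c_norm A C C (endo_at u A C)"
    using A by (rule seminormed_cstar_algebra_endo)
  interpret pre_cstar_category A using A by (rule unital_atD)
  let ?a = "endo_single A C a"
  fix l :: complex assume l: "\<not> (l \<in> \<real> \<and> 0 \<le> Re l)"
  then have l0: "l \<noteq> 0" by auto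
  have "alg.invertible (?a - endo_scalar l)"
  proof (rule alg.resolvent_off_half_line[OF endo_star_single[OF A a] _ l])
    fix s :: real assume s: "s > 0"
    show "alg.lower_bound (?a + endo_scalar (of_real s)) s"
      unfolding alg.lower_bound_def using lb[OF s endo_at_in[OF A]] a
      by (simp add: endo_at_simps[OF A] endo_at_single[OF A _ A] endo_at_scalar[OF A] endo_at_in[OF A]
          unital_atD[OF A] comp_add_left comp_scale_left)
  qed
  then obtain b where b:
    "c_norm A C C (endo_at (?a * b + endo_scalar (- l) * b + endo_scalar (- (1 / l)) * ?a) A C) = 0"
    "c_norm A C C (endo_at (b * ?a + endo_scalar (- l) * b + endo_scalar (- (1 / l)) * ?a) A C) = 0"
    unfolding alg.invertible_iff_quasi_inverse[OF l0] by blast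
  show "\<exists>b\<in>c_hom A C C.
      c_add A C C (c_add A C C (c_comp A C C C a b) (c_scale A C C (- l) b))
        (c_scale A C C (- (1 / l)) a) = c_zero A C C \<and>
      c_add A C C (c_add A C C (c_comp A C C C b a) (c_scale A C C (- l) b))
        (c_scale A C C (- (1 / l)) a) = c_zero A C C"
    using b[unfolded quasi_inverse_at[OF A] endo_at_single[OF A a(1) A]] endo_at_in[OF A, of b] by auto
qed

section \<open>The ideal inclusion and its universal property\<close>

context pre_cstar_category
begin

section \<open>The embedding as the inclusion of an ideal\<close>

lemma mult_embed_in:
  assumes [simp]: "C \<in> c_obj A" "D \<in> c_obj A" "f \<in> c_hom A C D"
  shows "snd (mult_embed A) C D f \<in> mult_hom A C D"
  by (rule mult_homI[where K = "c_norm A C D f"])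
    (simp_all add: norm_comp comp_assoc, auto simp: mult_embed_def)

lemma mult_embed_norm:
  assumes [simp]: "C \<in> c_obj A" "D \<in> c_obj A" "f \<in> c_hom A C D"
  shows "c_norm (mult_cat A) C D (snd (mult_embed A) C D f) = c_norm A C D f"
proof (rule antisym)
  let ?e = "snd (mult_embed A) C D f"
  have e: "?e \<in> mult_hom A C D" by (simp add: mult_embed_in)
  show "c_norm (mult_cat A) C D ?e \<le> c_norm A C D f"
    by (rule mult_norm_least[OF e]) (simp_all add: norm_comp)
  show "c_norm A C D f \<le> c_norm (mult_cat A) C D ?e"
  proof (cases "c_norm A C D f = 0")
    case True
    then show ?thesis using mult_norm_nonneg[OF e] by simp
  next
    case False
    \<comment> \<open>Evaluation at \<open>f\<^sup>*\<close> produces \<open>f f\<^sup>*\<close>,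
      whose norm is the square of the norm of \<open>f\<close>.\<close>
    have "c_norm A C D f * c_norm A C D f \<le> c_norm (mult_cat A) C D ?e * c_norm A C D f"
      using mult_norm_bound[OF e, of D "c_star A C D f"]
      by (simp add: norm_comp_star norm_star power2_eq_square)
    moreover have "0 < c_norm A C D f" using False hom_norm_nonneg[of C D f] by (simp add: less_le)
    ultimately show ?thesis by (rule mult_right_le_imp_le)
  qed
qed

lemma mult_embed_star_functor: "star_functor A (mult_cat A) (mult_embed A)"
  unfolding star_functor_def mult_embed_eval mult_cat_sel
proof (intro conjI ballI allI)
  fix C D E f g a
  note [simp] = mult_embed_in mult_add_in mult_scale_in mult_comp_in mult_star_in
  assume [simp]: "C \<in> c_obj A"
  then show "C \<in> c_obj A" .
  assume [simp]: "D \<in> c_obj A"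
  assume [simp]: "f \<in> c_hom A C D"
  show "snd (mult_embed A) C D f \<in> mult_hom A C D" by simp
  show "snd (mult_embed A) C D (c_scale A C D a f) = c_scale (mult_cat A) C D a (snd (mult_embed A) C D f)"
    by (rule mult_eqI[of _ C D]) (simp_all add: comp_scale_left)
  show "snd (mult_embed A) D C (c_star A C D f) = c_star (mult_cat A) C D (snd (mult_embed A) C D f)"
    by (rule mult_eqI[of _ D C]) (simp_all add: star_comp star_star)
  show "snd (mult_embed A) C D (c_add A C D f g)
      = c_add (mult_cat A) C D (snd (mult_embed A) C D f) (snd (mult_embed A) C D g)"
    if [simp]: "g \<in> c_hom A C D"
    by (rule mult_eqI[of _ C D]) (simp_all add: comp_add_left)
  show "snd (mult_embed A) C E (c_comp A C D E g f)
      = c_comp (mult_cat A) C D E (snd (mult_embed A) D E g) (snd (mult_embed A) C D f)"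
    if [simp]: "E \<in> c_obj A" "g \<in> c_hom A D E"
    by (rule mult_eqI[of _ C E]) (simp_all add: comp_assoc)
qed

lemma mult_embed_simps:
  assumes "C \<in> c_obj A" "D \<in> c_obj A" "f \<in> c_hom A C D"
  shows "snd (mult_embed A) C D (c_scale A C D a f) = c_scale (mult_cat A) C D a (snd (mult_embed A) C D f)"
    and "snd (mult_embed A) D C (c_star A C D f) = c_star (mult_cat A) C D (snd (mult_embed A) C D f)"
    and "g \<in> c_hom A C D \<Longrightarrow> snd (mult_embed A) C D (c_add A C D f g)
      = c_add (mult_cat A) C D (snd (mult_embed A) C D f) (snd (mult_embed A) C D g)"
    and "E \<in> c_obj A \<Longrightarrow> g \<in> c_hom A D E \<Longrightarrow> snd (mult_embed A) C E (c_comp A C D E g f)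
      = c_comp (mult_cat A) C D E (snd (mult_embed A) D E g) (snd (mult_embed A) C D f)"
  using assms mult_embed_star_functor unfolding star_functor_def mult_embed_eval by simp_all

lemma mult_embed_zero:
  assumes [simp]: "C \<in> c_obj A" "D \<in> c_obj A"
  shows "snd (mult_embed A) C D (c_zero A C D) = c_zero (mult_cat A) C D"
  by (rule mult_eqI[of _ C D]) (simp_all add: mult_embed_in mult_zero_in comp_zero_left)

lemma mult_embed_inj:
  assumes [simp]: "C \<in> c_obj A" "D \<in> c_obj A" "f \<in> c_hom A C D" "g \<in> c_hom A C D"
    and eq: "snd (mult_embed A) C D f = snd (mult_embed A) C D g"
  shows "f = g"
proof (rule comp_faithful_right[of C D])
  fix E h assume "E \<in> c_obj A" "h \<in> c_hom A E C"
  then show "c_comp A E C D f h = c_comp A E C D g h"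
    using mult_embed_eval(2)[of E A h C D f] mult_embed_eval(2)[of E A h C D g] eq by simp
qed simp_all

text \<open>The module property gives this half of the ideal property; compatibility gives the other
  half in \<open>embed_comp_mult\<close>.\<close>

lemma mult_comp_embed:
  assumes [simp]: "C \<in> c_obj A" "f \<in> c_hom A C D" and T: "T \<in> mult_hom A D E"
  shows "c_comp (mult_cat A) C D E T (snd (mult_embed A) C D f) = snd (mult_embed A) C E (fst T C f)"
proof -
  have [simp]: "D \<in> c_obj A" "E \<in> c_obj A" using T by (simp_all add: mult_homD)
  note [simp] = multL_in[OF T]
  show ?thesis
    by (rule mult_eqI[of _ C E]) (simp_all add: mult_embed_in mult_comp_in[OF _ T] multL_comp[OF T])
qed

lemma embed_comp_mult:
  assumes [simp]: "D \<in> c_obj A" "f \<in> c_hom A C D" and T: "T \<in> mult_hom A E C"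
  shows "c_comp (mult_cat A) E C D (snd (mult_embed A) C D f) T = snd (mult_embed A) E D (snd T D f)"
proof -
  have [simp]: "C \<in> c_obj A" "E \<in> c_obj A" using T by (simp_all add: mult_homD)
  note [simp] = multL_in[OF T] multR_in[OF T]
  show ?thesis
    by (rule mult_eqI[of _ E D]) (simp_all add: mult_embed_in mult_comp_in[OF T] mult_compat[OF T])
qed

text \<open>Being isometric, the embedding pulls a convergent sequence of images back to a Cauchy
  sequence. Its limit exists in the complete hom set, and uniqueness of limits identifies the image
  of that limit with \<open>T\<close>.\<close>

lemma mult_embed_closed:
  assumes [simp]: "C \<in> c_obj A" "D \<in> c_obj A"
    and X: "\<And>n. X n \<in> snd (mult_embed A) C D ` c_hom A C D" and T: "T \<in> mult_hom A C D"
    and lim: "(\<lambda>n. c_norm (mult_cat A) C D (c_add (mult_cat A) C D (X n) (c_scale (mult_cat A) C D (-1) T))) \<longlonglongrightarrow> 0"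
  shows "T \<in> snd (mult_embed A) C D ` c_hom A C D"
proof -
  interpret M: pre_cstar_category "mult_cat A" by (rule pre_cstar_category_mult_cat)
  let ?e = "snd (mult_embed A) C D"
  obtain x where x [simp]: "\<And>n. x n \<in> c_hom A C D" and X_eq: "\<And>n. X n = ?e (x n)"
    using X unfolding image_iff by metis
  have norm_diff: "c_norm (mult_cat A) C D (c_add (mult_cat A) C D (?e f) (c_scale (mult_cat A) C D (-1) (?e g)))
      = c_norm A C D (c_add A C D f (c_scale A C D (-1) g))"
    if [simp]: "f \<in> c_hom A C D" "g \<in> c_hom A C D" for f g
    by (simp add: mult_embed_norm flip: mult_embed_simps)
  have "\<exists>y\<in>c_hom A C D. (\<lambda>n. c_norm A C D (c_add A C D (x n) (c_scale A C D (-1) y))) \<longlonglongrightarrow> 0"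
  proof (rule hom_complete)
    fix e :: real assume "e > 0"
    then show "\<exists>N. \<forall>m\<ge>N. \<forall>n\<ge>N. c_norm A C D (c_add A C D (x m) (c_scale A C D (-1) (x n))) < e"
      using M.hom_convergent_imp_Cauchy[of C D X T e] lim T by (simp add: X_eq mult_embed_in norm_diff)
  qed simp_all
  then obtain y where y [simp]: "y \<in> c_hom A C D"
    and "(\<lambda>n. c_norm A C D (c_add A C D (x n) (c_scale A C D (-1) y))) \<longlonglongrightarrow> 0" by blast
  then have "(\<lambda>n. c_norm (mult_cat A) C D (c_add (mult_cat A) C D (X n) (c_scale (mult_cat A) C D (-1) (?e y)))) \<longlonglongrightarrow> 0"
    by (simp add: X_eq norm_diff)
  then have "T = ?e y"
    using M.hom_limit_unique[of C D X T "?e y"] lim T by (simp add: X_eq mult_embed_in)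
  then show ?thesis by simp
qed

lemma mult_embed_ideal_inclusion: "ideal_inclusion A (mult_cat A) (mult_embed A)"
  unfolding ideal_inclusion_def mult_embed_eval mult_cat_sel
proof (intro conjI ballI allI impI)
  show "star_functor A (mult_cat A) (mult_embed A)" by (rule mult_embed_star_functor)
  show "bij_betw (\<lambda>C. C) (c_obj A) (c_obj A)"
    by (simp add: bij_betw_def inj_on_def image_def)
  fix C D assume [simp]: "C \<in> c_obj A" "D \<in> c_obj A"
  show "inj_on (snd (mult_embed A) C D) (c_hom A C D)"
    by (rule inj_onI) (rule mult_embed_inj, simp_all)
  show "T \<in> snd (mult_embed A) C D ` c_hom A C D"
    if "(\<forall>n. X n \<in> snd (mult_embed A) C D ` c_hom A C D) \<and> T \<in> mult_hom A C D \<and>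
      (\<lambda>n. c_norm (mult_cat A) C D (c_add (mult_cat A) C D (X n) (c_scale (mult_cat A) C D (-1) T))) \<longlonglongrightarrow> 0"
    for X T
    using that by (intro mult_embed_closed[of C D X T]) auto
  fix f assume [simp]: "f \<in> c_hom A C D"
  show "c_norm (mult_cat A) C D (snd (mult_embed A) C D f) = c_norm A C D f"
    by (simp add: mult_embed_norm)
  fix E T assume [simp]: "E \<in> c_obj A"
  show "c_comp (mult_cat A) C D E T (snd (mult_embed A) C D f) \<in> snd (mult_embed A) C E ` c_hom A C E"
    if T: "T \<in> mult_hom A D E" using mult_comp_embed[OF _ _ T, of C f] multL_in[OF T, of C f] by simp
  show "c_comp (mult_cat A) E C D (snd (mult_embed A) C D f) T \<in> snd (mult_embed A) E D ` c_hom A E D"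
    if T: "T \<in> mult_hom A E C" using embed_comp_mult[OF _ _ T, of D f] multR_in[OF T, of D f] by simp
qed

section \<open>Positivity in the multiplier category\<close>

lemma unital_at_mult_cat: "C \<in> c_obj A \<Longrightarrow> unital_at (mult_cat A) C"
  unfolding unital_at_def using pre_cstar_category_mult_cat is_unit_mult_unit by (metis mult_cat_sel(1))

text \<open>Since \<open>positive_el\<close> speaks of quasi-inverses and never of a unit, its
  equations pass along the embedding even where the given category has no unit.\<close>

lemma positive_el_mult_embed:
  assumes [simp]: "C \<in> c_obj A" and p: "positive_el A C p"
  shows "positive_el (mult_cat A) C (snd (mult_embed A) C C p)"
  unfolding positive_el_def
proof (intro conjI allI impI)
  have [simp]: "p \<in> c_hom A C C" and sp: "c_star A C C p = p" using p by (auto simp: positive_el_def)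
  show "snd (mult_embed A) C C p \<in> c_hom (mult_cat A) C C" by (simp add: mult_embed_in)
  show "c_star (mult_cat A) C C (snd (mult_embed A) C C p) = snd (mult_embed A) C C p"
    using mult_embed_simps(2)[of C C p] sp by simp
  fix l :: complex assume "\<not> (l \<in> \<real> \<and> 0 \<le> Re l)"
  then obtain b where b [simp]: "b \<in> c_hom A C C"
    and eq: "c_add A C C (c_add A C C (c_comp A C C C p b) (c_scale A C C (- l) b))
        (c_scale A C C (- (1 / l)) p) = c_zero A C C"
      "c_add A C C (c_add A C C (c_comp A C C C b p) (c_scale A C C (- l) b))
        (c_scale A C C (- (1 / l)) p) = c_zero A C C"
    using p unfolding positive_el_def by blast
  let ?e = "snd (mult_embed A) C C"
  show "\<exists>b\<in>c_hom (mult_cat A) C C.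
      c_add (mult_cat A) C C (c_add (mult_cat A) C C (c_comp (mult_cat A) C C C (?e p) b)
        (c_scale (mult_cat A) C C (- l) b)) (c_scale (mult_cat A) C C (- (1 / l)) (?e p)) = c_zero (mult_cat A) C C \<and>
      c_add (mult_cat A) C C (c_add (mult_cat A) C C (c_comp (mult_cat A) C C C b (?e p))
        (c_scale (mult_cat A) C C (- l) b)) (c_scale (mult_cat A) C C (- (1 / l)) (?e p)) = c_zero (mult_cat A) C C"
  proof (intro bexI[of _ "?e b"] conjI)
    show "?e b \<in> c_hom (mult_cat A) C C" by (simp add: mult_embed_in)
  qed (use arg_cong[OF eq(1), of ?e] arg_cong[OF eq(2), of ?e] in
      \<open>simp_all add: mult_embed_simps mult_embed_zero\<close>)
qed

text \<open>The category itself need not have units, so the estimate is made in its multiplier category.\<close>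

lemma positive_el_norm_mono':
  assumes [simp]: "C \<in> c_obj A" and p: "positive_el A C p" and q: "positive_el A C q"
  shows "c_norm A C C q \<le> c_norm A C C (c_add A C C p q)"
proof -
  have [simp]: "p \<in> c_hom A C C" "q \<in> c_hom A C C" using p q by (auto simp: positive_el_def)
  show ?thesis
    using positive_el_norm_mono[OF unital_at_mult_cat positive_el_mult_embed[OF _ p] positive_el_mult_embed[OF _ q]]
    by (simp add: mult_embed_norm flip: mult_embed_simps)
qed

end

text \<open>Positivity in the given category enters here, at \<open>fst T E x\<close> and at a
  multiple of \<open>x\<close>. Composing with \<open>x\<^sup>*\<close> turns the morphism under the
  norm into a sum of two positive elements, and one factor \<open>\<parallel>x\<parallel>\<close> is
  cancelled at the end.\<close>

lemma mult_square_lower_bound: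
  assumes A: "cstar_cat A" and T: "T \<in> mult_hom A C D" and E: "E \<in> c_obj A" and x: "x \<in> c_hom A E C"
    and s: "s > 0"
  shows "s * c_norm A E C x \<le> c_norm A E C (c_add A E C
    (fst (c_comp (mult_cat A) C D C (c_star (mult_cat A) C D T) T) E x) (c_scale A E C (of_real s) x))"
proof -
  interpret pre_cstar_category A using A by (simp add: cstar_cat_iff)
  have pos: "positive_el A C (c_comp A C D C (c_star A C D f) f)"
    if "C \<in> c_obj A" "D \<in> c_obj A" "f \<in> c_hom A C D" for C D f
    using A that by (simp add: cstar_cat_iff)
  have [simp]: "C \<in> c_obj A" "D \<in> c_obj A" using T by (simp_all add: mult_homD)
  note [simp] = E x multL_in[OF T]
  let ?a = "c_comp (mult_cat A) C D C (c_star (mult_cat A) C D T) T"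
  have a: "?a \<in> mult_hom A C C" by (simp add: mult_comp_in[OF T] mult_star_in[OF T])
  have [simp]: "fst ?a E x \<in> c_hom A E C" using multL_in[OF a E x] .
  let ?w = "c_add A E C (fst ?a E x) (c_scale A E C (of_real s) x)"
  let ?p = "c_comp A E D E (c_star A E D (fst T E x)) (fst T E x)"
  \<comment> \<open>The factor \<open>sqrt s\<close> brings \<open>s x\<^sup>* x\<close> into the
    form \<open>y\<^sup>* y\<close>, to which the positivity axiom applies directly.\<close>
  let ?y = "c_scale A E C (of_real (sqrt s)) x"
  let ?q = "c_comp A E C E (c_star A E C ?y) ?y"
  have q: "?q = c_scale A E E (of_real s) (c_comp A E C E (c_star A E C x) x)"
    using s by (simp add: star_scale comp_scale_left comp_scale_right hom_scale_scale flip: of_real_mult)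
  have "c_norm A E C ?y = sqrt s * c_norm A E C x" using s by (simp add: hom_norm_scale)
  then have "s * c_norm A E C x * c_norm A E C x = c_norm A E E ?q"
    using s norm_star_comp[of E C ?y] by (simp add: power_mult_distrib) (simp add: power2_eq_square)
  also have "\<dots> \<le> c_norm A E E (c_add A E E ?p ?q)"
    by (rule positive_el_norm_mono') (simp_all add: pos)
  also have "c_add A E E ?p ?q = c_comp A E C E (c_star A E C x) ?w"
    unfolding q by (simp add: comp_add_right comp_scale_right star_comp_mult[OF T] del: mult_cat_eval)
  also have "c_norm A E E \<dots> \<le> c_norm A E C ?w * c_norm A E C x"
    using norm_comp[of E C E ?w "c_star A E C x"] by (simp add: norm_star mult.commute del: mult_cat_eval)
  finally have le: "s * c_norm A E C x * c_norm A E C x \<le> c_norm A E C ?w * c_norm A E C x" .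
  show ?thesis
  proof (cases "c_norm A E C x = 0")
    case True
    then show ?thesis by (simp del: mult_cat_eval)
  next
    case False
    then have "0 < c_norm A E C x" using hom_norm_nonneg[of E C x] by (simp add: less_le)
    with le show ?thesis by (rule mult_right_le_imp_le)
  qed
qed

lemma cstar_cat_mult_cat:
  fixes A :: "('o,'m) cstarcat"
  assumes A: "cstar_cat A"
  shows "cstar_cat (mult_cat A)"
proof -
  interpret pre_cstar_category A using A by (simp add: cstar_cat_iff)
  interpret M: pre_cstar_category "mult_cat A" by (rule pre_cstar_category_mult_cat)
  have "positive_el (mult_cat A) C (c_comp (mult_cat A) C D C (c_star (mult_cat A) C D T) T)"
    if [simp]: "C \<in> c_obj A" "D \<in> c_obj A" and T [simp]: "T \<in> mult_hom A C D" for C D T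
  proof (rule positive_elI)
    let ?a = "c_comp (mult_cat A) C D C (c_star (mult_cat A) C D T) T"
    have a: "?a \<in> mult_hom A C C" by (simp add: mult_comp_in mult_star_in)
    show "unital_at (mult_cat A) C" by (simp add: unital_at_mult_cat)
    show "?a \<in> c_hom (mult_cat A) C C" using a by simp
    show "c_star (mult_cat A) C C ?a = ?a"
      by (subst M.star_comp) (simp_all add: M.star_star mult_star_in)
    fix s :: real and m :: "('o,'m) mult" assume s: "s > 0" and "m \<in> c_hom (mult_cat A) C C"
    then have m: "m \<in> mult_hom A C C" by simp
    let ?w = "c_add (mult_cat A) C C (c_comp (mult_cat A) C C C ?a m) (c_scale (mult_cat A) C C (of_real s) m)"
    have w: "?w \<in> mult_hom A C C" by (intro mult_add_in mult_comp_in mult_scale_in a m)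
    \<comment> \<open>The value of \<open>?w\<close> at \<open>h\<close> is
      \<open>T\<^sup>* T + s\<close> applied to \<open>fst m E h\<close>, so the pointwise estimate
      is used at \<open>fst m E h\<close>.\<close>
    have "c_norm (mult_cat A) C C m \<le> c_norm (mult_cat A) C C ?w / s"
    proof (rule mult_norm_least[OF m])
      fix E h assume [simp]: "E \<in> c_obj A" "h \<in> c_hom A E C"
      have "s * c_norm A E C (fst m E h) \<le> c_norm A E C (fst ?w E h)"
        using mult_square_lower_bound[OF A T _ multL_in[OF m] s, of E h] by simp
      also have "\<dots> \<le> c_norm (mult_cat A) C C ?w * c_norm A E C h" using w by (rule mult_norm_bound) simp_all
      finally show "c_norm A E C (fst m E h) \<le> c_norm (mult_cat A) C C ?w / s * c_norm A E C h"
        using s by (simp add: le_divide_eq mult.commute)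
    qed (use s mult_norm_nonneg[OF w] in simp)
    then show "s * c_norm (mult_cat A) C C m \<le> c_norm (mult_cat A) C C ?w"
      using s by (simp add: le_divide_eq mult.commute)
  qed
  then show ?thesis using pre_cstar_category_mult_cat by (simp add: cstar_cat_iff)
qed

section \<open>The universal property\<close>

locale ideal_in_category =
  A: pre_cstar_category A + B: pre_cstar_category B
  for A :: "('o,'m) cstarcat" and B :: "('o2,'m2) cstarcat" +
  fixes i :: "('o,'m,'o2,'m2) cfun"
  assumes ideal: "ideal_inclusion A B i"
begin

abbreviation "iO \<equiv> fst i"
abbreviation "iM \<equiv> snd i"

lemma i_functor: "star_functor A B i"
  and i_bij: "bij_betw iO (c_obj A) (c_obj B)"
  and i_inj: "C \<in> c_obj A \<Longrightarrow> D \<in> c_obj A \<Longrightarrow> inj_on (iM C D) (c_hom A C D)"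
  and i_norm: "C \<in> c_obj A \<Longrightarrow> D \<in> c_obj A \<Longrightarrow> f \<in> c_hom A C D \<Longrightarrow>
    c_norm B (iO C) (iO D) (iM C D f) = c_norm A C D f"
  and i_comp_left: "C \<in> c_obj A \<Longrightarrow> D \<in> c_obj A \<Longrightarrow> E \<in> c_obj A \<Longrightarrow> f \<in> c_hom A C D \<Longrightarrow>
    g \<in> c_hom B (iO D) (iO E) \<Longrightarrow> c_comp B (iO C) (iO D) (iO E) g (iM C D f) \<in> iM C E ` c_hom A C E"
  and i_comp_right: "C \<in> c_obj A \<Longrightarrow> D \<in> c_obj A \<Longrightarrow> E \<in> c_obj A \<Longrightarrow> f \<in> c_hom A C D \<Longrightarrow>
    g \<in> c_hom B (iO E) (iO C) \<Longrightarrow> c_comp B (iO E) (iO C) (iO D) (iM C D f) g \<in> iM E D ` c_hom A E D"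
  by (insert ideal[unfolded ideal_inclusion_def]; elim conjE; simp)+

lemma i_obj [simp]: "C \<in> c_obj A \<Longrightarrow> iO C \<in> c_obj B"
  and i_in [simp]: "C \<in> c_obj A \<Longrightarrow> D \<in> c_obj A \<Longrightarrow> f \<in> c_hom A C D \<Longrightarrow> iM C D f \<in> c_hom B (iO C) (iO D)"
  and i_add: "C \<in> c_obj A \<Longrightarrow> D \<in> c_obj A \<Longrightarrow> f \<in> c_hom A C D \<Longrightarrow> g \<in> c_hom A C D \<Longrightarrow>
     iM C D (c_add A C D f g) = c_add B (iO C) (iO D) (iM C D f) (iM C D g)"
  and i_scale: "C \<in> c_obj A \<Longrightarrow> D \<in> c_obj A \<Longrightarrow> f \<in> c_hom A C D \<Longrightarrow>
     iM C D (c_scale A C D a f) = c_scale B (iO C) (iO D) a (iM C D f)"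
  and i_comp: "C \<in> c_obj A \<Longrightarrow> D \<in> c_obj A \<Longrightarrow> E \<in> c_obj A \<Longrightarrow> f \<in> c_hom A C D \<Longrightarrow> g \<in> c_hom A D E \<Longrightarrow>
     iM C E (c_comp A C D E g f) = c_comp B (iO C) (iO D) (iO E) (iM D E g) (iM C D f)"
  and i_star: "C \<in> c_obj A \<Longrightarrow> D \<in> c_obj A \<Longrightarrow> f \<in> c_hom A C D \<Longrightarrow>
     iM D C (c_star A C D f) = c_star B (iO C) (iO D) (iM C D f)"
  by (insert i_functor[unfolded star_functor_def]; elim conjE; simp)+

lemma i_eqD:
  "iM C D f = iM C D g \<Longrightarrow> C \<in> c_obj A \<Longrightarrow> D \<in> c_obj A \<Longrightarrow> f \<in> c_hom A C D \<Longrightarrow> g \<in> c_hom A C D \<Longrightarrow> f = g"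
  using i_inj by (meson inj_onD)

definition pull_obj :: "'o2 \<Rightarrow> 'o" where
  "pull_obj = inv_into (c_obj A) iO"

lemma pull_obj:
  "C \<in> c_obj A \<Longrightarrow> pull_obj (iO C) = C"
  "X \<in> c_obj B \<Longrightarrow> pull_obj X \<in> c_obj A"
  "X \<in> c_obj B \<Longrightarrow> iO (pull_obj X) = X"
  unfolding pull_obj_def using i_bij
  by (auto simp: bij_betw_def inv_into_into f_inv_into_f)

definition pull :: "'o \<Rightarrow> 'o \<Rightarrow> 'm2 \<Rightarrow> 'm" where
  "pull C D = inv_into (c_hom A C D) (iM C D)"

definition to_mult :: "'o \<Rightarrow> 'o \<Rightarrow> 'm2 \<Rightarrow> ('o,'m) mult" where
  "to_mult C D b =
    (\<lambda>E h. if E \<in> c_obj A \<and> h \<in> c_hom A E C then pull E D (c_comp B (iO E) (iO C) (iO D) b (iM E C h)) else undefined,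
     \<lambda>E g. if E \<in> c_obj A \<and> g \<in> c_hom A D E then pull C E (c_comp B (iO C) (iO D) (iO E) (iM D E g) b) else undefined)"

text \<open>The ideal property puts the compositions in the image of \<open>iM\<close>, so the
  chosen preimages are genuine. Later arguments compare values after applying the injective
  \<open>iM\<close>, that is, inside \<open>B\<close>.\<close>

lemma to_mult_eval:
  assumes "C \<in> c_obj A" "D \<in> c_obj A" "E \<in> c_obj A" "b \<in> c_hom B (iO C) (iO D)"
  shows "h \<in> c_hom A E C \<Longrightarrow> fst (to_mult C D b) E h \<in> c_hom A E D"
    and "h \<in> c_hom A E C \<Longrightarrow> iM E D (fst (to_mult C D b) E h) = c_comp B (iO E) (iO C) (iO D) b (iM E C h)"
    and "g \<in> c_hom A D E \<Longrightarrow> snd (to_mult C D b) E g \<in> c_hom A C E"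
    and "g \<in> c_hom A D E \<Longrightarrow> iM C E (snd (to_mult C D b) E g) = c_comp B (iO C) (iO D) (iO E) (iM D E g) b"
  using assms i_comp_left i_comp_right
  by (simp_all add: to_mult_def pull_def inv_into_into f_inv_into_f)

text \<open>Compatibility is associativity in \<open>B\<close>; the bound by the norm of
  \<open>b\<close> uses that the inclusion is isometric.\<close>

lemma to_mult_in:
  assumes [simp]: "C \<in> c_obj A" "D \<in> c_obj A" "b \<in> c_hom B (iO C) (iO D)"
  shows "to_mult C D b \<in> mult_hom A C D"
proof (rule A.mult_homI[where K = "c_norm B (iO C) (iO D) b"])
  note [simp] = to_mult_eval
  fix E h assume [simp]: "E \<in> c_obj A" "h \<in> c_hom A E C"
  have "c_norm A E D (fst (to_mult C D b) E h) = c_norm B (iO E) (iO D) (c_comp B (iO E) (iO C) (iO D) b (iM E C h))"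
    using i_norm[of E D "fst (to_mult C D b) E h"] by simp
  also have "\<dots> \<le> c_norm B (iO C) (iO D) b * c_norm B (iO E) (iO C) (iM E C h)"
    by (rule B.norm_comp) simp_all
  finally show "c_norm A E D (fst (to_mult C D b) E h) \<le> c_norm B (iO C) (iO D) b * c_norm A E C h"
    by (simp add: i_norm)
next
  note [simp] = to_mult_eval
  fix E F f g
  assume [simp]: "E \<in> c_obj A" "F \<in> c_obj A" "f \<in> c_hom A F C" "g \<in> c_hom A D E"
  show "c_comp A F D E g (fst (to_mult C D b) F f) = c_comp A F C E (snd (to_mult C D b) E g) f"
    by (rule i_eqD[of F E]) (simp_all add: i_comp B.comp_assoc)
qed (simp_all add: to_mult_eval, auto simp: to_mult_def)

definition classifying :: "('o2,'m2,'o,('o,'m) mult) cfun" where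
  "classifying = (pull_obj, \<lambda>X Y. to_mult (pull_obj X) (pull_obj Y))"

text \<open>Injectivity of \<open>iM\<close> reduces each law for \<open>to_mult\<close> to an
  equation between morphisms of \<open>B\<close>.\<close>

lemma to_mult_eqI:
  assumes "C \<in> c_obj A" "D \<in> c_obj A" "b \<in> c_hom B (iO C) (iO D)" "T \<in> mult_hom A C D"
    and "\<And>E h. E \<in> c_obj A \<Longrightarrow> h \<in> c_hom A E C \<Longrightarrow>
      iM E D (fst T E h) = c_comp B (iO E) (iO C) (iO D) b (iM E C h)"
  shows "to_mult C D b = T"
proof (rule A.mult_eqI[OF to_mult_in assms(4)])
  fix E h assume "E \<in> c_obj A" "h \<in> c_hom A E C"
  then show "fst (to_mult C D b) E h = fst T E h"
    using assms multL_in[OF assms(4)] by (intro i_eqD[of E D]) (simp_all add: to_mult_eval)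
qed (use assms in auto)

lemma to_mult_functorial:
  assumes [simp]: "C \<in> c_obj A" "D \<in> c_obj A" and b [simp]: "b \<in> c_hom B (iO C) (iO D)"
  shows "to_mult C D (c_scale B (iO C) (iO D) a b) = c_scale (mult_cat A) C D a (to_mult C D b)"
    and "to_mult D C (c_star B (iO C) (iO D) b) = c_star (mult_cat A) C D (to_mult C D b)"
    and "b' \<in> c_hom B (iO C) (iO D) \<Longrightarrow> to_mult C D (c_add B (iO C) (iO D) b b')
      = c_add (mult_cat A) C D (to_mult C D b) (to_mult C D b')"
    and "E \<in> c_obj A \<Longrightarrow> d \<in> c_hom B (iO D) (iO E) \<Longrightarrow> to_mult C E (c_comp B (iO C) (iO D) (iO E) d b)
      = c_comp (mult_cat A) C D E (to_mult D E d) (to_mult C D b)"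
proof -
  note [simp] = to_mult_in to_mult_eval A.mult_add_in A.mult_scale_in A.mult_comp_in A.mult_star_in
  show "to_mult C D (c_scale B (iO C) (iO D) a b) = c_scale (mult_cat A) C D a (to_mult C D b)"
    by (rule to_mult_eqI) (simp_all add: i_scale B.comp_scale_left)
  show "to_mult D C (c_star B (iO C) (iO D) b) = c_star (mult_cat A) C D (to_mult C D b)"
    by (rule to_mult_eqI) (simp_all add: i_star B.star_comp B.star_star)
  show "to_mult C D (c_add B (iO C) (iO D) b b') = c_add (mult_cat A) C D (to_mult C D b) (to_mult C D b')"
    if [simp]: "b' \<in> c_hom B (iO C) (iO D)"
    by (rule to_mult_eqI) (simp_all add: i_add B.comp_add_left)
  show "to_mult C E (c_comp B (iO C) (iO D) (iO E) d b) = c_comp (mult_cat A) C D E (to_mult D E d) (to_mult C D b)"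
    if [simp]: "E \<in> c_obj A" "d \<in> c_hom B (iO D) (iO E)"
    by (rule to_mult_eqI) (simp_all add: B.comp_assoc)
qed

lemma to_mult_embed:
  assumes [simp]: "C \<in> c_obj A" "D \<in> c_obj A" "f \<in> c_hom A C D"
  shows "to_mult C D (iM C D f) = snd (mult_embed A) C D f"
  by (rule to_mult_eqI) (simp_all add: A.mult_embed_in i_comp)

lemma to_mult_unit:
  assumes [simp]: "C \<in> c_obj A" and u: "is_unit B (iO C) u"
  shows "to_mult C C u = A.mult_unit C"
  by (rule to_mult_eqI) (use u in \<open>simp_all add: A.mult_unit_in is_unit_def\<close>)

lemma classifying_star_functor: "star_functor B (mult_cat A) classifying"
  unfolding star_functor_def classifying_def fst_conv snd_conv mult_cat_sel
proof (intro conjI ballI allI)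
  fix X Y Z b c a
  note [simp] = pull_obj
  assume [simp]: "X \<in> c_obj B"
  then show "pull_obj X \<in> c_obj A" by simp
  assume [simp]: "Y \<in> c_obj B" and [simp]: "b \<in> c_hom B X Y"
  show "to_mult (pull_obj X) (pull_obj Y) b \<in> mult_hom A (pull_obj X) (pull_obj Y)"
    by (simp add: to_mult_in)
  show "to_mult (pull_obj X) (pull_obj Y) (c_scale B X Y a b)
      = c_scale (mult_cat A) (pull_obj X) (pull_obj Y) a (to_mult (pull_obj X) (pull_obj Y) b)"
    using to_mult_functorial(1)[of "pull_obj X" "pull_obj Y" b a] by simp
  show "to_mult (pull_obj Y) (pull_obj X) (c_star B X Y b)
      = c_star (mult_cat A) (pull_obj X) (pull_obj Y) (to_mult (pull_obj X) (pull_obj Y) b)"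
    using to_mult_functorial(2)[of "pull_obj X" "pull_obj Y" b] by simp
  show "to_mult (pull_obj X) (pull_obj Y) (c_add B X Y b c)
      = c_add (mult_cat A) (pull_obj X) (pull_obj Y) (to_mult (pull_obj X) (pull_obj Y) b)
        (to_mult (pull_obj X) (pull_obj Y) c)" if "c \<in> c_hom B X Y"
    using to_mult_functorial(3)[of "pull_obj X" "pull_obj Y" b c] that by simp
  show "to_mult (pull_obj X) (pull_obj Z) (c_comp B X Y Z c b)
      = c_comp (mult_cat A) (pull_obj X) (pull_obj Y) (pull_obj Z) (to_mult (pull_obj Y) (pull_obj Z) c)
        (to_mult (pull_obj X) (pull_obj Y) b)" if "Z \<in> c_obj B" "c \<in> c_hom B Y Z"
    using to_mult_functorial(4)[of "pull_obj X" "pull_obj Y" b "pull_obj Z" c] that by simp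
qed

lemma classifying_unital: "unital_functor B (mult_cat A) classifying"
  unfolding unital_functor_def classifying_def fst_conv snd_conv
proof (intro ballI allI impI)
  fix X u assume "X \<in> c_obj B" "is_unit B X u"
  then show "is_unit (mult_cat A) (pull_obj X) (to_mult (pull_obj X) (pull_obj X) u)"
    using A.is_unit_mult_unit[of "pull_obj X"] to_mult_unit[of "pull_obj X" u] by (simp add: pull_obj)
qed

lemma classifying_extends: "functor_eq_on A (functor_comp i classifying) (mult_embed A)"
  unfolding functor_eq_on_def functor_comp_def classifying_def
  by (simp add: pull_obj to_mult_embed)

text \<open>A competitor \<open>G\<close> is prescribed on the ideal, and composing \<open>b\<close>
  with a morphism of the ideal stays there. Hence the composite of the image of \<open>b\<close>
  with an embedded \<open>h\<close> is known, and injectivity of the embedding recovers the left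
  component at \<open>h\<close>.\<close>

lemma classifying_unique:
  assumes G: "star_functor B (mult_cat A) G"
    and ext: "functor_eq_on A (functor_comp i G) (mult_embed A)"
  shows "functor_eq_on B classifying G"
proof -
  have G_obj: "fst G (iO C) = C" if "C \<in> c_obj A" for C
    using ext that by (simp add: functor_eq_on_def functor_comp_def)
  have G_embed: "snd G (iO C) (iO D) (iM C D f) = snd (mult_embed A) C D f"
    if "C \<in> c_obj A" "D \<in> c_obj A" "f \<in> c_hom A C D" for C D f
    using ext that by (simp add: functor_eq_on_def functor_comp_def)
  have G_in: "snd G (iO C) (iO D) b \<in> mult_hom A C D"
    if "C \<in> c_obj A" "D \<in> c_obj A" "b \<in> c_hom B (iO C) (iO D)" for C D b
  proof -
    have "snd G (iO C) (iO D) b \<in> c_hom (mult_cat A) (fst G (iO C)) (fst G (iO D))"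
      using G that unfolding star_functor_def by (meson i_obj)
    then show ?thesis using that by (simp add: G_obj)
  qed
  have G_comp: "snd G (iO C) (iO E) (c_comp B (iO C) (iO D) (iO E) g f)
      = c_comp (mult_cat A) C D E (snd G (iO D) (iO E) g) (snd G (iO C) (iO D) f)"
    if "C \<in> c_obj A" "D \<in> c_obj A" "E \<in> c_obj A" "f \<in> c_hom B (iO C) (iO D)" "g \<in> c_hom B (iO D) (iO E)"
    for C D E f g
  proof -
    have "snd G (iO C) (iO E) (c_comp B (iO C) (iO D) (iO E) g f)
      = c_comp (mult_cat A) (fst G (iO C)) (fst G (iO D)) (fst G (iO E)) (snd G (iO D) (iO E) g) (snd G (iO C) (iO D) f)"
      using G that unfolding star_functor_def by (meson i_obj)
    then show ?thesis using that by (simp add: G_obj)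
  qed
  have eq: "to_mult C D b = snd G (iO C) (iO D) b"
    if [simp]: "C \<in> c_obj A" "D \<in> c_obj A" "b \<in> c_hom B (iO C) (iO D)" for C D b
  proof (rule to_mult_eqI)
    show T: "snd G (iO C) (iO D) b \<in> mult_hom A C D" by (simp add: G_in)
    fix E h assume [simp]: "E \<in> c_obj A" "h \<in> c_hom A E C"
    obtain f where f [simp]: "f \<in> c_hom A E D" and f_eq: "c_comp B (iO E) (iO C) (iO D) b (iM E C h) = iM E D f"
      using i_comp_left[of E C D h b] by auto
    have "snd (mult_embed A) E D (fst (snd G (iO C) (iO D) b) E h)
        = c_comp (mult_cat A) E C D (snd G (iO C) (iO D) b) (snd (mult_embed A) E C h)"
      using T by (simp add: A.mult_comp_embed)
    also have "\<dots> = snd G (iO E) (iO D) (iM E D f)"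
      by (simp add: G_comp G_embed flip: f_eq)
    also have "\<dots> = snd (mult_embed A) E D f" by (simp add: G_embed)
    finally have "fst (snd G (iO C) (iO D) b) E h = f"
      using multL_in[OF T, of E h] by (intro A.mult_embed_inj[of E D]) simp_all
    then show "iM E D (fst (snd G (iO C) (iO D) b) E h) = c_comp B (iO E) (iO C) (iO D) b (iM E C h)"
      by (simp add: f_eq)
  qed simp_all
  show ?thesis
    unfolding functor_eq_on_def classifying_def fst_conv snd_conv
  proof (intro conjI ballI)
    fix X Y b assume X: "X \<in> c_obj B"
    then show "pull_obj X = fst G X" using G_obj[of "pull_obj X"] by (simp add: pull_obj)
    assume "Y \<in> c_obj B" "b \<in> c_hom B X Y"
    then show "to_mult (pull_obj X) (pull_obj Y) b = snd G X Y b"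
      using X eq[of "pull_obj X" "pull_obj Y" b] by (simp add: pull_obj)
  qed
qed

end

theorem theorem3p4:
  fixes A :: "('o,'m) cstarcat"
    and B :: "('o2,'m2) cstarcat"
    and i :: "('o,'m,'o2,'m2) cfun"
  assumes "cstar_cat A"
  shows "cstar_cat (mult_cat A) \<and> unital (mult_cat A) \<and>
    (\<forall>C\<in>c_obj A. \<forall>D\<in>c_obj A. \<forall>LR\<in>mult_hom A C D.
        mult_normL A C D (fst LR) = mult_normR A C D (snd LR)) \<and>
    ideal_inclusion A (mult_cat A) (mult_embed A) \<and>
    (cstar_cat B \<and> unital B \<and> ideal_inclusion A B i \<longrightarrow>
      (\<exists>F. star_functor B (mult_cat A) F \<and> unital_functor B (mult_cat A) F \<and>
           functor_eq_on A (functor_comp i F) (mult_embed A) \<and>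
           (\<forall>G. star_functor B (mult_cat A) G \<and> unital_functor B (mult_cat A) G \<and>
                functor_eq_on A (functor_comp i G) (mult_embed A) \<longrightarrow> functor_eq_on B F G)))"
proof -
  interpret pre_cstar_category A using assms by (simp add: cstar_cat_iff)
  have "\<exists>F. star_functor B (mult_cat A) F \<and> unital_functor B (mult_cat A) F \<and>
      functor_eq_on A (functor_comp i F) (mult_embed A) \<and>
      (\<forall>G. star_functor B (mult_cat A) G \<and> unital_functor B (mult_cat A) G \<and>
        functor_eq_on A (functor_comp i G) (mult_embed A) \<longrightarrow> functor_eq_on B F G)"
    if "cstar_cat B" "ideal_inclusion A B i"
  proof -
    interpret ideal_in_category A B i
      using that by (intro ideal_in_category.intro ideal_in_category_axioms.intro
          pre_cstar_category_axioms) (simp_all add: cstar_cat_iff)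
    show ?thesis
      using classifying_star_functor classifying_unital classifying_extends classifying_unique by blast
  qed
  then show ?thesis
    using cstar_cat_mult_cat[OF assms] unital_mult_cat mult_normL_eq_mult_normR mult_embed_ideal_inclusion
    by blast
qed

end
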